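(* Let $p\equiv1\pmod8$ be prime. Choose integers $a,b>0$ with $p=a^2-2b^2$, and put $\epsilon=1+\sqrt2$, $\alpha=a+b\sqrt2$, $F_p=\mathbb Q(i,\sqrt2,\sqrt p)$. Let $T_p$ be the unique quartic subfield of $\mathbb Q(\zeta_p)$, and define $$N_p=F_p(\sqrt\epsilon,\sqrt[4]p,\sqrt\alpha),\quad A_p=\mathbb Q(\zeta_{16})T_p,\quad M_p=A_pN_p,\quad B_p=\mathbb Q(\zeta_{16p}).$$ These fields are Galois over $\mathbb Q$, and $$[N_p:F_p]=8,\qquad N_p\cap A_p=N_p\cap B_p=F_p .$$ In particular $[M_p:\mathbb Q]=256$ and $[B_pN_p:\mathbb Q]=64(p-1)$. For $G_p=\mathrm{Gal}(M_p/\mathbb Q)$, its center is $H_p=\mathrm{Gal}(M_p/F_p)\cong(\mathbb Z/2\mathbb Z)^5$, and its commutator subgroup has order $8$. The group $G_p$ has $32$ conjugacy classes of size $1$ and $56$ conjugacy classes of size $4$ (these are all its conjugacy classes). For $\mathrm{Gal}(B_pN_p/\mathbb Q)$, the corresponding numbers of classes of size $1$ and of size $4$ are $8(p-1)$ and $14(p-1)$.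
   Context: $\zeta_m$ denotes a primitive $m$-th root of unity. All fields are subfields of a fixed algebraic closure of $\mathbb Q$. Integers $a,b>0$ with $p=a^2-2b^2$ exist for $p\equiv1\pmod8$. *)

theory Defs
  imports Complex_Main "HOL-Algebra.Algebra" "HOL-Algebra.Algebraic_Closure_Type"
begin

section \<open>Number fields and their Galois groups\<close>

text \<open>All fields are subfields of the complex numbers, represented by their carrier sets; every
  field below is generated by algebraic numbers, so the ambient algebraic closure of \<open>\<rat>\<close> is the one
  inside \<open>\<complex>\<close>.\<close>

abbreviation CC :: "complex ring" where
  "CC \<equiv> ring_of_type_algebra"

definition adjoin :: "complex set \<Rightarrow> complex set \<Rightarrow> complex set" where
  "adjoin K S = generate_field CC (K \<union> S)"

definition compositum :: "complex set \<Rightarrow> complex set \<Rightarrow> complex set" where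
  "compositum K L = generate_field CC (K \<union> L)"

definition has_degree :: "complex set \<Rightarrow> complex set \<Rightarrow> nat \<Rightarrow> bool" where
  "has_degree L K n \<longleftrightarrow> subfield K CC \<and> subfield L CC \<and> K \<subseteq> L \<and> ring.dimension CC n K L"

text \<open>As usual for \<^const>\<open>BijGroup\<close>, automorphisms are extensional functions on \<open>L\<close>.\<close>

definition Gal :: "complex set \<Rightarrow> complex set \<Rightarrow> (complex \<Rightarrow> complex) monoid" where
  "Gal L K = BijGroup L \<lparr>carrier :=
     {\<sigma> \<in> Bij L. \<sigma> \<in> ring_hom (CC\<lparr>carrier := L\<rparr>) (CC\<lparr>carrier := L\<rparr>) \<and> (\<forall>x\<in>K. \<sigma> x = x)}\<rparr>"

definition finite_galois :: "complex set \<Rightarrow> complex set \<Rightarrow> bool" where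
  "finite_galois L K \<longleftrightarrow>
     subfield K CC \<and> subfield L CC \<and> K \<subseteq> L \<and> ring.finite_dimension CC K L \<and>
     {x \<in> L. \<forall>\<sigma>\<in>carrier (Gal L K). \<sigma> x = x} = K"


section \<open>Group theory\<close>

definition group_center :: "('a, 'b) monoid_scheme \<Rightarrow> 'a set" where
  "group_center G = {z \<in> carrier G. \<forall>g\<in>carrier G. z \<otimes>\<^bsub>G\<^esub> g = g \<otimes>\<^bsub>G\<^esub> z}"

definition conj_classes :: "('a, 'b) monoid_scheme \<Rightarrow> 'a set set" where
  "conj_classes G =
     orbits G (carrier G) (\<lambda>g. \<lambda>h\<in>carrier G. g \<otimes>\<^bsub>G\<^esub> h \<otimes>\<^bsub>G\<^esub> inv\<^bsub>G\<^esub> g)"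


section \<open>The fields attached to \<open>p = a\<^sup>2 - 2 b\<^sup>2\<close>\<close>

definition cyclotomic :: "nat \<Rightarrow> complex set" where
  "cyclotomic m = adjoin \<rat> {cis (2 * pi / real m)}"

text \<open>Both numbers are positive reals (when \<open>a, b > 0\<close>), so \<^const>\<open>sqrt\<close> yields true square roots.\<close>

definition epsilon :: real where
  "epsilon = 1 + sqrt 2"

definition alpha :: "int \<Rightarrow> int \<Rightarrow> real" where
  "alpha a b = of_int a + of_int b * sqrt 2"

definition F_field :: "nat \<Rightarrow> complex set" where
  "F_field p = adjoin \<rat> {\<i>, of_real (sqrt 2), of_real (sqrt (real p))}"

definition T_field :: "nat \<Rightarrow> complex set" where
  "T_field p = (THE T. T \<subseteq> cyclotomic p \<and> has_degree T \<rat> 4)"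

definition N_field :: "nat \<Rightarrow> int \<Rightarrow> int \<Rightarrow> complex set" where
  "N_field p a b = adjoin (F_field p)
     {of_real (sqrt epsilon), of_real (root 4 (real p)), of_real (sqrt (alpha a b))}"

definition A_field :: "nat \<Rightarrow> complex set" where
  "A_field p = compositum (cyclotomic 16) (T_field p)"

definition M_field :: "nat \<Rightarrow> int \<Rightarrow> int \<Rightarrow> complex set" where
  "M_field p a b = compositum (A_field p) (N_field p a b)"

definition B_field :: "nat \<Rightarrow> complex set" where
  "B_field p = cyclotomic (16 * p)"

definition BN_field :: "nat \<Rightarrow> int \<Rightarrow> int \<Rightarrow> complex set" where
  "BN_field p a b = compositum (B_field p) (N_field p a b)"

end

theory Submission
  imports Defs "HOL-Number_Theory.Number_Theory"
begin

text \<open>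
  Three facts carry the proof. Write \<open>K = B\<^sub>p N\<^sub>p\<close>, and for an automorphism \<open>\<sigma>\<close> of \<open>K\<close> let its
  \<^emph>\<open>bits\<close> record whether \<open>\<sigma>\<close> moves \<open>\<i>\<close>, \<open>\<surd>2\<close> and \<open>\<surd>p\<close>, that is, the image of \<open>\<sigma>\<close> in
  \<open>Gal(F\<^sub>p/\<rat>) = (\<int>/2)\<^sup>3\<close>.

  First, the commutators can be computed. The conjugates of the three radicands satisfy
  \<open>\<epsilon>' = -1/\<epsilon>\<close>, \<open>(\<surd>p)' = -\<surd>p\<close> and \<open>\<alpha>' = p/\<alpha>\<close>. So \<open>\<surd>\<epsilon>\<close> is sent to \<open>\<plusminus>\<surd>\<epsilon>\<close> or \<open>\<plusminus>\<i>/\<surd>\<epsilon>\<close>, according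
  to the bit of \<open>\<surd>2\<close>; the fourth root of \<open>p\<close> is multiplied by \<open>\<plusminus>1\<close> or \<open>\<plusminus>\<i>\<close>, according to the bit of
  \<open>\<surd>p\<close>; and \<open>\<surd>\<alpha>\<close> is sent to \<open>\<plusminus>\<surd>\<alpha>\<close> or \<open>\<plusminus>\<surd>p/\<surd>\<alpha>\<close>, according to the bit of \<open>\<surd>2\<close>. It follows that
  a commutator changes the signs of these three roots by the three \<open>2 \<times> 2\<close> minors of the bit vectors
  of its two entries, in other words by their wedge product. Every vector of \<open>(\<int>/2)\<^sup>3\<close> is a wedge
  product, so every pattern of signs comes from a commutator. Commutators act trivially on every
  abelian field. Hence adjoining the three roots to any field between \<open>F\<^sub>p\<close> and \<open>B\<^sub>p\<close> gives
  degree 8, and \<open>N\<^sub>p \<inter> B\<^sub>p = F\<^sub>p\<close>.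

  Secondly, the group theory is formal (locale \<open>wedge_group\<close>): in a finite group with a
  surjection onto \<open>(\<int>/2)\<^sup>3\<close> whose commutators are given by the wedge product, two elements commute
  exactly if their bit vectors are linearly dependent. The centre is therefore the kernel \<open>Z\<close> of the
  surjection, the commutators form a group of order 8, and an element outside \<open>Z\<close> has a centralizer
  of order \<open>2|Z|\<close>, hence a class of size 4. This applies to \<open>Gal(M\<^sub>p/\<rat>)\<close> and to \<open>Gal(K/\<rat>)\<close>.

  Thirdly, everything takes place inside \<open>K\<close>, so the arithmetic input is the group
  \<open>Gal(\<rat>(\<zeta>\<^sub>1\<^sub>6\<^sub>p)/\<rat>)\<close>. It has order \<open>8(p-1)\<close> because \<open>\<zeta>\<close> and \<open>\<zeta>\<^sup>k\<close> are conjugate for \<open>k\<close> prime to the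
  order (\<open>conjugate_root_of_unity\<close>, after Landau). Automorphisms extend along quadratic
  extensions, the commutators supply a further factor 8, and \<open>[K:\<rat>] \<le> 64(p-1)\<close> is clear from the
  tower; so \<open>K/\<rat>\<close> is Galois of degree \<open>64(p-1)\<close>. All other degrees and intersections are read off from
  the Galois correspondence for \<open>K/\<rat>\<close>, which is derived from the linear independence of
  embeddings. The field \<open>T\<^sub>p\<close> appears as the fixed field of the automorphisms that act on \<open>\<zeta>\<^sub>p\<close> through
  fourth powers modulo \<open>p\<close>.
\<close>


section \<open>Subfields of the complex numbers and their embeddings\<close>

lemma carrier_CC [simp]: "carrier CC = UNIV"
  and mult_CC [simp]: "x \<otimes>\<^bsub>CC\<^esub> y = x * y"
  and add_CC [simp]: "x \<oplus>\<^bsub>CC\<^esub> y = x + y"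
  and one_CC [simp]: "\<one>\<^bsub>CC\<^esub> = 1"
  and zero_CC [simp]: "\<zero>\<^bsub>CC\<^esub> = 0"
  by (simp_all add: ring_of_type_algebra_def)

lemma field_CC: "field CC"
  by (rule field_from_type_algebra)

interpretation CC: ring CC
  by (rule ring_from_type_algebra)

lemma uminus_CC [simp]: "\<ominus>\<^bsub>CC\<^esub> x = - x"
  by (rule CC.minus_equality) simp_all

lemma inverse_CC [simp]: "x \<noteq> 0 \<Longrightarrow> inv\<^bsub>CC\<^esub> x = inverse x"
  by (rule comm_monoid.comm_inv_char[OF cring.axioms(2)[OF cring_from_type_algebra]]) simp_all

lemma subfield_CC_I:
  assumes "1 \<in> K" "\<And>x y. x \<in> K \<Longrightarrow> y \<in> K \<Longrightarrow> x + y \<in> K" "\<And>x. x \<in> K \<Longrightarrow> - x \<in> K"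
    "\<And>x y. x \<in> K \<Longrightarrow> y \<in> K \<Longrightarrow> x * y \<in> K"
    "\<And>x. x \<in> K \<Longrightarrow> x \<noteq> 0 \<Longrightarrow> inverse x \<in> K"
  shows "subfield K CC"
  by (rule field.subfieldI'[OF field_CC]) (auto intro!: CC.subringI assms)

lemma subfield_1: "subfield K CC \<Longrightarrow> 1 \<in> K"
  using subringE(3)[OF subfieldE(1)] by fastforce

lemma subfield_0: "subfield K CC \<Longrightarrow> 0 \<in> K"
  using subringE(2)[OF subfieldE(1)] by fastforce

lemma subfield_add: "subfield K CC \<Longrightarrow> x \<in> K \<Longrightarrow> y \<in> K \<Longrightarrow> x + y \<in> K"
  using subringE(7)[OF subfieldE(1)] by fastforce

lemma subfield_minus: "subfield K CC \<Longrightarrow> x \<in> K \<Longrightarrow> - x \<in> K"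
  using subringE(5)[OF subfieldE(1)] by fastforce

lemma subfield_mult: "subfield K CC \<Longrightarrow> x \<in> K \<Longrightarrow> y \<in> K \<Longrightarrow> x * y \<in> K"
  using subringE(6)[OF subfieldE(1)] by fastforce

lemma subfield_inverse: "subfield K CC \<Longrightarrow> x \<in> K \<Longrightarrow> inverse x \<in> K"
  using CC.subfield_m_inv(1)[of K x] by (cases "x = 0") auto

lemma subfield_diff: "subfield K CC \<Longrightarrow> x \<in> K \<Longrightarrow> y \<in> K \<Longrightarrow> x - y \<in> K"
  using subfield_add[of K x "- y"] subfield_minus by auto

lemma subfield_divide: "subfield K CC \<Longrightarrow> x \<in> K \<Longrightarrow> y \<in> K \<Longrightarrow> x / y \<in> K"
  using subfield_mult[of K x "inverse y"] subfield_inverse by (auto simp: divide_inverse)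

lemma subfield_power: "subfield K CC \<Longrightarrow> x \<in> K \<Longrightarrow> x ^ n \<in> K"
  by (induction n) (auto intro: subfield_1 subfield_mult)

lemma subfield_of_nat: "subfield K CC \<Longrightarrow> of_nat n \<in> K"
  by (induction n) (auto intro: subfield_0 subfield_1 subfield_add)

lemma subfield_of_int: "subfield K CC \<Longrightarrow> of_int n \<in> K"
  by (cases n rule: int_cases2) (auto intro: subfield_of_nat subfield_minus)

lemma subfield_of_rat: "subfield K CC \<Longrightarrow> of_rat q \<in> K"
  by (cases q) (auto simp: of_rat_rat intro: subfield_of_int subfield_divide)

lemma subfield_sum: "subfield K CC \<Longrightarrow> (\<And>i. i \<in> I \<Longrightarrow> f i \<in> K) \<Longrightarrow> sum f I \<in> K"
  by (induction I rule: infinite_finite_induct) (auto intro: subfield_0 subfield_add)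

lemma subfield_prod: "subfield K CC \<Longrightarrow> (\<And>i. i \<in> I \<Longrightarrow> f i \<in> K) \<Longrightarrow> prod f I \<in> K"
  by (induction I rule: infinite_finite_induct) (auto intro: subfield_1 subfield_mult)

lemma Rats_subset_subfield: "subfield K CC \<Longrightarrow> \<rat> \<subseteq> K"
  by (auto simp: Rats_def intro: subfield_of_rat)

lemma subfield_Rats: "subfield \<rat> CC"
  by (rule subfield_CC_I) auto

lemmas subfield_intros = subfield_0 subfield_1 subfield_add subfield_minus subfield_mult
  subfield_inverse subfield_diff subfield_divide subfield_power subfield_of_nat subfield_of_int
  subfield_of_rat subfield_sum subfield_prod

lemma subfield_adjoin: "subfield (adjoin K S) CC"
  unfolding adjoin_def by (rule field.generate_field_is_subfield[OF field_CC]) simp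

lemma subfield_compositum: "subfield (compositum K L) CC"
  unfolding compositum_def by (rule field.generate_field_is_subfield[OF field_CC]) simp

lemma adjoin_base: "K \<subseteq> adjoin K S" and adjoin_gens: "S \<subseteq> adjoin K S"
  unfolding adjoin_def by (auto intro: generate_field.incl)

lemma compositum_upper: "K \<subseteq> compositum K L" "L \<subseteq> compositum K L"
  unfolding compositum_def by (auto intro: generate_field.incl)

lemma adjoin_least: "subfield L CC \<Longrightarrow> K \<subseteq> L \<Longrightarrow> S \<subseteq> L \<Longrightarrow> adjoin K S \<subseteq> L"
  unfolding adjoin_def by (rule field.generate_field_min_subfield1[OF field_CC]) auto

lemma compositum_least: "subfield M CC \<Longrightarrow> K \<subseteq> M \<Longrightarrow> L \<subseteq> M \<Longrightarrow> compositum K L \<subseteq> M"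
  unfolding compositum_def by (rule field.generate_field_min_subfield1[OF field_CC]) auto

text \<open>Embeddings are total functions of which only the values on the field matter. One function thus
  embeds all fields of a tower at once.\<close>

definition hom_on :: "complex set \<Rightarrow> (complex \<Rightarrow> complex) \<Rightarrow> bool" where
  "hom_on L \<sigma> \<longleftrightarrow> \<sigma> 1 = 1 \<and>
     (\<forall>x\<in>L. \<forall>y\<in>L. \<sigma> (x + y) = \<sigma> x + \<sigma> y \<and> \<sigma> (x * y) = \<sigma> x * \<sigma> y)"

lemma hom_on_1: "hom_on L \<sigma> \<Longrightarrow> \<sigma> 1 = 1"
  and hom_on_add: "hom_on L \<sigma> \<Longrightarrow> x \<in> L \<Longrightarrow> y \<in> L \<Longrightarrow> \<sigma> (x + y) = \<sigma> x + \<sigma> y"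
  and hom_on_mult: "hom_on L \<sigma> \<Longrightarrow> x \<in> L \<Longrightarrow> y \<in> L \<Longrightarrow> \<sigma> (x * y) = \<sigma> x * \<sigma> y"
  by (auto simp: hom_on_def)

lemma hom_on_subset: "hom_on L \<sigma> \<Longrightarrow> K \<subseteq> L \<Longrightarrow> hom_on K \<sigma>"
  by (auto simp: hom_on_def)

context
  fixes L \<sigma> assumes L: "subfield L CC" and h: "hom_on L \<sigma>"
begin

lemma hom_on_0: "\<sigma> 0 = 0"
  using hom_on_add[OF h, of 0 0] subfield_0[OF L] by simp

lemma hom_on_minus: "x \<in> L \<Longrightarrow> \<sigma> (- x) = - \<sigma> x"
  using hom_on_add[OF h, of x "- x"] subfield_minus[OF L] hom_on_0
  by (simp add: eq_neg_iff_add_eq_0 add.commute)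

lemma hom_on_diff: "x \<in> L \<Longrightarrow> y \<in> L \<Longrightarrow> \<sigma> (x - y) = \<sigma> x - \<sigma> y"
  using hom_on_add[OF h, of x "- y"] subfield_minus[OF L] hom_on_minus by simp

lemma hom_on_nonzero: "x \<in> L \<Longrightarrow> x \<noteq> 0 \<Longrightarrow> \<sigma> x \<noteq> 0"
  using hom_on_mult[OF h, of x "inverse x"] subfield_inverse[OF L] hom_on_1[OF h] by auto

lemma hom_on_inj: "x \<in> L \<Longrightarrow> y \<in> L \<Longrightarrow> \<sigma> x = \<sigma> y \<Longrightarrow> x = y"
  using hom_on_nonzero[of "x - y"] hom_on_diff[of x y] subfield_diff[OF L, of x y] by auto

lemma hom_on_inverse: "x \<in> L \<Longrightarrow> \<sigma> (inverse x) = inverse (\<sigma> x)"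
  using hom_on_mult[OF h, of x "inverse x"] subfield_inverse[OF L] hom_on_1[OF h] hom_on_0
    inverse_unique[of "\<sigma> x" "\<sigma> (inverse x)"]
  by (cases "x = 0") auto

lemma hom_on_divide: "x \<in> L \<Longrightarrow> y \<in> L \<Longrightarrow> \<sigma> (x / y) = \<sigma> x / \<sigma> y"
  using hom_on_mult[OF h, of x "inverse y"] subfield_inverse[OF L] hom_on_inverse
  by (simp add: divide_inverse)

lemma hom_on_power: "x \<in> L \<Longrightarrow> \<sigma> (x ^ n) = \<sigma> x ^ n"
  by (induction n) (auto simp: hom_on_1[OF h] hom_on_mult[OF h] subfield_power[OF L])

lemma hom_on_of_nat: "\<sigma> (of_nat n) = of_nat n"
  by (induction n) (auto simp: hom_on_0 hom_on_1[OF h] hom_on_add[OF h] subfield_1[OF L]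
      subfield_of_nat[OF L])

lemma hom_on_of_int: "\<sigma> (of_int n) = of_int n"
  by (cases n rule: int_cases2) (auto simp: hom_on_of_nat hom_on_minus subfield_of_nat[OF L])

lemma hom_on_of_rat: "\<sigma> (of_rat q) = of_rat q"
  by (cases q) (auto simp: of_rat_rat hom_on_of_int hom_on_divide subfield_of_int[OF L])

lemma hom_on_Rats: "x \<in> \<rat> \<Longrightarrow> \<sigma> x = x"
  by (auto simp: Rats_def hom_on_of_rat)

lemma hom_on_sum: "(\<And>i. i \<in> I \<Longrightarrow> f i \<in> L) \<Longrightarrow> \<sigma> (sum f I) = (\<Sum>i\<in>I. \<sigma> (f i))"
  by (induction I rule: infinite_finite_induct)
    (auto simp: hom_on_0 hom_on_add[OF h] subfield_sum[OF L])

text \<open>The least field with given generators is contained in this one as soon as the generators are; so a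
  generated field is mapped into \<open>K\<close> if its generators are.\<close>

lemma subfield_hom_vimage:
  assumes "subfield K CC" shows "subfield {x \<in> L. \<sigma> x \<in> K} CC"
  by (rule subfield_CC_I)
    (auto simp: hom_on_1[OF h] hom_on_add[OF h] hom_on_mult[OF h] hom_on_minus hom_on_inverse
      intro!: subfield_intros L assms)

end

text \<open>In the same way, embeddings that agree on generators agree on the generated field.\<close>

lemma subfield_hom_eq:
  assumes L: "subfield L CC" and h: "hom_on L \<sigma>" "hom_on L \<tau>"
  shows "subfield {x \<in> L. \<sigma> x = \<tau> x} CC"
  by (rule subfield_CC_I)
    (auto simp: h[THEN hom_on_1] h[THEN hom_on_add] h[THEN hom_on_mult]
      hom_on_minus[OF L h(1)] hom_on_minus[OF L h(2)] hom_on_inverse[OF L h(1)]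
      hom_on_inverse[OF L h(2)] intro!: subfield_intros L)

section \<open>Finite Galois theory inside the complex numbers\<close>

lemma Gal_iff:
  "\<sigma> \<in> carrier (Gal L K) \<longleftrightarrow>
     \<sigma> \<in> extensional L \<and> bij_betw \<sigma> L L \<and> hom_on L \<sigma> \<and> (\<forall>x\<in>K. \<sigma> x = x)"
  by (auto simp: Gal_def Bij_def ring_hom_def hom_on_def Pi_iff bij_betw_apply)

lemma Gal_hom: "\<sigma> \<in> carrier (Gal L K) \<Longrightarrow> hom_on L \<sigma>"
  and Gal_fix: "\<sigma> \<in> carrier (Gal L K) \<Longrightarrow> x \<in> K \<Longrightarrow> \<sigma> x = x"
  and Gal_in: "\<sigma> \<in> carrier (Gal L K) \<Longrightarrow> x \<in> L \<Longrightarrow> \<sigma> x \<in> L"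
  and Gal_ext: "\<sigma> \<in> carrier (Gal L K) \<Longrightarrow> \<sigma> \<in> extensional L"
  by (auto simp: Gal_iff bij_betw_def)

lemma Gal_eqI:
  "\<sigma> \<in> carrier (Gal L K) \<Longrightarrow> \<tau> \<in> carrier (Gal L K') \<Longrightarrow> (\<And>x. x \<in> L \<Longrightarrow> \<sigma> x = \<tau> x) \<Longrightarrow> \<sigma> = \<tau>"
  by (meson Gal_iff extensionalityI)

lemma Gal_mono: "K \<subseteq> K' \<Longrightarrow> carrier (Gal L K') \<subseteq> carrier (Gal L K)"
  by (auto simp: Gal_iff subset_iff)

lemma Gal_subI: "\<sigma> \<in> carrier (Gal L K) \<Longrightarrow> (\<And>x. x \<in> K' \<Longrightarrow> \<sigma> x = x) \<Longrightarrow> \<sigma> \<in> carrier (Gal L K')"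
  by (auto simp: Gal_iff)

lemma Gal_mult_eq: "\<sigma> \<in> carrier (Gal L K) \<Longrightarrow> \<tau> \<in> carrier (Gal L K) \<Longrightarrow> \<sigma> \<otimes>\<^bsub>Gal L K\<^esub> \<tau> = compose L \<sigma> \<tau>"
  by (auto simp: Gal_def BijGroup_def)

lemma Gal_mult:
  "\<sigma> \<in> carrier (Gal L K) \<Longrightarrow> \<tau> \<in> carrier (Gal L K) \<Longrightarrow> x \<in> L \<Longrightarrow> (\<sigma> \<otimes>\<^bsub>Gal L K\<^esub> \<tau>) x = \<sigma> (\<tau> x)"
  by (simp add: Gal_mult_eq compose_eq)

lemma Gal_one: "x \<in> L \<Longrightarrow> \<one>\<^bsub>Gal L K\<^esub> x = x"
  by (simp add: Gal_def BijGroup_def)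

lemma hom_on_compose:
  "hom_on L \<sigma> \<Longrightarrow> hom_on K \<tau> \<Longrightarrow> (\<And>x. x \<in> K \<Longrightarrow> \<tau> x \<in> L) \<Longrightarrow> hom_on K (\<lambda>x. \<sigma> (\<tau> x))"
  by (auto simp: hom_on_def)

lemma hom_on_restrict: "subfield L CC \<Longrightarrow> hom_on L (restrict \<sigma> L) \<longleftrightarrow> hom_on L \<sigma>"
  by (auto simp: hom_on_def subfield_1 subfield_add subfield_mult)

lemma Gal_compose_closed:
  assumes L: "subfield L CC" and s: "\<sigma> \<in> carrier (Gal L K)" and t: "\<tau> \<in> carrier (Gal L K)" and "K \<subseteq> L"
  shows "compose L \<sigma> \<tau> \<in> carrier (Gal L K)"
proof -
  have "hom_on L (compose L \<sigma> \<tau>)"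
    unfolding compose_def hom_on_restrict[OF L]
    by (rule hom_on_compose[OF Gal_hom[OF s] Gal_hom[OF t]]) (rule Gal_in[OF t])
  with assms show ?thesis
    by (auto simp: Gal_iff bij_betw_compose compose_eq subset_iff)
qed

lemma group_Gal:
  assumes L: "subfield L CC" and KL: "K \<subseteq> L"
  shows "group (Gal L K)"
proof -
  have "subgroup (carrier (Gal L K)) (BijGroup L)"
  proof (rule group.subgroupI[OF group_BijGroup])
    show "carrier (Gal L K) \<subseteq> carrier (BijGroup L)"
      by (auto simp: Gal_def BijGroup_def)
    have "(\<lambda>x\<in>L. x) \<in> carrier (Gal L K)"
      using KL hom_on_restrict[OF L, of "\<lambda>x. x"] by (auto simp: Gal_iff hom_on_def bij_betw_def inj_on_def)
    then show "carrier (Gal L K) \<noteq> {}" by auto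
  next
    fix \<sigma> assume s: "\<sigma> \<in> carrier (Gal L K)"
    then have bij: "bij_betw \<sigma> L L" by (simp add: Gal_iff)
    have b: "\<sigma> \<in> Bij L" using s by (simp add: Gal_def)
    define \<tau> where "\<tau> = inv_into L \<sigma>"
    have t: "\<tau> x \<in> L" "\<sigma> (\<tau> x) = x" if "x \<in> L" for x
      using bij that unfolding \<tau>_def by (auto simp: bij_betw_def inv_into_into f_inv_into_f)
    have t_eq: "\<tau> x = y" if "x \<in> L" "y \<in> L" "x = \<sigma> y" for x y
      unfolding \<tau>_def using that bij by (simp add: bij_betw_inv_into_left)
    have "hom_on L \<tau>"
      unfolding hom_on_def
      by (auto intro!: t_eq simp: t subfield_intros[OF L] hom_on_add[OF Gal_hom[OF s]]
          hom_on_mult[OF Gal_hom[OF s]] hom_on_1[OF Gal_hom[OF s]])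
    moreover have "\<forall>x\<in>K. \<tau> x = x" using KL Gal_fix[OF s] by (auto intro!: t_eq)
    ultimately have "(\<lambda>x\<in>L. \<tau> x) \<in> carrier (Gal L K)"
      using KL restrict_inv_into_Bij[OF b] hom_on_restrict[OF L, of \<tau>]
      by (auto simp: Gal_iff \<tau>_def Bij_def)
    then show "inv\<^bsub>BijGroup L\<^esub> \<sigma> \<in> carrier (Gal L K)"
      using inv_BijGroup[OF b] \<tau>_def by simp
  next
    fix \<sigma> \<tau> assume st: "\<sigma> \<in> carrier (Gal L K)" "\<tau> \<in> carrier (Gal L K)"
    then have "\<sigma> \<otimes>\<^bsub>BijGroup L\<^esub> \<tau> = compose L \<sigma> \<tau>"
      using Gal_mult_eq[OF st] by (simp add: Gal_def)
    with Gal_compose_closed[OF L st KL] show "\<sigma> \<otimes>\<^bsub>BijGroup L\<^esub> \<tau> \<in> carrier (Gal L K)" by simp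
  qed
  then have "group (BijGroup L\<lparr>carrier := carrier (Gal L K)\<rparr>)"
    by (rule subgroup.subgroup_is_group[OF _ group_BijGroup])
  then show ?thesis by (simp add: Gal_def)
qed

subsection \<open>Independence of embeddings\<close>

text \<open>Multiplicativity removes one embedding from a relation: the relation at \<open>x * y\<close> minus
  \<open>\<tau> y\<close> times the relation at \<open>x\<close> does not contain
  \<open>\<tau>\<close>, and its other coefficients are \<open>c \<sigma> * (\<sigma> y - \<tau>
  y)\<close>.\<close>

lemma dedekind_independence:
  assumes L: "subfield L CC" and "finite S" "\<And>\<sigma>. \<sigma> \<in> S \<Longrightarrow> hom_on L \<sigma>"
    "inj_on (\<lambda>\<sigma>. restrict \<sigma> L) S" "\<And>x. x \<in> L \<Longrightarrow> (\<Sum>\<sigma>\<in>S. c \<sigma> * \<sigma> x) = 0" "\<sigma> \<in> S"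
  shows "c \<sigma> = 0"
  using assms(2-)
proof (induction S arbitrary: c \<sigma> rule: finite_induct)
  case (insert \<tau> S)
  note hom = insert.prems(1) and eq = insert.prems(3)
  have "c \<rho> = 0" if \<rho>: "\<rho> \<in> S" for \<rho>
  proof -
    have "\<rho> \<noteq> \<tau>" using \<rho> insert.hyps by auto
    then have "restrict \<rho> L \<noteq> restrict \<tau> L"
      using insert.prems(2) \<rho> unfolding inj_on_def by blast
    then obtain y where y: "y \<in> L" "\<rho> y \<noteq> \<tau> y" by (metis restrict_ext)
    have "(\<Sum>\<sigma>\<in>S. (c \<sigma> * (\<sigma> y - \<tau> y)) * \<sigma> x) = 0" if x: "x \<in> L" for x
    proof -
      have "(\<Sum>\<sigma>\<in>S. (c \<sigma> * (\<sigma> y - \<tau> y)) * \<sigma> x)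
          = (\<Sum>\<sigma>\<in>S. c \<sigma> * \<sigma> (x * y)) - \<tau> y * (\<Sum>\<sigma>\<in>S. c \<sigma> * \<sigma> x)"
        using hom x y by (simp add: hom_on_mult[where L=L] sum_subtractf sum_distrib_left algebra_simps)
      also have "\<dots> = (c \<tau> * \<tau> (x * y) + (\<Sum>\<sigma>\<in>S. c \<sigma> * \<sigma> (x * y)))
          - \<tau> y * (c \<tau> * \<tau> x + (\<Sum>\<sigma>\<in>S. c \<sigma> * \<sigma> x))"
        using hom[of \<tau>] x y by (simp add: hom_on_mult[where L=L] algebra_simps)
      also have "\<dots> = 0"
        using eq[OF x] eq[of "x * y"] subfield_mult[OF L x y(1)] insert.hyps by simp
      finally show ?thesis .
    qed
    then have "c \<rho> * (\<rho> y - \<tau> y) = 0"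
      using insert.IH[of "\<lambda>\<sigma>. c \<sigma> * (\<sigma> y - \<tau> y)" \<rho>] insert.prems(1,2) \<rho> by auto
    with y show ?thesis by simp
  qed
  moreover from this have "c \<tau> = 0"
    using eq[OF subfield_1[OF L]] hom[of \<tau>] insert.hyps by (simp add: hom_on_1[where L=L])
  ultimately show ?case using insert.prems(4) by auto
qed simp

text \<open>One step of Gaussian elimination per equation.\<close>

lemma homogeneous_system_solution:
  fixes a :: "'i \<Rightarrow> 'j \<Rightarrow> 'a::field"
  assumes "finite I" "finite J" "card I < card J"
  shows "\<exists>c. (\<exists>j\<in>J. c j \<noteq> 0) \<and> (\<forall>i\<in>I. (\<Sum>j\<in>J. a i j * c j) = 0)"
  using assms
proof (induction I arbitrary: J a rule: finite_induct)
  case empty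
  then have "J \<noteq> {}" by auto
  then show ?case by (intro exI[of _ "\<lambda>_. 1"]) auto
next
  case (insert i I)
  show ?case
  proof (cases "\<forall>j\<in>J. a i j = 0")
    case True
    moreover obtain c where "\<exists>j\<in>J. c j \<noteq> 0" "\<forall>i\<in>I. (\<Sum>j\<in>J. a i j * c j) = 0"
      using insert.IH[of J a] insert.prems insert.hyps by auto
    ultimately show ?thesis by (intro exI[of _ c]) auto
  next
    case False
    then obtain k where k: "k \<in> J" "a i k \<noteq> 0" by auto
    define J' where "J' = J - {k}"
    have J: "J = insert k J'" "k \<notin> J'" "finite J'" using k insert.prems by (auto simp: J'_def)
    obtain c where c: "\<exists>j\<in>J'. c j \<noteq> 0"
        "\<And>i'. i' \<in> I \<Longrightarrow> (\<Sum>j\<in>J'. (a i' j - a i' k * a i j / a i k) * c j) = 0"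
      using insert.IH[of J' "\<lambda>i' j. a i' j - a i' k * a i j / a i k"] insert.prems insert.hyps J
      by auto
    define s where "s = (\<Sum>j\<in>J'. a i j * c j)"
    define d where "d = c(k := - s / a i k)"
    have sum_d: "(\<Sum>j\<in>J. a i' j * d j) = (\<Sum>j\<in>J'. a i' j * c j) - a i' k * s / a i k" for i'
    proof -
      have "(\<Sum>j\<in>J. a i' j * d j) = a i' k * d k + (\<Sum>j\<in>J'. a i' j * d j)" using J by simp
      also have "(\<Sum>j\<in>J'. a i' j * d j) = (\<Sum>j\<in>J'. a i' j * c j)"
        using J(2) by (intro sum.cong) (auto simp: d_def)
      finally show ?thesis by (simp add: d_def)
    qed
    have "(\<Sum>j\<in>J. a i' j * d j) = 0" if "i' \<in> I" for i'
      using c(2)[OF that] unfolding sum_d s_def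
      by (simp add: left_diff_distrib sum_subtractf sum_distrib_left sum_divide_distrib mult.assoc)
    moreover have "(\<Sum>j\<in>J. a i j * d j) = 0"
      using k unfolding sum_d s_def by simp
    moreover have "\<exists>j\<in>J. d j \<noteq> 0" using c(1) J by (auto simp: d_def)
    ultimately show ?thesis by (intro exI[of _ d]) auto
  qed
qed

lemma has_degreeD:
  assumes "has_degree L K n"
  shows "subfield K CC" "subfield L CC" "K \<subseteq> L" "CC.dimension n K L"
  using assms by (auto simp: has_degree_def)

lemma subalgebra_CC_I:
  assumes "V \<noteq> {}" "\<And>x y. x \<in> V \<Longrightarrow> y \<in> V \<Longrightarrow> x + y \<in> V"
    "\<And>x. x \<in> V \<Longrightarrow> - x \<in> V" "\<And>k x. k \<in> K \<Longrightarrow> x \<in> V \<Longrightarrow> k * x \<in> V"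
  shows "subalgebra K V CC"
  by (auto intro!: subalgebra.intro subalgebra_axioms.intro CC.add.subgroupI assms
      simp: uminus_CC[unfolded a_inv_def])

lemma subfield_subalgebra: "subfield L CC \<Longrightarrow> K \<subseteq> L \<Longrightarrow> subalgebra K L CC"
  by (rule subalgebra_CC_I) (auto intro: subfield_intros)

text \<open>With more embeddings than basis vectors, some nontrivial combination of the embeddings vanishes on
  a basis, hence everywhere, contrary to their independence.\<close>

lemma card_embeddings_le_degree:
  assumes deg: "has_degree L K n" and S: "finite S" "inj_on (\<lambda>\<sigma>. restrict \<sigma> L) S"
    and hom: "\<And>\<sigma>. \<sigma> \<in> S \<Longrightarrow> hom_on L \<sigma>" and fixed: "\<And>\<sigma> x. \<sigma> \<in> S \<Longrightarrow> x \<in> K \<Longrightarrow> \<sigma> x = x"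
  shows "card S \<le> n"
proof (rule ccontr)
  note sub = has_degreeD(1,2,3)[OF deg]
  assume "\<not> card S \<le> n"
  obtain Us where Us: "length Us = n" "CC.Span K Us = L"
    using CC.exists_base[OF sub(1) has_degreeD(4)[OF deg]] by blast
  have UsL: "set Us \<subseteq> L" using CC.Span_base_incl[OF sub(1), of Us] Us(2) by simp
  have "card (set Us) < card S" using \<open>\<not> card S \<le> n\<close> card_length[of Us] Us(1) by simp
  then obtain c where c: "\<exists>\<sigma>\<in>S. c \<sigma> \<noteq> 0" "\<forall>u\<in>set Us. (\<Sum>\<sigma>\<in>S. \<sigma> u * c \<sigma>) = 0"
    using homogeneous_system_solution[of "set Us" S "\<lambda>u \<sigma>. \<sigma> u"] S(1) by auto
  define V where "V = {x \<in> L. (\<Sum>\<sigma>\<in>S. c \<sigma> * \<sigma> x) = 0}"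
  have "subalgebra K V CC"
  proof (rule subalgebra_CC_I)
    show "V \<noteq> {}" using hom_on_0[OF sub(2) hom] subfield_0[OF sub(2)]
      by (auto simp: V_def intro!: exI[of _ 0] sum.neutral)
    show "x + y \<in> V" if "x \<in> V" "y \<in> V" for x y
      using that by (auto simp: V_def hom_on_add[OF hom] ring_distribs sum.distrib subfield_add[OF sub(2)])
    show "- x \<in> V" if "x \<in> V" for x
      using that by (auto simp: V_def hom_on_minus[OF sub(2) hom] sum_negf subfield_minus[OF sub(2)])
    show "k * x \<in> V" if "k \<in> K" "x \<in> V" for k x
    proof -
      have kL: "k \<in> L" and xL: "x \<in> L" using that sub by (auto simp: V_def)
      have "(\<Sum>\<sigma>\<in>S. c \<sigma> * \<sigma> (k * x)) = (\<Sum>\<sigma>\<in>S. k * (c \<sigma> * \<sigma> x))"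
        using kL xL that(1) by (intro sum.cong) (auto simp: hom_on_mult[OF hom] fixed)
      also have "\<dots> = k * (\<Sum>\<sigma>\<in>S. c \<sigma> * \<sigma> x)" by (rule sum_distrib_left[symmetric])
      finally show ?thesis using that kL xL subfield_mult[OF sub(2)] by (auto simp: V_def)
    qed
  qed
  moreover have "set Us \<subseteq> V" using c(2) UsL by (auto simp: V_def mult.commute)
  ultimately have "L \<subseteq> V" using CC.subalgebra_Span_incl[OF sub(1)] Us(2) by blast
  then have "c \<sigma> = 0" if "\<sigma> \<in> S" for \<sigma>
    using dedekind_independence[OF sub(2) S(1) hom S(2) _ that, of c] by (auto simp: V_def)
  with c(1) show False by auto
qed

lemma finite_embeddings:
  assumes deg: "has_degree L K n"
  shows "finite {\<sigma> \<in> extensional L. hom_on L \<sigma> \<and> (\<forall>x\<in>K. \<sigma> x = x)}" (is "finite ?E")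
    and "card {\<sigma> \<in> extensional L. hom_on L \<sigma> \<and> (\<forall>x\<in>K. \<sigma> x = x)} \<le> n"
proof -
  have bd: "card S \<le> n" if S: "finite S" "S \<subseteq> ?E" for S
  proof (rule card_embeddings_le_degree[OF deg S(1)])
    show "inj_on (\<lambda>\<sigma>. restrict \<sigma> L) S"
      using S by (auto simp: inj_on_def extensional_restrict subset_iff)
  qed (use S in auto)
  show "finite ?E"
  proof (rule ccontr)
    assume "infinite ?E"
    then obtain S where "finite S" "card S = Suc n" "S \<subseteq> ?E"
      using infinite_arbitrarily_large by blast
    with bd[of S] show False by simp
  qed
  with bd show "card ?E \<le> n" by simp
qed

lemma
  assumes deg: "has_degree L K n"
  shows finite_Gal: "finite (carrier (Gal L K))" and card_Gal_le: "card (carrier (Gal L K)) \<le> n"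
proof -
  have sub: "carrier (Gal L K) \<subseteq> {\<sigma> \<in> extensional L. hom_on L \<sigma> \<and> (\<forall>x\<in>K. \<sigma> x = x)}"
    by (auto simp: Gal_iff)
  from finite_subset[OF this finite_embeddings(1)[OF deg]] show "finite (carrier (Gal L K))" .
  from card_mono[OF finite_embeddings(1)[OF deg] sub] finite_embeddings(2)[OF deg]
  show "card (carrier (Gal L K)) \<le> n" by simp
qed

text \<open>There are only finitely many embeddings over \<open>K\<close>, so two powers of
  \<open>\<psi>\<close> agree on \<open>L\<close>. Cancelling injective factors shows that a
  positive power of \<open>\<psi>\<close> is the identity.\<close>

lemma endomorphism_bij:
  assumes deg: "has_degree L K n" and hom: "hom_on L \<psi>" and fixed: "\<And>x. x \<in> K \<Longrightarrow> \<psi> x = x"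
    and into: "\<And>x. x \<in> L \<Longrightarrow> \<psi> x \<in> L"
  shows "bij_betw \<psi> L L"
proof -
  note sub = has_degreeD(1,2,3)[OF deg]
  have pw: "hom_on L (\<psi> ^^ i) \<and> (\<forall>x\<in>L. (\<psi> ^^ i) x \<in> L) \<and> (\<forall>x\<in>K. (\<psi> ^^ i) x = x)" for i
    using hom_on_compose[OF hom, of L] into fixed hom_on_1[OF hom]
    by (induction i) (auto simp: hom_on_def)
  have "range (\<lambda>i. restrict (\<psi> ^^ i) L) \<subseteq> {\<sigma> \<in> extensional L. hom_on L \<sigma> \<and> (\<forall>x\<in>K. \<sigma> x = x)}"
    using pw sub(3) by (auto simp: hom_on_restrict[OF sub(2)] subset_iff)
  then have "finite (range (\<lambda>i. restrict (\<psi> ^^ i) L))"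
    using finite_embeddings(1)[OF deg] by (rule finite_subset)
  then have "\<not> inj (\<lambda>i. restrict (\<psi> ^^ i) L)"
    using finite_imageD infinite_UNIV_nat by blast
  then obtain i' j' where "i' \<noteq> j'" "restrict (\<psi> ^^ i') L = restrict (\<psi> ^^ j') L"
    unfolding inj_def by blast
  then obtain i j where ij: "i < j" "restrict (\<psi> ^^ i) L = restrict (\<psi> ^^ j) L"
    by (cases i' j' rule: linorder_cases) auto
  have "x \<in> \<psi> ` L" if x: "x \<in> L" for x
  proof -
    have "(\<psi> ^^ i) x = (\<psi> ^^ (i + (j - i))) x" using ij x by (metis le_add_diff_inverse nat_less_le restrict_apply')
    also have "\<dots> = (\<psi> ^^ i) ((\<psi> ^^ (j - i)) x)" by (simp only: funpow_add o_apply)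
    finally have "x = (\<psi> ^^ (j - i)) x" using hom_on_inj[OF sub(2)] pw x by blast
    also have "\<dots> = \<psi> ((\<psi> ^^ (j - i - 1)) x)"
      using ij(1) by (cases "j - i") auto
    finally show ?thesis using pw[of "j - i - 1"] x by blast
  qed
  moreover have "inj_on \<psi> L" by (rule inj_onI) (rule hom_on_inj[OF sub(2) hom])
  ultimately show ?thesis using into by (auto simp: bij_betw_def)
qed

subsection \<open>The Galois correspondence\<close>

lemma has_degree_tower:
  "has_degree L K m \<Longrightarrow> has_degree M L d \<Longrightarrow> has_degree M K (m * d)"
  unfolding has_degree_def using CC.telescopic_base[of K L m d M] by auto

lemma has_degree_unique: "has_degree L K m \<Longrightarrow> has_degree L K n \<Longrightarrow> m = n"
  unfolding has_degree_def using CC.dimension_is_inj[of K m L n] by auto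

lemma has_degree_pos: assumes "has_degree L K n" shows "n > 0"
proof (rule ccontr)
  assume "\<not> n > 0"
  then have "L = {0}" using CC.dimension_zero[of K L] assms by (auto simp: has_degree_def)
  with subfield_1[of L] assms show False by (auto simp: has_degree_def)
qed

lemma has_degree_1_iff: "has_degree L K 1 \<longleftrightarrow> subfield K CC \<and> L = K"
proof
  assume d: "has_degree L K 1"
  note sub = has_degreeD[OF d]
  have ind: "CC.independent K [1]"
    by (rule CC.li_Cons) auto
  then have "CC.Span K [1] = L"
    using CC.independent_length_eq_dimension[OF sub(1,4) ind] subfield_1[OF sub(2)] by simp
  moreover have "CC.Span K [1] \<subseteq> K"
    by (rule CC.subalgebra_Span_incl[OF sub(1) subfield_subalgebra[OF sub(1)]]) (auto simp: subfield_1[OF sub(1)])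
  ultimately show "subfield K CC \<and> L = K" using sub by auto
next
  assume "subfield K CC \<and> L = K"
  then show "has_degree L K 1" using CC.dimension_one[of K] by (auto simp: has_degree_def)
qed

text \<open>A basis over \<open>K\<close> spans over \<open>L\<close>, so both steps of the tower have finite
  degree.\<close>

lemma has_degree_intermediate:
  assumes deg: "has_degree M K n" and L: "subfield L CC" "K \<subseteq> L" "L \<subseteq> M"
  shows "\<exists>m d. has_degree L K m \<and> has_degree M L d \<and> n = m * d"
proof -
  note sub = has_degreeD[OF deg]
  have "CC.finite_dimension K L"
    by (rule CC.subalbegra_incl_imp_finite_dimension[OF sub(1) CC.finite_dimensionI[OF sub(4)]
        subfield_subalgebra[OF L(1,2)] L(3)])
  then obtain m where m: "has_degree L K m"
    using L sub by (auto simp: has_degree_def CC.finite_dimension_def)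
  obtain Us where Us: "CC.Span K Us = M"
    using CC.exists_base[OF sub(1) sub(4)] by blast
  have UsM: "set Us \<subseteq> M" using CC.Span_base_incl[OF sub(1), of Us] Us by simp
  have "CC.Span L Us \<subseteq> M"
    by (rule CC.subalgebra_Span_incl[OF L(1) subfield_subalgebra[OF sub(2) L(3)] UsM])
  moreover have "subalgebra K (CC.Span L Us) CC"
    using CC.Span_is_subalgebra[OF L(1), of Us] L(2)
    by (auto simp: subalgebra_def subalgebra_axioms_def)
  then have "M \<subseteq> CC.Span L Us"
    using CC.subalgebra_Span_incl[OF sub(1), of "CC.Span L Us" Us] CC.Span_base_incl[OF L(1), of Us] Us
    by auto
  ultimately have "CC.Span L Us = M" by blast
  with CC.Span_finite_dimension[OF L(1), of Us] obtain d where d: "has_degree M L d"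
    using L sub by (auto simp: has_degree_def CC.finite_dimension_def)
  from has_degree_unique[OF deg has_degree_tower[OF m d]] m d show ?thesis by blast
qed

lemma subfield_fixed:
  assumes L: "subfield L CC" and S: "S \<subseteq> carrier (Gal L K)"
  shows "subfield {x \<in> L. \<forall>\<sigma>\<in>S. \<sigma> x = x} CC"
proof -
  have h: "hom_on L \<sigma>" if "\<sigma> \<in> S" for \<sigma> using that S Gal_hom by blast
  show ?thesis
    by (rule subfield_CC_I)
      (auto simp: hom_on_1[OF h] hom_on_add[OF h] hom_on_mult[OF h] hom_on_minus[OF L h]
         hom_on_inverse[OF L h] intro!: subfield_intros L)
qed

text \<open>Lagrange's theorem for restriction to \<open>L\<close>: automorphisms with the same restriction
  form a coset of the group of \<open>L\<close>. The function \<open>q\<close> stands for any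
  convenient invariant that recognizes the restriction.\<close>

lemma card_Gal_fibres:
  assumes M: "subfield M CC" and KL: "K \<subseteq> L" "L \<subseteq> M" and fin: "finite (carrier (Gal M K))"
    and q: "\<And>\<sigma> \<tau>. \<sigma> \<in> carrier (Gal M K) \<Longrightarrow> \<tau> \<in> carrier (Gal M K) \<Longrightarrow>
      q \<sigma> = q \<tau> \<longleftrightarrow> (\<forall>x\<in>L. \<sigma> x = \<tau> x)"
  shows "card (carrier (Gal M K)) = card (q ` carrier (Gal M K)) * card (carrier (Gal M L))"
proof -
  define G where "G = Gal M K"
  have KM: "K \<subseteq> M" using KL by auto
  interpret G: group G unfolding G_def by (rule group_Gal[OF M KM])
  have "card {\<tau> \<in> carrier G. q \<tau> = q \<sigma>} = card (carrier (Gal M L))" if s: "\<sigma> \<in> carrier G" for \<sigma>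
  proof -
    have "{\<tau> \<in> carrier G. q \<tau> = q \<sigma>} = (\<lambda>\<rho>. \<sigma> \<otimes>\<^bsub>G\<^esub> \<rho>) ` carrier (Gal M L)" (is "?A = ?B")
    proof (intro equalityI subsetI)
      fix \<tau> assume t: "\<tau> \<in> ?A"
      define \<rho> where "\<rho> = inv\<^bsub>G\<^esub> \<sigma> \<otimes>\<^bsub>G\<^esub> \<tau>"
      have r: "\<rho> \<in> carrier G" "\<tau> = \<sigma> \<otimes>\<^bsub>G\<^esub> \<rho>" using s t
        by (auto simp: \<rho>_def G.m_assoc[symmetric])
      have "\<rho> x = x" if x: "x \<in> L" for x
      proof -
        have xM: "x \<in> M" using x KL by auto
        have "\<sigma> (\<rho> x) = \<tau> x" using r(2) Gal_mult[OF s[unfolded G_def] r(1)[unfolded G_def] xM] G_def by simp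
        also have "\<dots> = \<sigma> x" using q[of \<tau> \<sigma>] t s x by (auto simp: G_def)
        finally show ?thesis
          using hom_on_inj[OF M Gal_hom[OF s[unfolded G_def]]] xM Gal_in[OF r(1)[unfolded G_def] xM] by blast
      qed
      then have "\<rho> \<in> carrier (Gal M L)" using r(1) Gal_subI G_def by blast
      with r(2) show "\<tau> \<in> ?B" by blast
    next
      fix \<tau> assume "\<tau> \<in> ?B"
      then obtain \<rho> where r: "\<rho> \<in> carrier (Gal M L)" "\<tau> = \<sigma> \<otimes>\<^bsub>G\<^esub> \<rho>" by auto
      have r': "\<rho> \<in> carrier G" using r(1) Gal_mono[OF KL(1), of M] G_def by auto
      then have t: "\<tau> \<in> carrier G" using r(2) s by simp
      have "\<tau> x = \<sigma> x" if x: "x \<in> L" for x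
        using Gal_mult[OF s[unfolded G_def] r'[unfolded G_def]] x KL Gal_fix[OF r(1) x] r(2)
        by (auto simp: G_def)
      with q[of \<tau> \<sigma>] t s show "\<tau> \<in> ?A" by (auto simp: G_def)
    qed
    moreover have "inj_on (\<lambda>\<rho>. \<sigma> \<otimes>\<^bsub>G\<^esub> \<rho>) (carrier (Gal M L))"
      using Gal_mono[OF KL(1), of M] s unfolding G_def[symmetric]
      by (auto simp: inj_on_def subset_iff)
    ultimately show ?thesis by (simp add: card_image)
  qed
  note fib = this
  have "card (carrier G) = (\<Sum>y\<in>q ` carrier G. card {\<tau> \<in> carrier G. q \<tau> = y})"
    using sum.image_gen[of "carrier G" "\<lambda>_. 1::nat" q] fin by (simp add: G_def)
  also have "\<dots> = (\<Sum>y\<in>q ` carrier G. card (carrier (Gal M L)))"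
    by (rule sum.cong) (use fib in auto)
  finally show ?thesis by (simp add: G_def)
qed

text \<open>The property of being Galois in the form of a count. It passes to intermediate fields by counting
  alone (\<open>galois_degree_upper\<close>).\<close>

definition galois_degree :: "complex set \<Rightarrow> complex set \<Rightarrow> nat \<Rightarrow> bool" where
  "galois_degree M K n \<longleftrightarrow> has_degree M K n \<and> card (carrier (Gal M K)) = n"

text \<open>An automorphism \<open>\<tau>\<close> that fixes the fixed field of \<open>H\<close> fixes all
  traces \<open>\<Sum>\<sigma>\<in>H. \<sigma> x\<close>. If \<open>\<tau>\<close> were not in
  \<open>H\<close>, the sum over \<open>H\<close> minus the sum over the disjoint coset
  \<open>\<tau> H\<close> would be a linear relation between distinct embeddings.\<close>

lemma Artin_fixed_field:
  assumes M: "subfield M CC" "K \<subseteq> M" and H: "subgroup H (Gal M K)" "finite H"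
    and t: "\<tau> \<in> carrier (Gal M {x \<in> M. \<forall>\<sigma>\<in>H. \<sigma> x = x})"
  shows "\<tau> \<in> H"
proof (rule ccontr)
  assume nt: "\<tau> \<notin> H"
  interpret G: group "Gal M K" by (rule group_Gal[OF M])
  have HG: "H \<subseteq> carrier (Gal M K)" by (rule subgroup.subset[OF H(1)])
  let ?Tr = "\<lambda>x. \<Sum>\<sigma>\<in>H. \<sigma> x"
  have "K \<subseteq> {x \<in> M. \<forall>\<sigma>\<in>H. \<sigma> x = x}" using M(2) HG Gal_fix by blast
  then have tG: "\<tau> \<in> carrier (Gal M K)" using t Gal_mono by blast
  define T where "T = (\<lambda>\<sigma>. \<tau> \<otimes>\<^bsub>Gal M K\<^esub> \<sigma>) ` H"
  have inj: "inj_on (\<lambda>\<sigma>. \<tau> \<otimes>\<^bsub>Gal M K\<^esub> \<sigma>) H" using HG tG by (auto simp: inj_on_def subset_iff)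
  have disj: "H \<inter> T = {}"
  proof -
    have False if "\<sigma> \<in> H" "\<tau> \<otimes>\<^bsub>Gal M K\<^esub> \<sigma> \<in> H" for \<sigma>
    proof -
      have "\<sigma> \<in> carrier (Gal M K)" using that HG by auto
      then have "\<tau> = (\<tau> \<otimes>\<^bsub>Gal M K\<^esub> \<sigma>) \<otimes>\<^bsub>Gal M K\<^esub> inv\<^bsub>Gal M K\<^esub> \<sigma>"
        using tG by (simp add: G.m_assoc)
      with that subgroup.m_closed[OF H(1)] subgroup.m_inv_closed[OF H(1)] nt show False by metis
    qed
    then show ?thesis by (auto simp: T_def)
  qed
  have TG: "T \<subseteq> carrier (Gal M K)" using HG tG by (auto simp: T_def)
  have trace: "\<tau> (?Tr x) = ?Tr x" if x: "x \<in> M" for x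
  proof -
    have "\<rho> (?Tr x) = ?Tr x" if r: "\<rho> \<in> H" for \<rho>
    proof -
      have rG: "\<rho> \<in> carrier (Gal M K)" using r HG by auto
      have "\<rho> (?Tr x) = (\<Sum>\<sigma>\<in>H. \<rho> (\<sigma> x))"
        using HG x by (intro hom_on_sum[OF M(1) Gal_hom[OF rG]]) (auto intro: Gal_in)
      also have "\<dots> = (\<Sum>\<sigma>\<in>H. (\<rho> \<otimes>\<^bsub>Gal M K\<^esub> \<sigma>) x)"
        using HG x by (intro sum.cong) (auto simp: Gal_mult[OF rG])
      also have "\<dots> = ?Tr x"
      proof (rule sum.reindex_bij_betw)
        show "bij_betw (\<lambda>\<sigma>. \<rho> \<otimes>\<^bsub>Gal M K\<^esub> \<sigma>) H H"
        proof (rule bij_betwI[where g = "\<lambda>\<sigma>. inv\<^bsub>Gal M K\<^esub> \<rho> \<otimes>\<^bsub>Gal M K\<^esub> \<sigma>"])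
        qed (use r rG HG H(1) in \<open>auto simp: G.m_assoc[symmetric] subset_iff subgroup.m_closed subgroup.m_inv_closed\<close>)
      qed
      finally show ?thesis .
    qed
    moreover have "?Tr x \<in> M" using HG x by (auto intro!: subfield_sum M intro: Gal_in)
    ultimately show ?thesis using Gal_fix[OF t] by blast
  qed
  define c :: "(complex \<Rightarrow> complex) \<Rightarrow> complex" where "c = (\<lambda>\<sigma>. if \<sigma> \<in> H then 1 else - 1)"
  have fT: "finite T" using H(2) by (simp add: T_def)
  have "(\<Sum>\<sigma>\<in>H \<union> T. c \<sigma> * \<sigma> x) = 0" if x: "x \<in> M" for x
  proof -
    have "(\<Sum>\<sigma>\<in>H \<union> T. c \<sigma> * \<sigma> x) = (\<Sum>\<sigma>\<in>H. c \<sigma> * \<sigma> x) + (\<Sum>\<sigma>\<in>T. c \<sigma> * \<sigma> x)"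
      by (rule sum.union_disjoint[OF H(2) fT disj])
    also have "(\<Sum>\<sigma>\<in>H. c \<sigma> * \<sigma> x) = ?Tr x" by (simp add: c_def)
    also have "(\<Sum>\<sigma>\<in>T. c \<sigma> * \<sigma> x) = (\<Sum>\<sigma>\<in>T. - \<sigma> x)"
      using disj by (intro sum.cong) (auto simp: c_def)
    also have "\<dots> = - (\<Sum>\<sigma>\<in>H. \<tau> (\<sigma> x))"
      unfolding T_def sum_negf using HG x tG
      by (subst sum.reindex[OF inj]) (auto simp: Gal_mult[OF tG] intro!: sum.cong)
    also have "(\<Sum>\<sigma>\<in>H. \<tau> (\<sigma> x)) = \<tau> (?Tr x)"
      using HG x by (intro hom_on_sum[OF M(1) Gal_hom[OF tG], symmetric]) (auto intro: Gal_in)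
    finally show ?thesis using trace[OF x] by simp
  qed
  moreover have "inj_on (\<lambda>\<sigma>. restrict \<sigma> M) (H \<union> T)"
  proof (rule inj_onI)
    fix x y assume "x \<in> H \<union> T" "y \<in> H \<union> T" and eq: "restrict x M = restrict y M"
    then have "x \<in> extensional M" "y \<in> extensional M" using HG TG Gal_ext by blast+
    with eq show "x = y" by (simp add: extensional_restrict)
  qed
  moreover have "\<one>\<^bsub>Gal M K\<^esub> \<in> H" by (rule subgroup.one_closed[OF H(1)])
  ultimately have "c \<one>\<^bsub>Gal M K\<^esub> = 0"
    using H(2) fT HG TG by (intro dedekind_independence[OF M(1), of "H \<union> T" c]) (auto intro: Gal_hom)
  with \<open>\<one>\<^bsub>Gal M K\<^esub> \<in> H\<close> show False by (simp add: c_def)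
qed

context
  fixes M K n assumes gal: "galois_degree M K n"
begin

lemma galois_degreeD: "has_degree M K n" "card (carrier (Gal M K)) = n"
    "subfield K CC" "subfield M CC" "K \<subseteq> M" "finite (carrier (Gal M K))"
  using gal has_degreeD[of M K n] finite_Gal[of M K n] by (simp_all add: galois_degree_def)

text \<open>The number \<open>n\<close> of automorphisms is the number of restrictions to \<open>L\<close>, at
  most \<open>[L : K]\<close>, times the order of the group of \<open>L\<close>, at most \<open>[M :
  L]\<close>. As \<open>n = [L : K] [M : L]\<close>, both bounds are attained.\<close>

lemma galois_degree_upper:
  assumes L: "subfield L CC" "K \<subseteq> L" "L \<subseteq> M"
  shows "galois_degree M L (card (carrier (Gal M L)))"
proof -
  obtain m d where md: "has_degree L K m" "has_degree M L d" "n = m * d"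
    using has_degree_intermediate[OF galois_degreeD(1) L] by blast
  define q where "q = (\<lambda>\<sigma>::complex\<Rightarrow>complex. restrict \<sigma> L)"
  have "q \<sigma> = q \<tau> \<longleftrightarrow> (\<forall>x\<in>L. \<sigma> x = \<tau> x)" for \<sigma> \<tau>
    by (auto simp: q_def fun_eq_iff)
  then have "n = card (q ` carrier (Gal M K)) * card (carrier (Gal M L))"
    using card_Gal_fibres[OF galois_degreeD(4) L(2,3) galois_degreeD(6), of q] galois_degreeD(2) by simp
  moreover have "card (q ` carrier (Gal M K)) \<le> m"
  proof -
    have "q ` carrier (Gal M K) \<subseteq> {\<sigma> \<in> extensional L. hom_on L \<sigma> \<and> (\<forall>x\<in>K. \<sigma> x = x)}"
      using L(2) hom_on_subset[OF Gal_hom L(3), of _ K]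
      by (auto simp: q_def hom_on_restrict[OF L(1)] Gal_fix subset_iff)
    from card_mono[OF finite_embeddings(1)[OF md(1)] this] finite_embeddings(2)[OF md(1)]
    show ?thesis by simp
  qed
  moreover have "card (carrier (Gal M L)) \<le> d" by (rule card_Gal_le[OF md(2)])
  moreover have "m > 0" "d > 0" using has_degree_pos md by auto
  ultimately have "m * d \<le> m * card (carrier (Gal M L))"
    using md(3) by (metis mult_le_mono1)
  with \<open>m > 0\<close> \<open>card (carrier (Gal M L)) \<le> d\<close> have "card (carrier (Gal M L)) = d" by simp
  with md(2) show ?thesis by (simp add: galois_degree_def)
qed

text \<open>The fixed field \<open>L'\<close> of the group of \<open>L\<close> has the same group as
  \<open>L\<close>. By the previous count \<open>M\<close> has the same degree over both.\<close>

lemma fixed_field_Gal: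
  assumes L: "subfield L CC" "K \<subseteq> L" "L \<subseteq> M"
  shows "{x \<in> M. \<forall>\<sigma>\<in>carrier (Gal M L). \<sigma> x = x} = L"
proof -
  define L' where "L' = {x \<in> M. \<forall>\<sigma>\<in>carrier (Gal M L). \<sigma> x = x}"
  have L': "subfield L' CC" "L \<subseteq> L'" "L' \<subseteq> M"
    unfolding L'_def using subfield_fixed[OF galois_degreeD(4), of "carrier (Gal M L)" L] L Gal_fix by auto
  have deg: "has_degree M L (card (carrier (Gal M L)))"
    using galois_degree_upper[OF L] by (simp add: galois_degree_def)
  have "carrier (Gal M L') = carrier (Gal M L)"
    using Gal_mono[OF L'(2), of M] by (auto simp: L'_def intro: Gal_subI)
  moreover have "galois_degree M L' (card (carrier (Gal M L')))"
    using galois_degree_upper[OF L'(1) _ L'(3)] L L' by auto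
  ultimately have deg': "has_degree M L' (card (carrier (Gal M L)))" by (simp add: galois_degree_def)
  obtain m d where md: "has_degree L' L m" "has_degree M L' d" "card (carrier (Gal M L)) = m * d"
    using has_degree_intermediate[OF deg L'] by blast
  have "d = card (carrier (Gal M L))" by (rule has_degree_unique[OF md(2) deg'])
  with md(3) has_degree_pos[OF deg'] have "m = 1" by simp
  with md(1) have "has_degree L' L 1" by simp
  then show ?thesis unfolding has_degree_1_iff by (simp add: L'_def)
qed

text \<open>The form in which degrees are computed below: \<open>[L : L']\<close> is the number of values of
  an invariant \<open>q\<close> that recognizes restrictions to \<open>L\<close>.\<close>

lemma has_degree_via_restrictions:
  assumes L: "subfield L' CC" "subfield L CC" "K \<subseteq> L'" "L' \<subseteq> L" "L \<subseteq> M"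
    and q: "\<And>\<sigma> \<tau>. \<sigma> \<in> carrier (Gal M L') \<Longrightarrow> \<tau> \<in> carrier (Gal M L') \<Longrightarrow>
      q \<sigma> = q \<tau> \<longleftrightarrow> (\<forall>x\<in>L. \<sigma> x = \<tau> x)"
  shows "has_degree L L' (card (q ` carrier (Gal M L')))"
proof -
  have deg: "has_degree M L' (card (carrier (Gal M L')))" "has_degree M L (card (carrier (Gal M L)))"
    using galois_degree_upper[of L'] galois_degree_upper[of L] L by (auto simp: galois_degree_def)
  obtain m d where md: "has_degree L L' m" "has_degree M L d" "card (carrier (Gal M L')) = m * d"
    using has_degree_intermediate[OF deg(1) L(2,4,5)] by blast
  have "d = card (carrier (Gal M L))" by (rule has_degree_unique[OF md(2) deg(2)])
  moreover have "d > 0" using has_degree_pos[OF md(2)] .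
  moreover have "card (carrier (Gal M L')) = card (q ` carrier (Gal M L')) * card (carrier (Gal M L))"
    by (rule card_Gal_fibres[OF galois_degreeD(4) L(4,5) finite_Gal[OF deg(1)] q])
  ultimately have "m = card (q ` carrier (Gal M L'))"
    using md(3) by simp
  with md(1) show ?thesis by simp
qed

text \<open>Restrictions give as many automorphisms of a stable field as its degree allows, so there are no
  others.\<close>

lemma stable_intermediate:
  assumes L: "subfield L CC" "K \<subseteq> L" "L \<subseteq> M"
    and stable: "\<And>\<sigma> x. \<sigma> \<in> carrier (Gal M K) \<Longrightarrow> x \<in> L \<Longrightarrow> \<sigma> x \<in> L"
  shows "carrier (Gal L K) = (\<lambda>\<sigma>. restrict \<sigma> L) ` carrier (Gal M K)"
    and "galois_degree L K (card (carrier (Gal L K)))"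
    and "finite_galois L K"
proof -
  let ?q = "\<lambda>\<sigma>::complex\<Rightarrow>complex. restrict \<sigma> L"
  have "?q \<sigma> = ?q \<tau> \<longleftrightarrow> (\<forall>x\<in>L. \<sigma> x = \<tau> x)" for \<sigma> \<tau>
    by (auto simp: fun_eq_iff)
  then have deg: "has_degree L K (card (?q ` carrier (Gal M K)))"
    by (intro has_degree_via_restrictions galois_degreeD L) auto
  have sub: "?q ` carrier (Gal M K) \<subseteq> carrier (Gal L K)"
  proof (clarify)
    fix \<sigma> assume s: "\<sigma> \<in> carrier (Gal M K)"
    have h: "hom_on L \<sigma>" by (rule hom_on_subset[OF Gal_hom[OF s] L(3)])
    have "bij_betw \<sigma> L L"
      by (rule endomorphism_bij[OF deg h]) (use s Gal_fix stable in auto)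
    with h s L(2) show "?q \<sigma> \<in> carrier (Gal L K)"
      by (auto simp: Gal_iff hom_on_restrict[OF L(1)] subset_iff cong: bij_betw_cong)
  qed
  show eq: "carrier (Gal L K) = ?q ` carrier (Gal M K)"
    using card_seteq[OF finite_Gal[OF deg] sub card_Gal_le[OF deg]] by simp
  with deg show "galois_degree L K (card (carrier (Gal L K)))" by (simp add: galois_degree_def)
  have "{x \<in> L. \<forall>\<sigma>\<in>carrier (Gal L K). \<sigma> x = x} = K"
    unfolding eq using fixed_field_Gal[OF galois_degreeD(3) _ galois_degreeD(5)] L by auto
  with deg show "finite_galois L K"
    by (auto simp: finite_galois_def has_degree_def CC.finite_dimension_def)
qed

end

lemma galois_degree_fixed_field:
  assumes gal: "galois_degree M K n" and H: "subgroup H (Gal M K)"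
  shows "carrier (Gal M {x \<in> M. \<forall>\<sigma>\<in>H. \<sigma> x = x}) = H"
proof -
  note g = galois_degreeD[OF gal]
  have HG: "H \<subseteq> carrier (Gal M K)" by (rule subgroup.subset[OF H])
  then have "finite H" using g(6) finite_subset by blast
  with Artin_fixed_field[OF g(4,5) H] show ?thesis
    using HG by (auto intro: Gal_subI)
qed

section \<open>Evaluating integer polynomials at complex numbers\<close>

definition ieval :: "int poly \<Rightarrow> complex \<Rightarrow> complex" where
  "ieval h z = poly (map_poly of_int h) z"

lemma ieval_0 [simp]: "ieval 0 z = 0"
  and ieval_pCons [simp]: "ieval (pCons a h) z = of_int a + z * ieval h z"
  by (simp_all add: ieval_def map_poly_pCons)

lemma ieval_1 [simp]: "ieval 1 z = 1"
  by (simp add: one_pCons)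

lemma ieval_add [simp]: "ieval (g + h) z = ieval g z + ieval h z"
  by (induction g h rule: poly_induct2) (auto simp: algebra_simps)

lemma ieval_smult [simp]: "ieval (smult c h) z = of_int c * ieval h z"
  by (induction h) (auto simp: algebra_simps)

lemma ieval_minus [simp]: "ieval (- h) z = - ieval h z"
  using ieval_smult[of "-1" h z] by simp

lemma ieval_diff [simp]: "ieval (g - h) z = ieval g z - ieval h z"
  using ieval_add[of g "- h" z] by simp

lemma ieval_mult [simp]: "ieval (g * h) z = ieval g z * ieval h z"
  by (induction g) (auto simp: algebra_simps)

lemma ieval_power [simp]: "ieval (g ^ n) z = ieval g z ^ n"
  by (induction n) auto

lemma ieval_sum [simp]: "ieval (sum f A) z = (\<Sum>i\<in>A. ieval (f i) z)"
  by (induction A rule: infinite_finite_induct) auto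

lemma ieval_monom [simp]: "ieval (monom c n) z = of_int c * z ^ n"
  by (induction n) (auto simp: monom_0 monom_Suc)

lemma ieval_of_nat [simp]: "ieval (of_nat n) z = of_nat n"
  by (induction n) auto

lemma ieval_altdef: "ieval h z = (\<Sum>i\<le>degree h. of_int (coeff h i) * z ^ i)"
  by (subst poly_as_sum_of_monoms[symmetric, of h]) (simp del: poly_as_sum_of_monoms)

lemma ieval_substitute_power: "\<exists>h'. \<forall>w. ieval h' w = ieval h (w ^ k)"
proof (induction h)
  case (pCons a h)
  then obtain h' where "\<forall>w. ieval h' w = ieval h (w ^ k)" by blast
  then show ?case by (intro exI[of _ "[:a:] + monom 1 k * h'"]) simp
qed (auto intro: exI[of _ 0])

lemma freshmans_dream:
  fixes x y :: "'a::comm_ring_1"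
  assumes q: "Factorial_Ring.prime (q::nat)"
  shows "\<exists>t. (x + y) ^ q = x ^ q + y ^ q + of_nat q * t"
proof -
  define t where "t = (\<Sum>k\<in>{1..<q}. of_nat ((q choose k) div q) * x ^ k * y ^ (q - k))"
  have q0: "q > 0" using q prime_gt_0_nat by blast
  have "(x + y) ^ q = (\<Sum>k\<le>q. of_nat (q choose k) * x ^ k * y ^ (q - k))"
    by (rule binomial_ring)
  also have "{..q} = insert 0 (insert q {1..<q})" using q0 by auto
  also have "(\<Sum>k\<in>\<dots>. of_nat (q choose k) * x ^ k * y ^ (q - k))
      = x ^ q + y ^ q + (\<Sum>k\<in>{1..<q}. of_nat (q choose k) * x ^ k * y ^ (q - k))"
    using q0 by simp
  also have "(\<Sum>k\<in>{1..<q}. of_nat (q choose k) * x ^ k * y ^ (q - k)) = of_nat q * t"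
    unfolding t_def sum_distrib_left
  proof (intro sum.cong refl)
    fix k assume "k \<in> {1..<q}"
    then have "q dvd (q choose k)" using dvd_choose_prime[of k q] q by auto
    then have "of_nat (q choose k) = (of_nat q * of_nat ((q choose k) div q) :: 'a)"
      by (metis dvd_mult_div_cancel of_nat_mult)
    then show "of_nat (q choose k) * x ^ k * y ^ (q - k)
        = of_nat q * (of_nat ((q choose k) div q) * x ^ k * y ^ (q - k))" by (simp add: mult.assoc)
  qed
  finally show ?thesis by blast
qed

lemma fermat_int: assumes q: "Factorial_Ring.prime (q::nat)" shows "\<exists>t. (a::int) ^ q = a + int q * t"
proof -
  have q0: "q > 0" using q prime_gt_0_nat by blast
  have nat: "\<exists>t. int n ^ q = int n + int q * t" for n
  proof (induction n)
    case (Suc n)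
    then obtain t where "int n ^ q = int n + int q * t" by blast
    moreover obtain s where "(int n + 1) ^ q = int n ^ q + 1 ^ q + int q * s"
      using freshmans_dream[OF q, of "int n" 1] by auto
    ultimately show ?case by (intro exI[of _ "s + t"]) (simp add: algebra_simps)
  qed (use q0 in \<open>auto intro: exI[of _ 0]\<close>)
  define b where "b = a mod int q"
  have b: "a = b + int q * (a div int q)" "b = int (nat b)"
    using q0 by (auto simp: b_def)
  obtain t where t: "b ^ q = b + int q * t" using nat[of "nat b"] b(2) by metis
  obtain s where "a ^ q = b ^ q + (int q * (a div int q)) ^ q + int q * s"
    using freshmans_dream[OF q, of b "int q * (a div int q)"] b(1) by auto
  moreover have "int q dvd (int q * (a div int q)) ^ q" using q0 by (metis dvd_power dvd_trans dvd_triv_left)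
  then obtain u where "(int q * (a div int q)) ^ q = int q * u" by (auto simp: dvd_def)
  moreover have "b = a - int q * (a div int q)" using b(1) by linarith
  ultimately have "a ^ q = a + int q * (t + u + s - a div int q)"
    using t unfolding distrib_left right_diff_distrib by linarith
  then show ?thesis by blast
qed

text \<open>Modulo \<open>q\<close> the polynomials \<open>g(X\<^sup>q)\<close> and
  \<open>g(X)\<^sup>q\<close> agree.\<close>

lemma ieval_frobenius:
  assumes q: "Factorial_Ring.prime (q::nat)"
  shows "\<exists>h. \<forall>w. ieval g (w ^ q) = ieval g w ^ q + of_nat q * ieval h w"
proof (induction g)
  case 0
  then show ?case using prime_gt_0_nat[OF q] by (intro exI[of _ 0]) simp
next
  case (pCons a g)
  then obtain h where h: "\<And>w. ieval g (w ^ q) = ieval g w ^ q + of_nat q * ieval h w" by blast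
  obtain t where t: "a ^ q = a + int q * t" using fermat_int[OF q] by blast
  obtain s where s: "([:a:] + [:0, 1:] * g) ^ q = [:a:] ^ q + ([:0, 1:] * g) ^ q + of_nat q * s"
    using freshmans_dream[OF q, of "[:a:]" "[:0, 1:] * g"] by blast
  show ?case
  proof (intro exI allI)
    fix w
    have "(of_int a + w * ieval g w) ^ q
        = of_int a ^ q + (w * ieval g w) ^ q + of_nat q * ieval s w"
      using arg_cong[OF s, of "\<lambda>p. ieval p w"] by simp
    moreover have "(of_int a :: complex) ^ q = of_int a + of_nat q * of_int t"
      using arg_cong[OF t, of of_int] by simp
    ultimately show "ieval (pCons a g) (w ^ q) = ieval (pCons a g) w ^ q
        + of_nat q * ieval (monom 1 q * h - s - [:t:]) w"
      using h[of w] by (simp add: power_mult_distrib algebra_simps)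
  qed
qed

section \<open>Galois conjugates of roots of unity\<close>

lemma power_mod_period:
  assumes "z ^ n = (1 :: 'a :: monoid_mult)" shows "z ^ k = z ^ (k mod n)"
  by (metis assms div_mult_mod_eq mult.commute mult_1 power_add power_mult power_one)

lemma minimal_int_poly:
  assumes "n > 0" "z ^ n = (1::complex)"
  obtains g where "g \<noteq> 0" "ieval g z = 0" "\<And>h. ieval h z = 0 \<Longrightarrow> h \<noteq> 0 \<Longrightarrow> degree g \<le> degree h"
proof -
  let ?P = "\<lambda>h. h \<noteq> 0 \<and> ieval h z = 0"
  have "coeff (monom 1 n - 1 :: int poly) n \<noteq> 0" using assms by simp
  then have "?P (monom 1 n - 1)" using assms by (auto simp del: coeff_diff)
  from that[of "arg_min degree ?P"] arg_min_nat_lemma[of ?P, OF this] show ?thesis by blast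
qed

text \<open>Division by a polynomial that need not be monic; the factor \<open>c\<close> spares the passage to
  rational coefficients. The remainder is described by its coefficients because that condition is
  visibly closed under linear combinations.\<close>

lemma minimal_poly_pseudo_division:
  assumes "g \<noteq> 0"
  shows "\<exists>c q r. c \<noteq> 0 \<and> smult c h = g * q + r \<and> (\<forall>i\<ge>degree g. coeff r i = (0::int))"
proof -
  obtain c q where "c \<noteq> 0" "smult c h = g * q + pseudo_mod h g"
    using pseudo_mod(1)[OF assms] by blast
  moreover have "\<forall>i\<ge>degree g. coeff (pseudo_mod h g) i = 0"
    using pseudo_mod(2)[OF assms, of h] by (auto simp: coeff_eq_0)
  ultimately show ?thesis by blast
qed

lemma small_poly_eq_0:
  assumes min: "\<And>h. ieval h z = 0 \<Longrightarrow> h \<noteq> 0 \<Longrightarrow> degree g \<le> degree h"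
    and r: "ieval r z = 0" "\<forall>i\<ge>degree g. coeff r i = 0"
  shows "r = 0"
  using min[OF r(1)] r(2) leading_coeff_0_iff by blast

lemma minimal_poly_pseudo_dvd:
  assumes g: "g \<noteq> 0" "ieval g z = 0" "\<And>h. ieval h z = 0 \<Longrightarrow> h \<noteq> 0 \<Longrightarrow> degree g \<le> degree h"
    and h: "ieval h z = 0"
  obtains c q where "c \<noteq> 0" "smult c h = g * q"
proof -
  obtain c q r where cqr: "c \<noteq> 0" "smult c h = g * q + r" "\<forall>i\<ge>degree g. coeff r i = 0"
    using minimal_poly_pseudo_division[OF g(1)] by blast
  have "ieval r z = 0" using arg_cong[OF cqr(2), of "\<lambda>p. ieval p z"] h g(2) by simp
  then have "r = 0" using small_poly_eq_0[OF g(3) _ cqr(3)] by simp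
  with cqr that show ?thesis by simp
qed

lemma minimal_poly_root:
  assumes g: "g \<noteq> 0" "ieval g z = 0" "\<And>h. ieval h z = 0 \<Longrightarrow> h \<noteq> 0 \<Longrightarrow> degree g \<le> degree h"
    and "ieval h z = 0" "ieval g w = 0"
  shows "ieval h w = 0"
proof -
  obtain c q where cq: "c \<noteq> 0" "smult c h = g * q" using minimal_poly_pseudo_dvd[of g z h] g assms(4) by blast
  show ?thesis using arg_cong[OF cq(2), of "\<lambda>p. ieval p w"] assms(5) cq(1) by simp
qed

text \<open>Landau's argument. Up to a common denominator \<open>N\<close>, the number \<open>N
  g(z\<^sup>k)\<close> has integral coordinates with respect to \<open>1, z, \<dots>,
  z\<^sup>d\<^sup>-\<^sup>1\<close>, where \<open>d\<close> is the degree of \<open>g\<close>. These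
  depend only on \<open>k\<close> modulo \<open>n\<close>, so they are bounded by some
  \<open>A\<close>. For a prime \<open>k = q\<close> they are divisible by \<open>q\<close>, since
  \<open>g(z) = 0\<close> and \<open>g(z\<^sup>q)\<close> is congruent to
  \<open>g(z)\<^sup>q\<close>. If \<open>q > A\<close>, they vanish.\<close>

lemma landau_large_primes:
  assumes n: "n > 0" "z ^ n = (1::complex)"
    and g: "g \<noteq> 0" "ieval g z = 0" "\<And>h. ieval h z = 0 \<Longrightarrow> h \<noteq> 0 \<Longrightarrow> degree g \<le> degree h"
  obtains A :: nat where "\<And>q. Factorial_Ring.prime q \<Longrightarrow> q > A \<Longrightarrow> ieval g (z ^ q) = 0"
proof -
  define small where "small r \<longleftrightarrow> (\<forall>i\<ge>degree g. coeff r i = 0)" for r :: "int poly"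
  have red: "\<exists>c r. c \<noteq> 0 \<and> of_int c * z ^ j = ieval r z \<and> small r" for j
  proof -
    obtain c q r where c: "c \<noteq> 0" and eq: "smult c (monom 1 j) = g * q + r" and r: "small r"
      using minimal_poly_pseudo_division[OF g(1)] unfolding small_def by blast
    have "of_int c * z ^ j = ieval r z"
      using arg_cong[OF eq, of "\<lambda>p. ieval p z"] g(2) by simp
    with c r show ?thesis by blast
  qed
  then obtain c r where cr: "\<And>j. c j \<noteq> 0" "\<And>j. of_int (c j) * z ^ j = ieval (r j) z" "\<And>j. small (r j)"
    by metis
  \<comment> \<open>The common denominator; only exponents below \<open>n\<close> occur, as \<open>z ^ n = 1\<close>.\<close>
  define N where "N = (\<Prod>j<n. c j)"
  have N0: "N \<noteq> 0" using cr(1) by (simp add: N_def)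
  note zmod = power_mod_period[OF n(2)]
  have coords: "\<exists>s. of_int N * ieval h z = ieval s z \<and> small s" for h
  proof -
    define s where "s = (\<Sum>k\<le>degree h. smult (coeff h k * (\<Prod>j\<in>{..<n} - {k mod n}. c j)) (r (k mod n)))"
    have "of_int N * ieval h z = (\<Sum>k\<le>degree h. of_int (coeff h k) * (of_int N * z ^ k))"
      by (simp add: ieval_altdef sum_distrib_left mult_ac)
    also have "\<dots> = ieval s z"
      unfolding s_def ieval_sum
    proof (rule sum.cong)
      fix k
      have "N = c (k mod n) * (\<Prod>j\<in>{..<n} - {k mod n}. c j)"
        unfolding N_def using n(1) by (intro prod.remove) auto
      then show "of_int (coeff h k) * (of_int N * z ^ k)
          = ieval (smult (coeff h k * (\<Prod>j\<in>{..<n} - {k mod n}. c j)) (r (k mod n))) z"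
        using cr(2)[of "k mod n"] zmod[of k] by (simp add: mult_ac)
    qed simp
    finally show ?thesis
      using cr(3) by (intro exI[of _ s]) (auto simp: s_def small_def coeff_sum)
  qed
  have "\<exists>s. of_int N * ieval g (z ^ k) = ieval s z \<and> small s" for k
    using ieval_substitute_power[of g k] coords by metis
  then obtain R where R: "\<And>k. of_int N * ieval g (z ^ k) = ieval (R k) z" "\<And>k. small (R k)"
    by metis
  define A where "A = nat (\<Sum>k<n. \<Sum>i\<le>degree g. \<bar>coeff (R k) i\<bar>)"
  show ?thesis
  proof (rule that[of A])
    fix q assume q: "Factorial_Ring.prime q" "q > A"
    obtain h where "ieval g (z ^ q) = ieval g z ^ q + of_nat q * ieval h z"
      using ieval_frobenius[OF q(1)] by blast
    then have gq: "ieval g (z ^ q) = of_nat q * ieval h z"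
      using g(2) prime_gt_0_nat[OF q(1)] by simp
    obtain s where s: "of_int N * ieval h z = ieval s z" "small s" using coords by blast
    define k where "k = q mod n"
    have k: "k < n" "z ^ q = z ^ k" using n(1) zmod[of q] by (auto simp: k_def)
    have "ieval (R k - smult (int q) s) z = of_int N * (ieval g (z ^ q) - of_nat q * ieval h z)"
      using R(1)[of k] s(1)[symmetric] k(2) by (simp add: algebra_simps)
    then have "ieval (R k - smult (int q) s) z = 0" using gq by simp
    moreover have "small (R k - smult (int q) s)" using R(2) s(2) by (simp add: small_def)
    ultimately have "R k - smult (int q) s = 0"
      using small_poly_eq_0[OF g(3)] unfolding small_def by blast
    then have Rk: "R k = smult (int q) s" by simp
    have "coeff (R k) i = 0" for i
    proof (cases "i \<le> degree g")
      case True
      have "\<bar>coeff (R k) i\<bar> \<le> (\<Sum>i\<le>degree g. \<bar>coeff (R k) i\<bar>)"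
        using True member_le_sum[of i "{..degree g}" "\<lambda>i. \<bar>coeff (R k) i\<bar>"] by simp
      moreover have "(\<Sum>i\<le>degree g. \<bar>coeff (R k) i\<bar>) \<le> (\<Sum>k<n. \<Sum>i\<le>degree g. \<bar>coeff (R k) i\<bar>)"
        using k(1) by (intro member_le_sum[of k "{..<n}" "\<lambda>k. \<Sum>i\<le>degree g. \<bar>coeff (R k) i\<bar>"])
          (auto intro: sum_nonneg)
      moreover have "(\<Sum>k<n. \<Sum>i\<le>degree g. \<bar>coeff (R k) i\<bar>) < int q" using q(2) by (simp add: A_def)
      ultimately have "\<bar>coeff (R k) i\<bar> < int q" by linarith
      moreover have "int q dvd coeff (R k) i" using Rk by simp
      ultimately show ?thesis by (metis abs_ge_zero abs_of_nat dvd_imp_le_int linorder_not_less)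
    next
      case False
      then show ?thesis using R(2) by (simp add: small_def)
    qed
    then have "R k = 0" by (simp add: poly_eq_iff)
    then show "ieval g (z ^ q) = 0" using R(1)[of k] N0 k(2) by simp
  qed
qed

text \<open>Add to \<open>k\<close> the product of \<open>n\<close> and of all small primes that do not divide
  \<open>k\<close>: a small prime then divides exactly one of the two summands.\<close>

lemma coprime_representative_large_factors:
  assumes "coprime k (n::nat)" "k > 0"
  obtains l where "[l = k] (mod n)" "l > 0" "\<And>q. Factorial_Ring.prime q \<Longrightarrow> q dvd l \<Longrightarrow> q > A"
proof -
  define P where "P = (\<Prod>r\<in>{r. Factorial_Ring.prime r \<and> r \<le> A \<and> \<not> r dvd k}. r)"
  have fin: "finite {r. Factorial_Ring.prime r \<and> r \<le> A \<and> \<not> r dvd k}" by (rule finite_subset[of _ "{..A}"]) auto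
  have P: "r dvd P \<longleftrightarrow> r \<le> A \<and> \<not> r dvd k" if r: "Factorial_Ring.prime r" for r
  proof
    assume "r dvd P"
    then obtain r' where "Factorial_Ring.prime r'" "r' \<le> A" "\<not> r' dvd k" "r dvd r'"
      using prime_dvd_prod_iff[OF fin, of r "\<lambda>x. x"] r by (auto simp: P_def)
    then show "r \<le> A \<and> \<not> r dvd k" using r primes_dvd_imp_eq by auto
  next
    assume "r \<le> A \<and> \<not> r dvd k"
    then show "r dvd P" unfolding P_def using r fin by (intro dvd_prodI) auto
  qed
  show ?thesis
  proof (rule that[of "k + n * P"])
    show "[k + n * P = k] (mod n)" by (simp add: cong_def)
    show "k + n * P > 0" using assms by simp
    fix q assume q: "Factorial_Ring.prime q" "q dvd k + n * P"
    show "q > A"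
    proof (rule ccontr)
      assume "\<not> q > A"
      show False
      proof (cases "q dvd k")
        case True
        then have "q dvd n * P" using q(2) by (simp add: dvd_add_right_iff)
        then have "q dvd n" using q(1) True P[OF q(1)] by (simp add: prime_dvd_mult_iff)
        with True assms(1) q(1) show False by (meson not_coprimeI not_prime_unit)
      next
        case False
        then have "q dvd P" using P[OF q(1)] \<open>\<not> q > A\<close> by simp
        then have "q dvd k" using q(2) by (metis dvd_add_left_iff dvd_mult)
        with False show False by simp
      qed
    qed
  qed
qed

text \<open>The irreducibility of the cyclotomic polynomial in the form needed here. By the preceding lemma
  \<open>k\<close> may be replaced by a product of large primes, and each of these preserves the
  roots of the minimal polynomial.\<close>

theorem conjugate_root_of_unity:
  assumes n: "n > 0" "z ^ n = (1::complex)" and k: "coprime k n" and h: "ieval h z = 0"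
  shows "ieval h (z ^ k) = 0"
proof -
  obtain g where g: "g \<noteq> 0" "ieval g z = 0" "\<And>h. ieval h z = 0 \<Longrightarrow> h \<noteq> 0 \<Longrightarrow> degree g \<le> degree h"
    using minimal_int_poly[OF n] by metis
  have multiple: "ieval h w = 0" if "ieval h z = 0" "ieval g w = 0" for h w
    using minimal_poly_root[of g z h w] g that by blast
  obtain A where A: "\<And>q. Factorial_Ring.prime q \<Longrightarrow> q > A \<Longrightarrow> ieval g (z ^ q) = 0"
    using landau_large_primes[OF n g] by metis
  have large: "ieval h (z ^ l) = 0"
    if "l > 0" "\<And>q. Factorial_Ring.prime q \<Longrightarrow> q dvd l \<Longrightarrow> q > A" "ieval h z = 0" for l h
    using that
  proof (induction l arbitrary: h rule: less_induct)
    case (less l)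
    show ?case
    proof (cases "l = 1")
      case False
      then obtain q where q: "Factorial_Ring.prime q" "q dvd l" using prime_factor_nat by blast
      then obtain l' where l': "l = q * l'" by auto
      with less.prems(1) prime_gt_1_nat[OF q(1)] have "l' < l" "l' > 0" by auto
      obtain h' where h': "\<And>w. ieval h' w = ieval h (w ^ l')" using ieval_substitute_power by metis
      have "ieval h' z = 0" unfolding h' using \<open>l' < l\<close> \<open>l' > 0\<close> less.prems l' by (intro less.IH) auto
      then have "ieval h' (z ^ q) = 0" using multiple A q less.prems(2) by blast
      then show ?thesis using h' l' by (simp add: power_mult)
    qed (use less.prems in simp)
  qed
  show ?thesis
  proof (cases "k = 0")
    case True
    then show ?thesis using k n h by simp
  next
    case False
    then obtain l where l: "[l = k] (mod n)" "l > 0" "\<And>q. Factorial_Ring.prime q \<Longrightarrow> q dvd l \<Longrightarrow> q > A"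
      using coprime_representative_large_factors[OF k, of A] by blast
    have "z ^ l = z ^ k" using l(1) power_mod_period[OF n(2)] by (metis cong_def)
    with large[OF l(2,3) h] show ?thesis by simp
  qed
qed

lemma pow_CC [simp]: "x [^]\<^bsub>CC\<^esub> (n::nat) = x ^ n"
  by (induction n) (auto simp: CC.nat_pow_Suc)

lemma domain_CC: "domain CC"
  using field_CC by (rule field.axioms)

lemma root_of_unity_algebraic:
  assumes n: "n > 0" "z ^ n = (1::complex)"
  shows "(CC.algebraic over \<rat>) z"
proof (rule CC.algebraicI)
  have aux: "CC.eval (replicate m 0 @ [- 1]) z = - 1" for m
    by (induction m) simp_all
  let ?p = "1 # replicate (n - 1) 0 @ [- 1] :: complex list"
  show "?p \<in> carrier (\<rat>[X]\<^bsub>CC\<^esub>)"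
    by (auto simp: univ_poly_def polynomial_def)
  show "CC.eval ?p z = \<zero>\<^bsub>CC\<^esub>" using n aux by (simp add: n)
qed simp

text \<open>Since \<open>z\<close> is algebraic, its polynomial expressions already form a field; this is the
  description on which automorphisms can be defined.\<close>

lemma adjoin_root_of_unity:
  assumes n: "n > 0" "z ^ n = (1::complex)"
  shows "adjoin \<rat> {z} = {ieval h z / of_int m | h m. m \<noteq> 0}" (is "_ = ?V")
proof
  have "ieval h z / of_int m \<in> adjoin \<rat> {z}" for h m
    unfolding ieval_altdef using adjoin_gens[of "{z}" \<rat>]
    by (intro subfield_intros subfield_adjoin) auto
  then show "?V \<subseteq> adjoin \<rat> {z}" by auto
next
  have "subfield (CC.simple_extension \<rat> z) CC"
    using domain.simple_extension_is_subfield[OF domain_CC subfield_Rats]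
      root_of_unity_algebraic[OF n] by simp
  then have "adjoin \<rat> {z} \<subseteq> CC.simple_extension \<rat> z"
    using CC.simple_extension_incl[of \<rat> z] CC.simple_extension_mem[of \<rat> z]
      subfieldE(1)[OF subfield_Rats]
    by (intro adjoin_least) auto
  moreover have "x \<in> ?V" if "x \<in> CC.simple_extension \<rat> z" for x
    using that
  proof (induction rule: CC.simple_extension.induct)
    case zero
    show ?case by (intro CollectI, rule exI[of _ 0], rule exI[of _ 1]) simp
  next
    case (lin k1 k2)
    then obtain h m where h: "k1 = ieval h z / of_int m" "m \<noteq> 0" by auto
    obtain a b :: int where ab: "k2 = of_int a / of_int b" "b \<noteq> 0"
      using lin(2) by (cases k2 rule: Rats_cases') auto
    have "k1 * z + k2 = ieval (pCons (a * m) (smult b h)) z / of_int (m * b)"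
      unfolding h(1) ab(1) using h(2) ab(2) by (simp add: field_simps)
    with h(2) ab(2) show ?case by (auto intro!: exI[of _ "pCons (a * m) (smult b h)"] exI[of _ "m * b"])
  qed
  ultimately show "adjoin \<rat> {z} \<subseteq> ?V" by blast
qed

lemma primitive_power_eq_iff:
  assumes n: "n > 0" and prim: "\<And>j. z ^ j = (1::complex) \<longleftrightarrow> n dvd j"
  shows "z ^ i = z ^ j \<longleftrightarrow> [i = j] (mod n)"
proof -
  have z0: "z \<noteq> 0" using prim[of n] n by (metis dvd_refl power_0_left neq0_conv zero_neq_one)
  have *: "z ^ i = z ^ j \<longleftrightarrow> [i = j] (mod n)" if "i \<le> j" for i j
  proof -
    have "z ^ j = z ^ i * z ^ (j - i)" using that by (simp flip: power_add)
    then have "z ^ i = z ^ j \<longleftrightarrow> z ^ (j - i) = 1" using z0 by auto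
    also have "\<dots> \<longleftrightarrow> [i = j] (mod n)"
      unfolding prim using that by (metis cong_altdef_nat cong_sym_eq)
    finally show ?thesis .
  qed
  show ?thesis using *[of i j] *[of j i] by (cases "i \<le> j") (auto simp: cong_sym_eq)
qed

lemma primitive_powers_inj:
  assumes n: "n > 0" and prim: "\<And>j. z ^ j = (1::complex) \<longleftrightarrow> n dvd j"
    and S: "\<And>i j. i \<in> S \<Longrightarrow> j \<in> S \<Longrightarrow> i < j \<Longrightarrow> j - i < n"
  shows "inj_on (\<lambda>k. z ^ k) S"
proof (rule linorder_inj_onI)
  fix i j assume ij: "i < j" "i \<in> S" "j \<in> S"
  then have "\<not> n dvd j - i" using S[of i j] by (auto dest: dvd_imp_le)
  then show "z ^ i \<noteq> z ^ j"
    unfolding primitive_power_eq_iff[OF n prim] using ij(1) by (metis cong_altdef_nat cong_sym_eq less_imp_le)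
qed auto

text \<open>A root \<open>w\<close> of the minimal polynomial \<open>g\<close> is an \<open>n\<close>-th root
  of unity, and a primitive one: if \<open>h(w) = 0\<close> then \<open>h(z) = 0\<close>, as
  \<open>h(z)\<close> would otherwise have an inverse \<open>v(z)/m\<close> and \<open>h v -
  m\<close>, up to a constant a multiple of \<open>g\<close>, would not vanish at \<open>w\<close>.
  The roots of \<open>g\<close> are simple because those of \<open>X\<^sup>n - 1\<close> are, so the
  degree of \<open>g\<close> is their number.\<close>

lemma degree_minimal_poly_le_totient:
  assumes n: "n > 0" and prim: "\<And>j. z ^ j = (1::complex) \<longleftrightarrow> n dvd j"
    and g: "g \<noteq> 0" "ieval g z = 0" "\<And>h. ieval h z = 0 \<Longrightarrow> h \<noteq> 0 \<Longrightarrow> degree g \<le> degree h"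
  shows "degree g \<le> totient n"
proof -
  have zn: "z ^ n = 1" using prim by simp
  have multiple: "ieval h w = 0" if "ieval h z = 0" "ieval g w = 0" for h w
    using minimal_poly_root[of g z h w] g that by blast
  have common: "ieval h z = 0" if w: "ieval g w = 0" "ieval h w = 0" for h w
  proof (rule ccontr)
    assume h0: "ieval h z \<noteq> 0"
    have "ieval h z \<in> adjoin \<rat> {z}"
      unfolding adjoin_root_of_unity[OF n zn] by (intro CollectI, rule exI[of _ h], rule exI[of _ 1]) simp
    then have "inverse (ieval h z) \<in> adjoin \<rat> {z}" by (rule subfield_inverse[OF subfield_adjoin])
    then obtain v m where v: "inverse (ieval h z) = ieval v z / of_int m" "m \<noteq> 0"
      unfolding adjoin_root_of_unity[OF n zn] by blast
    have "ieval (h * v - [:m:]) z = 0" using v h0 by (simp add: field_simps)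
    from multiple[OF this w(1)] w v show False by simp
  qed
  define G where "G = map_poly (of_int :: int \<Rightarrow> complex) g"
  have Gev: "poly G w = ieval g w" for w by (simp add: G_def ieval_def)
  have degG: "degree G = degree g" unfolding G_def by (rule degree_map_poly) simp
  have G0: "G \<noteq> 0" using g(1) by (simp add: G_def poly_eq_iff coeff_map_poly)
  obtain c q where cq: "c \<noteq> 0" "smult c (monom 1 n - 1) = g * q"
  proof (rule minimal_poly_pseudo_dvd[of g z "monom 1 n - 1"])
    show "ieval (monom 1 n - 1) z = 0" using zn by simp
  qed (use g in blast)+
  define Q where "Q = map_poly (of_int :: int \<Rightarrow> complex) q"
  have GQ: "smult (of_int c) (monom 1 n - 1) = G * Q"
  proof (rule poly_ext)
    fix w
    show "poly (smult (of_int c) (monom 1 n - 1)) w = poly (G * Q) w"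
      using arg_cong[OF cq(2), of "\<lambda>p. ieval p w"]
      by (simp add: Gev Q_def poly_monom) (simp add: ieval_def)
  qed
  have sep: "\<not> (poly G a = 0 \<and> poly (pderiv G) a = 0)" for a
  proof
    assume a: "poly G a = 0 \<and> poly (pderiv G) a = 0"
    have "poly (smult (of_int c) (monom 1 n - 1)) a = 0" unfolding GQ using a by simp
    then have an: "a ^ n = 1" using cq(1) by (simp add: poly_monom)
    have "poly (pderiv (smult (of_int c) (monom 1 n - 1))) a = 0"
      unfolding GQ pderiv_mult using a by simp
    then have "a ^ (n - 1) = 0" using cq(1) n by (simp add: pderiv_smult pderiv_diff pderiv_monom poly_monom)
    with an n show False by (metis power_eq_0_iff power_0_left zero_neq_one)
  qed
  have "smult (lead_coeff G) (\<Prod>w|poly G w = 0. [:-w, 1:]) = G"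
    by (rule complex_poly_decompose_rsquarefree) (use sep in \<open>simp add: rsquarefree_roots\<close>)
  then have "degree g = degree (smult (lead_coeff G) (\<Prod>w|poly G w = 0. [:-w, 1:]))" using degG by simp
  also have "\<dots> = degree (\<Prod>w|poly G w = 0. [:-w, 1:])" using G0 by simp
  also have "\<dots> = card {w. poly G w = 0}" by (subst degree_prod_sum_eq) auto
  also have "\<dots> \<le> card ((\<lambda>k. z ^ k) ` totatives n)"
  proof (intro card_mono subsetI)
    fix w assume "w \<in> {w. poly G w = 0}"
    then have w: "ieval g w = 0" by (simp add: Gev)
    then have "ieval (smult c (monom 1 n - 1)) w = 0" unfolding cq(2) by simp
    then have "w ^ n = 1" using cq(1) by simp
    have "inj_on (\<lambda>k. z ^ k) {..<n}" by (rule primitive_powers_inj[OF n prim]) auto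
    then have "card ((\<lambda>k. z ^ k) ` {..<n}) = n" by (simp add: card_image)
    moreover have "(\<lambda>k. z ^ k) ` {..<n} \<subseteq> {w. w ^ n = 1}"
      using zn by (auto simp: power_mult[symmetric] mult.commute[of _ n]) (simp add: power_mult)
    ultimately have "(\<lambda>k. z ^ k) ` {..<n} = {w. w ^ n = 1}"
      using card_roots_unity_eq[OF n] finite_roots_unity[of n, where 'a=complex] n
      by (intro card_subset_eq) auto
    then obtain k where k: "k < n" "w = z ^ k" using \<open>w ^ n = 1\<close> by blast
    have "coprime k n"
    proof (rule ccontr)
      assume "\<not> coprime k n"
      define d where "d = gcd k n"
      have "d dvd k" "d dvd n" by (simp_all add: d_def)
      moreover have "d \<noteq> 1" using \<open>\<not> coprime k n\<close> coprime_iff_gcd_eq_1 unfolding d_def by blast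
      moreover have "d \<noteq> 0" using n by (simp add: d_def)
      ultimately have d: "d > 1" "d dvd k" "d dvd n" by simp_all
      have "ieval (monom 1 (n div d) - 1) w = z ^ (k * (n div d)) - 1" using k by (simp add: power_mult)
      also have "k * (n div d) = n * (k div d)" 
        unfolding div_mult_swap[OF d(2)] div_mult_swap[OF d(3)] by (simp add: mult.commute)
      finally have "ieval (monom 1 (n div d) - 1) w = 0" using zn by (simp add: power_mult)
      from common[OF w this] have "n dvd n div d" using prim by simp
      moreover have "n div d < n" "n div d \<noteq> 0" using d n by (simp_all add: dvd_div_eq_0_iff)
      ultimately show False by (auto dest: dvd_imp_le)
    qed
    show "w \<in> (\<lambda>k. z ^ k) ` totatives n"
    proof (cases "k = 0")
      case True
      with \<open>coprime k n\<close> have "n = 1" by simp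
      then show ?thesis using k True prim[of 1] by (auto simp: totatives_def image_iff)
    next
      case False
      then show ?thesis using k \<open>coprime k n\<close> by (auto simp: totatives_def)
    qed
  qed auto
  also have "\<dots> \<le> card (totatives n)" by (rule card_image_le) simp
  finally show ?thesis by (simp add: totient_def)
qed

lemma Span_dimension_le_length:
  assumes K: "subfield K CC"
  shows "\<exists>n\<le>length Us. CC.dimension n K (CC.Span K Us)"
proof (induction Us)
  case Nil
  then show ?case using CC.zero_dim by auto
next
  case (Cons u Us)
  then obtain n where n: "n \<le> length Us" "CC.dimension n K (CC.Span K Us)" by blast
  show ?case
  proof (cases "u \<in> CC.Span K Us")
    case True
    have "CC.Span K (u # Us) = CC.Span K Us"
    proof
      show "CC.Span K (u # Us) \<subseteq> CC.Span K Us"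
        using True CC.Span_base_incl[OF K, of Us]
        by (intro CC.subalgebra_Span_incl[OF K CC.Span_is_subalgebra[OF K]]) (auto simp del: CC.Span.simps)
      show "CC.Span K Us \<subseteq> CC.Span K (u # Us)"
        using CC.Span_base_incl[OF K, of "u # Us"]
        by (intro CC.subalgebra_Span_incl[OF K CC.Span_is_subalgebra[OF K]]) (auto simp del: CC.Span.simps)
    qed
    with n show ?thesis by (intro exI[of _ n]) (simp del: CC.Span.simps)
  next
    case False
    from CC.Suc_dim[OF _ this n(2)] n(1) show ?thesis by (intro exI[of _ "Suc n"]) simp
  qed
qed

lemma finite_degree_adjoin_root_of_unity:
  assumes n: "n > 0" and prim: "\<And>j. z ^ j = (1::complex) \<longleftrightarrow> n dvd j"
  obtains d where "has_degree (adjoin \<rat> {z}) \<rat> d" "d \<le> totient n"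
proof -
  have zn: "z ^ n = 1" using prim by simp
  obtain g where g: "g \<noteq> 0" "ieval g z = 0" "\<And>h. ieval h z = 0 \<Longrightarrow> h \<noteq> 0 \<Longrightarrow> degree g \<le> degree h"
    using minimal_int_poly[OF n zn] by metis
  define Us where "Us = map (\<lambda>i. z ^ i) [0..<degree g]"
  let ?S = "CC.Span \<rat> Us"
  have S: "subalgebra \<rat> ?S CC" by (rule CC.Span_is_subalgebra[OF subfield_Rats]) simp
  have sub: "x + y \<in> ?S" "k * x \<in> ?S" if "x \<in> ?S" "y \<in> ?S" "k \<in> \<rat>" for x y k
    using subgroup.m_closed[OF subalgebra.axioms(1)[OF S]] subalgebra.smult_closed[OF S] that by fastforce+
  have zero: "0 \<in> ?S" using subgroup.one_closed[OF subalgebra.axioms(1)[OF S]] by simp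
  have Us: "z ^ i \<in> ?S" if "i < degree g" for i
    using CC.Span_base_incl[OF subfield_Rats, of Us] that by (auto simp: Us_def)
  have "adjoin \<rat> {z} \<subseteq> ?S"
  proof
    fix x assume "x \<in> adjoin \<rat> {z}"
    then obtain h m where x: "x = ieval h z / of_int m" "m \<noteq> 0"
      unfolding adjoin_root_of_unity[OF n zn] by blast
    obtain c q r where cqr: "c \<noteq> 0" "smult c h = g * q + r" "\<forall>i\<ge>degree g. coeff r i = 0"
      using minimal_poly_pseudo_division[OF g(1)] by blast
    have "of_int c * ieval h z = ieval r z"
      using arg_cong[OF cqr(2), of "\<lambda>p. ieval p z"] g(2) by simp
    then have "ieval r z = of_int (c * m) * x" using x by simp
    then have "x = inverse (of_int (c * m)) * ieval r z"
      using x(2) cqr(1) by (simp add: field_simps)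
    moreover have "ieval r z \<in> ?S"
    proof -
      have "sum f {..k} \<in> ?S" if "\<And>i. f i \<in> ?S" for f and k :: nat
        by (induction k) (simp_all add: that sub(1)[OF _ _ Rats_0] del: CC.Span.simps)
      moreover have "of_int (coeff r i) * z ^ i \<in> ?S" for i
        using cqr(3) zero sub(2)[OF Us Us] by (cases "i < degree g") (auto simp del: CC.Span.simps)
      ultimately show ?thesis unfolding ieval_altdef by (simp del: CC.Span.simps)
    qed
    ultimately show "x \<in> ?S" using sub(2) by (auto simp del: CC.Span.simps)
  qed
  moreover have "?S \<subseteq> adjoin \<rat> {z}"
    using adjoin_gens[of "{z}" \<rat>]
    by (intro CC.subalgebra_Span_incl[OF subfield_Rats subfield_subalgebra])
      (auto simp: Us_def intro: subfield_adjoin subfield_power adjoin_base[THEN subsetD])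
  ultimately have eq: "?S = adjoin \<rat> {z}" by blast
  obtain m where m: "m \<le> length Us" "CC.dimension m \<rat> ?S"
    using Span_dimension_le_length[OF subfield_Rats] by blast
  have "length Us \<le> totient n" using degree_minimal_poly_le_totient[OF n prim g] by (simp add: Us_def)
  moreover have "has_degree (adjoin \<rat> {z}) \<rat> m"
    using m(2) eq subfield_adjoin subfield_Rats adjoin_base
    by (auto simp: has_degree_def simp del: CC.Span.simps)
  ultimately show ?thesis using that m(1) by simp
qed

text \<open>The map \<open>h(z)/m \<mapsto> h(z\<^sup>k)/m\<close>; it is well defined because relations at
  \<open>z\<close> also hold at \<open>z\<^sup>k\<close>.\<close>

lemma root_of_unity_automorphism:
  assumes n: "n > 0" and prim: "\<And>j. z ^ j = (1::complex) \<longleftrightarrow> n dvd j" and k: "coprime k n"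
  shows "\<exists>\<sigma>\<in>carrier (Gal (adjoin \<rat> {z}) \<rat>). \<sigma> z = z ^ k"
proof -
  let ?L = "adjoin \<rat> {z}"
  have zn: "z ^ n = 1" using prim by simp
  note L = adjoin_root_of_unity[OF n zn]
  have sub: "subfield ?L CC" by (rule subfield_adjoin)
  define \<sigma> where "\<sigma> = (\<lambda>x. SOME y. \<exists>h m. m \<noteq> 0 \<and> x = ieval h z / of_int m \<and> y = ieval h (z ^ k) / of_int m)"
  have \<sigma>: "\<sigma> x = ieval h (z ^ k) / of_int m" if x: "x = ieval h z / of_int m" "m \<noteq> 0" for x h m
    unfolding \<sigma>_def
  proof (rule some_equality)
    fix y assume "\<exists>h m. m \<noteq> 0 \<and> x = ieval h z / of_int m \<and> y = ieval h (z ^ k) / of_int m"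
    then obtain h' m' where h': "m' \<noteq> 0" "x = ieval h' z / of_int m'" "y = ieval h' (z ^ k) / of_int m'" by blast
    have "ieval (smult m' h - smult m h') z = 0" using x h' by (simp add: field_simps)
    from conjugate_root_of_unity[OF n zn k this]
    have "ieval h' (z ^ k) * of_int m = ieval h (z ^ k) * of_int m'" by (simp add: mult.commute)
    with x(2) h'(1) show "y = ieval h (z ^ k) / of_int m"
      unfolding h'(3) by (simp add: frac_eq_eq)
  qed (use x in blast)
  have hom: "hom_on ?L \<sigma>"
    unfolding hom_on_def
  proof (intro conjI ballI)
    show "\<sigma> 1 = 1" using \<sigma>[of 1 1 1] by simp
    fix x y assume "x \<in> ?L" "y \<in> ?L"
    then obtain h m h' m' where h: "x = ieval h z / of_int m" "m \<noteq> 0"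
        "y = ieval h' z / of_int m'" "m' \<noteq> 0"
      unfolding L by blast
    have "x + y = ieval (smult m' h + smult m h') z / of_int (m * m')"
      unfolding h(1,3) using h(2,4) by (simp add: add_frac_eq)
    from \<sigma>[OF this] h(2,4)
    have "\<sigma> (x + y) = (of_int m' * ieval h (z ^ k) + of_int m * ieval h' (z ^ k)) / (of_int m * of_int m')"
      by simp
    also have "\<dots> = \<sigma> x + \<sigma> y"
      unfolding \<sigma>[OF h(1,2)] \<sigma>[OF h(3,4)] using h(2,4) by (simp add: add_frac_eq)
    finally show "\<sigma> (x + y) = \<sigma> x + \<sigma> y" .
    have "x * y = ieval (h * h') z / of_int (m * m')" unfolding h(1,3) by simp
    from \<sigma>[OF this] h(2,4) show "\<sigma> (x * y) = \<sigma> x * \<sigma> y"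
      unfolding \<sigma>[OF h(1,2)] \<sigma>[OF h(3,4)] by simp
  qed
  have z: "\<sigma> z = z ^ k" using \<sigma>[of z "[:0, 1:]" 1] by simp
  have into: "\<sigma> x \<in> ?L" if xL: "x \<in> ?L" for x
  proof -
    obtain h m where "x = ieval h z / of_int m" "m \<noteq> 0" using xL L by auto
    then have "\<sigma> x = ieval h (z ^ k) / of_int m" by (rule \<sigma>)
    moreover have "ieval h (z ^ k) / of_int m \<in> ?L"
      unfolding ieval_altdef using adjoin_gens[of "{z}" \<rat>]
      by (intro subfield_intros subfield_adjoin) auto
    ultimately show ?thesis by simp
  qed
  obtain d where "has_degree ?L \<rat> d" using finite_degree_adjoin_root_of_unity[OF n prim] by blast
  then have "bij_betw \<sigma> ?L ?L"
    by (rule endomorphism_bij[OF _ hom]) (auto simp: hom_on_Rats[OF sub hom] into)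
  then have "restrict \<sigma> ?L \<in> carrier (Gal ?L \<rat>)"
    using hom adjoin_base[of \<rat> "{z}"] hom_on_restrict[OF sub, of \<sigma>]
    by (auto simp: Gal_iff hom_on_Rats[OF sub hom] cong: bij_betw_cong)
  moreover have "z \<in> ?L" using adjoin_gens by blast
  ultimately show ?thesis using z by (intro bexI[of _ "restrict \<sigma> ?L"]) auto
qed

lemma cis_root_of_unity_iff:
  assumes "n > 0" shows "cis (2 * pi / real n) ^ j = 1 \<longleftrightarrow> n dvd j"
proof -
  have "cis t = 1 \<longleftrightarrow> cos t = 1" for t
    using sin_cos_squared_add[of t] by (cases "cos t = 1") (auto simp: complex_eq_iff)
  then have "cis (2 * pi / real n) ^ j = 1 \<longleftrightarrow> (\<exists>k::int. real j * (2 * pi / real n) = of_int k * 2 * pi)"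
    unfolding DeMoivre by (simp add: cos_one_2pi_int)
  also have "\<dots> \<longleftrightarrow> (\<exists>k::int. real j = of_int k * real n)"
    using assms by (auto simp: field_simps)
  also have "\<dots> \<longleftrightarrow> n dvd j"
  proof
    assume "\<exists>k::int. real j = of_int k * real n"
    then obtain k :: int where "real j = of_int k * real n" by blast
    then have "int j = k * int n" by (metis of_int_eq_iff of_int_mult of_int_of_nat_eq)
    then show "n dvd j" by (metis dvd_triv_right int_dvd_int_iff)
  next
    assume "n dvd j"
    then obtain k where "j = n * k" by blast
    then show "\<exists>k::int. real j = of_int k * real n" by (intro exI[of _ "int k"]) simp
  qed
  finally show ?thesis .
qed

text \<open>The automorphisms found above bound the degree from below, the minimal polynomial bounds it from
  above.\<close>

theorem galois_degree_cyclotomic: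
  assumes n: "n > 0" shows "galois_degree (cyclotomic n) \<rat> (totient n)"
proof -
  define z where "z = cis (2 * pi / real n)"
  have prim: "z ^ j = 1 \<longleftrightarrow> n dvd j" for j unfolding z_def by (rule cis_root_of_unity_iff[OF n])
  have L: "cyclotomic n = adjoin \<rat> {z}" by (simp add: cyclotomic_def z_def)
  have zL: "z \<in> cyclotomic n" unfolding L using adjoin_gens by blast
  obtain d where d: "has_degree (cyclotomic n) \<rat> d" "d \<le> totient n"
    using finite_degree_adjoin_root_of_unity[OF n prim] L by metis
  have "\<exists>\<sigma>\<in>carrier (Gal (cyclotomic n) \<rat>). \<sigma> z = z ^ k" if "k \<in> totatives n" for k
    using root_of_unity_automorphism[OF n prim, of k] that L by (auto simp: totatives_def)
  then obtain \<sigma> where \<sigma>: "\<And>k. k \<in> totatives n \<Longrightarrow> \<sigma> k \<in> carrier (Gal (cyclotomic n) \<rat>)"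
      "\<And>k. k \<in> totatives n \<Longrightarrow> \<sigma> k z = z ^ k" by metis
  have inj: "inj_on (\<lambda>k. z ^ k) (totatives n)"
    by (rule primitive_powers_inj[OF n prim]) (auto simp: totatives_def)
  have "inj_on \<sigma> (totatives n)"
  proof (rule inj_onI)
    fix i j assume ij: "i \<in> totatives n" "j \<in> totatives n" "\<sigma> i = \<sigma> j"
    then have "z ^ i = z ^ j" using \<sigma>(2)[of i] \<sigma>(2)[of j] by simp
    then show "i = j" by (rule inj_onD[OF inj _ ij(1,2)])
  qed
  then have "totient n = card (\<sigma> ` totatives n)" by (simp add: card_image totient_def)
  also have "\<dots> \<le> card (carrier (Gal (cyclotomic n) \<rat>))"
    using \<sigma>(1) finite_Gal[OF d(1)] by (intro card_mono) auto
  finally have "d = totient n" "card (carrier (Gal (cyclotomic n) \<rat>)) = totient n"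
    using d card_Gal_le[OF d(1)] by linarith+
  with d(1) show ?thesis by (simp add: galois_degree_def)
qed

section \<open>Quadratic extensions\<close>

lemma adjoin_sqrt:
  assumes L: "subfield L CC" and x: "x\<^sup>2 \<in> L"
  shows "adjoin L {x} = {u + v * x | u v. u \<in> L \<and> v \<in> L}" (is "_ = ?V")
proof (cases "x \<in> L")
  case True
  then have "adjoin L {x} = L" using L adjoin_base by (intro equalityI adjoin_least) auto
  moreover have "?V \<subseteq> L" using True by (auto intro!: subfield_intros L)
  moreover have "u \<in> ?V" if "u \<in> L" for u
    using that subfield_0[OF L] by (intro CollectI exI[of _ u] exI[of _ 0]) simp
  ultimately show ?thesis by auto
next
  case False
  have memV: "u + v * x \<in> ?V" if "u \<in> L" "v \<in> L" for u v using that by auto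
  have "subfield ?V CC"
  proof (rule subfield_CC_I)
    show "1 \<in> ?V" using memV[of 1 0] subfield_0[OF L] subfield_1[OF L] by simp
    fix s assume "s \<in> ?V"
    then obtain u v where s: "s = u + v * x" "u \<in> L" "v \<in> L" by blast
    show "- s \<in> ?V" using memV[of "- u" "- v"] s by (simp add: subfield_minus[OF L])
    show "inverse s \<in> ?V" if "s \<noteq> 0"
    proof -
      define d where "d = u\<^sup>2 - v\<^sup>2 * x\<^sup>2"
      have dL: "d \<in> L" unfolding d_def using s x
        by (intro subfield_diff[OF L] subfield_mult[OF L] x) (auto intro: subfield_power[OF L])
      have "u - v * x \<noteq> 0"
      proof
        assume eq: "u - v * x = 0"
        show False
        proof (cases "v = 0")
          case True
          with eq s that show False by simp
        next
          case False
          then have "x = u / v" using eq by (simp add: field_simps)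
          moreover have "u / v \<in> L" by (rule subfield_divide[OF L s(2,3)])
          ultimately show False using \<open>x \<notin> L\<close> by simp
        qed
      qed
      moreover have d: "d = s * (u - v * x)" by (simp add: d_def s(1) power2_eq_square algebra_simps)
      ultimately have "inverse s = (u - v * x) / d" unfolding d using that by (simp add: divide_inverse)
      also have "\<dots> = u / d + (- v / d) * x" by (simp add: diff_divide_distrib)
      also have "\<dots> \<in> ?V"
        by (rule memV[OF subfield_divide[OF L s(2) dL] subfield_divide[OF L subfield_minus[OF L s(3)] dL]])
      finally show ?thesis .
    qed
    fix t assume "t \<in> ?V"
    then obtain u' v' where t: "t = u' + v' * x" "u' \<in> L" "v' \<in> L" by blast
    have "s + t = (u + u') + (v + v') * x" by (simp add: s(1) t(1) algebra_simps)
    also have "\<dots> \<in> ?V" using s t by (intro memV subfield_add[OF L])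
    finally show "s + t \<in> ?V" .
    have "s * t = (u * u' + v * v' * x\<^sup>2) + (u * v' + v * u') * x"
      by (simp add: s(1) t(1) power2_eq_square algebra_simps)
    also have "\<dots> \<in> ?V" using s t x by (intro memV subfield_add[OF L] subfield_mult[OF L])
    finally show "s * t \<in> ?V" .
  qed
  then have "adjoin L {x} \<subseteq> ?V"
    using memV[of _ 0] memV[of 0 1] subfield_0[OF L] subfield_1[OF L] by (intro adjoin_least) auto
  moreover have "?V \<subseteq> adjoin L {x}"
    using adjoin_gens[of "{x}" L] adjoin_base[of L "{x}"] by (auto intro!: subfield_intros subfield_adjoin)
  ultimately show ?thesis by blast
qed

lemma has_degree_adjoin_sqrt:
  assumes L: "subfield L CC" and x: "x\<^sup>2 \<in> L"
  obtains j where "has_degree (adjoin L {x}) L j" "j \<le> 2"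
proof -
  have "CC.Span L [1, x] = adjoin L {x}"
  proof
    show "CC.Span L [1, x] \<subseteq> adjoin L {x}"
      using adjoin_gens[of "{x}" L]
      by (intro CC.subalgebra_Span_incl[OF L subfield_subalgebra[OF subfield_adjoin adjoin_base]])
        (auto intro: subfield_1 subfield_adjoin)
    show "adjoin L {x} \<subseteq> CC.Span L [1, x]"
      unfolding adjoin_sqrt[OF assms]
      by (fastforce simp: CC.line_extension_mem_iff intro: L)
  qed
  moreover obtain j where "j \<le> length [1, x]" "CC.dimension j L (CC.Span L [1, x])"
    using Span_dimension_le_length[OF L, of "[1, x]"] by blast
  ultimately show ?thesis
    using that[of j] L subfield_adjoin[of L "{x}"] adjoin_base[of L "{x}"]
    by (simp add: has_degree_def del: CC.Span.simps)
qed

text \<open>The root \<open>x\<close> is sent to any square root of the image of \<open>x\<^sup>2\<close>.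
  Either choice will do, because commutators supply both signs later.\<close>

lemma extend_hom_adjoin_sqrt:
  assumes L: "subfield L CC" and x: "x\<^sup>2 \<in> L" and h: "hom_on L \<phi>"
  shows "\<exists>\<psi>. hom_on (adjoin L {x}) \<psi> \<and> (\<forall>z\<in>L. \<psi> z = \<phi> z)"
proof (cases "x \<in> L")
  case True
  then have "adjoin L {x} = L" using L adjoin_base by (intro equalityI adjoin_least) auto
  with h show ?thesis by auto
next
  case False
  obtain y where y: "y\<^sup>2 = \<phi> (x\<^sup>2)" using power2_csqrt by blast
  have uniq: "u = u' \<and> v = v'" if "u + v * x = u' + v' * x" "u \<in> L" "v \<in> L" "u' \<in> L" "v' \<in> L" for u v u' v'
  proof -
    have "v = v'"
    proof (rule ccontr)
      assume "v \<noteq> v'"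
      then have "x = (u' - u) / (v - v')" using that(1) by (simp add: field_simps)
      with that False show False by (metis subfield_diff[OF L] subfield_divide[OF L])
    qed
    with that(1) show ?thesis by simp
  qed
  define \<psi> where "\<psi> = (\<lambda>s. THE t. \<exists>u v. u \<in> L \<and> v \<in> L \<and> s = u + v * x \<and> t = \<phi> u + \<phi> v * y)"
  have \<psi>: "\<psi> (u + v * x) = \<phi> u + \<phi> v * y" if "u \<in> L" "v \<in> L" for u v
    unfolding \<psi>_def by (rule the_equality) (use that uniq in blast)+
  have "hom_on (adjoin L {x}) \<psi>"
    unfolding hom_on_def adjoin_sqrt[OF L x]
  proof (intro conjI ballI)
    show "\<psi> 1 = 1" using \<psi>[of 1 0] subfield_0[OF L] subfield_1[OF L] by (simp add: hom_on_0[OF L h] hom_on_1[OF h])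
    fix s t assume "s \<in> {u + v * x |u v. u \<in> L \<and> v \<in> L}" "t \<in> {u + v * x |u v. u \<in> L \<and> v \<in> L}"
    then obtain u v u' v' where s: "s = u + v * x" "u \<in> L" "v \<in> L"
      and t: "t = u' + v' * x" "u' \<in> L" "v' \<in> L" by blast
    have st: "s + t = (u + u') + (v + v') * x" by (simp add: s(1) t(1) algebra_simps)
    have "\<psi> (s + t) = \<phi> (u + u') + \<phi> (v + v') * y"
      unfolding st using s t by (intro \<psi>) (auto intro: subfield_add[OF L])
    also have "\<dots> = \<psi> s + \<psi> t"
      unfolding s(1) t(1) using s(2,3) t(2,3) by (simp add: \<psi> hom_on_add[OF h] algebra_simps)
    finally show "\<psi> (s + t) = \<psi> s + \<psi> t" .
    have st: "s * t = (u * u' + v * v' * x\<^sup>2) + (u * v' + v * u') * x"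
      by (simp add: s(1) t(1) power2_eq_square algebra_simps)
    have "\<psi> (s * t) = \<phi> (u * u' + v * v' * x\<^sup>2) + \<phi> (u * v' + v * u') * y"
      unfolding st using s t x by (intro \<psi> subfield_add[OF L] subfield_mult[OF L])
    also have "\<dots> = (\<phi> u * \<phi> u' + \<phi> v * \<phi> v' * y\<^sup>2) + (\<phi> u * \<phi> v' + \<phi> v * \<phi> u') * y"
      using s(2,3) t(2,3) x y by (simp add: hom_on_add[OF h] hom_on_mult[OF h] subfield_mult[OF L])
    also have "\<dots> = \<psi> s * \<psi> t"
      unfolding s(1) t(1) using s(2,3) t(2,3) by (simp add: \<psi> power2_eq_square algebra_simps)
    finally show "\<psi> (s * t) = \<psi> s * \<psi> t" .
  qed
  moreover have "\<psi> z = \<phi> z" if "z \<in> L" for z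
    using \<psi>[OF that subfield_0[OF L]] hom_on_0[OF L h] by simp
  ultimately show ?thesis by blast
qed

section \<open>Square roots in cyclotomic fields\<close>

lemma cyclotomic_root_mem: "cis (2 * pi / real n) \<in> cyclotomic n"
  unfolding cyclotomic_def using adjoin_gens by blast

lemma subfield_cyclotomic: "subfield (cyclotomic n) CC"
  unfolding cyclotomic_def by (rule subfield_adjoin)

lemma cis_root_power: assumes "m > 0" "n > 0"
  shows "cis (2 * pi / real (m * n)) ^ m = cis (2 * pi / real n)"
  unfolding DeMoivre using assms by simp

lemma cyclotomic_mono: assumes "m > 0" "n > 0" shows "cyclotomic n \<subseteq> cyclotomic (m * n)"
  unfolding cyclotomic_def[of n]
  using subfield_power[OF subfield_cyclotomic cyclotomic_root_mem, of "m * n" m] cis_root_power[OF assms]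
  by (intro adjoin_least subfield_cyclotomic Rats_subset_subfield) auto

text \<open>Evaluate \<open>1 + X + \<dots> + X\<^sup>n\<^sup>-\<^sup>1 = \<Prod>(X - z\<^sup>k)\<close> at 1.\<close>

lemma prod_one_minus_roots_of_unity:
  assumes n: "n > 0" and prim: "\<And>j. z ^ j = (1::complex) \<longleftrightarrow> n dvd j"
  shows "(\<Prod>k\<in>{1..<n}. 1 - z ^ k) = of_nat n"
proof -
  have inj: "inj_on (\<lambda>k. z ^ k) {1..<n}" by (rule primitive_powers_inj[OF n prim]) auto
  have "(\<Prod>k\<in>{1..<n}. [:- (z ^ k), 1:]) = (\<Sum>j<n. monom 1 j)" (is "?P = ?Q")
  proof (rule poly_eqI_degree_lead_coeff[where n = "n - 1" and A = "(\<lambda>k. z ^ k) ` {1..<n}"])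
    have degP: "degree ?P = n - 1" by (subst degree_prod_sum_eq) auto
    then show "degree ?P \<le> n - 1" by simp
    show "degree ?Q \<le> n - 1" by (rule degree_sum_le) (auto intro: order_trans[OF degree_monom_le])
    have "coeff ?P (n - 1) = lead_coeff ?P" using degP by simp
    also have "\<dots> = 1" by (simp add: lead_coeff_prod)
    finally show "coeff ?P (n - 1) = coeff ?Q (n - 1)"
      using n by (simp add: coeff_sum)
    show "n - 1 \<le> card ((\<lambda>k. z ^ k) ` {1..<n})" using card_image[OF inj] by simp
    fix w assume "w \<in> (\<lambda>k. z ^ k) ` {1..<n}"
    then obtain k where k: "k \<in> {1..<n}" "w = z ^ k" by blast
    have "poly ?P w = 0" using k by (auto simp: poly_prod intro!: bexI[of _ k])
    moreover have "w \<noteq> 1" using prim[of k] k by (auto dest: dvd_imp_le)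
    moreover have "w ^ n = 1" using prim[of "k * n"] k by (simp add: power_mult)
    ultimately show "poly ?P w = poly ?Q w"
      by (simp add: poly_sum poly_monom geometric_sum)
  qed
  from arg_cong[OF this, of "\<lambda>p. poly p 1"] show ?thesis
    by (simp add: poly_prod poly_sum poly_monom)
qed

text \<open>A product with the square of the quadratic Gauss sum. With \<open>w\<^sup>2 = \<zeta>\<close> one
  has \<open>(w\<^sup>k - w\<^sup>-\<^sup>k)\<^sup>2 = - (1 - \<zeta>\<^sup>k) (1 -
  \<zeta>\<^sup>n\<^sup>-\<^sup>k)\<close>, so the product of \<open>w\<^sup>k -
  w\<^sup>-\<^sup>k\<close> over \<open>1 \<le> k \<le> (n - 1)/2\<close> has square
  \<open>n\<close>; the number of factors is even, which disposes of the signs. As \<open>n\<close>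
  is odd, \<open>w\<close> is itself a power of \<open>\<zeta>\<close>.\<close>

theorem sqrt_in_cyclotomic:
  assumes n: "n mod 4 = 1" shows "complex_of_real (sqrt (real n)) \<in> cyclotomic n"
proof -
  define t where "t = n div 4"
  have nt: "n = 4 * t + 1" using n unfolding t_def by presburger
  define z where "z = cis (2 * pi / real n)"
  have n0: "n > 0" using nt by simp
  have prim: "z ^ j = 1 \<longleftrightarrow> n dvd j" for j unfolding z_def by (rule cis_root_of_unity_iff[OF n0])
  have z0: "z \<noteq> 0" by (simp add: z_def)
  \<comment> \<open>The exponent is \<open>(n + 1) div 2\<close>.\<close>
  define w where "w = z ^ (2 * t + 1)"
  have w2: "w\<^sup>2 = z"
  proof -
    have "(2 * t + 1) * 2 = n + 1" using nt by simp
    then have "w\<^sup>2 = z ^ (n + 1)" by (simp only: w_def flip: power_mult)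
    also have "\<dots> = z" using prim[of n] by simp
    finally show ?thesis .
  qed
  have w0: "w \<noteq> 0" using z0 by (simp add: w_def)
  define y where "y = (\<Prod>k\<in>{1..2*t}. w ^ k - inverse (w ^ k))"
  have "y\<^sup>2 = (\<Prod>k\<in>{1..2*t}. (w ^ k - inverse (w ^ k))\<^sup>2)" by (simp add: y_def prod_power_distrib)
  also have "\<dots> = (\<Prod>k\<in>{1..2*t}. - 1 * ((1 - z ^ k) * (1 - z ^ (n - k))))"
  proof (rule prod.cong)
    fix k assume k: "k \<in> {1..2*t}"
    have "z ^ k * z ^ (n - k) = 1" using k nt prim[of n] by (simp flip: power_add)
    then have inv: "z ^ (n - k) = inverse (z ^ k)" by (metis inverse_unique)
    have "(w ^ k)\<^sup>2 = z ^ k" using w2 by (metis mult.commute power_mult)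
    then show "(w ^ k - inverse (w ^ k))\<^sup>2 = - 1 * ((1 - z ^ k) * (1 - z ^ (n - k)))"
      unfolding inv using w0 z0 by (simp add: field_simps power2_eq_square)
  qed simp
  also have "\<dots> = (\<Prod>k\<in>{1..2*t}. 1 - z ^ k) * (\<Prod>k\<in>{1..2*t}. 1 - z ^ (n - k))"
    unfolding prod.distrib by simp
  also have "(\<Prod>k\<in>{1..2*t}. 1 - z ^ (n - k)) = (\<Prod>k\<in>{2*t+1..<n}. 1 - z ^ k)"
    by (rule prod.reindex_bij_witness[of _ "\<lambda>k. n - k" "\<lambda>k. n - k"]) (auto simp: nt)
  also have "(\<Prod>k\<in>{1..2*t}. 1 - z ^ k) * \<dots> = (\<Prod>k\<in>{1..2*t} \<union> {2*t+1..<n}. 1 - z ^ k)"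
    by (rule prod.union_disjoint[symmetric]) auto
  also have "{1..2*t} \<union> {2*t+1..<n} = {1..<n}" using nt by auto
  finally have "y\<^sup>2 = of_nat n" using prod_one_minus_roots_of_unity[OF n0 prim] by simp
  also have "\<dots> = (complex_of_real (sqrt (real n)))\<^sup>2"
    by (simp flip: of_real_power)
  finally have "complex_of_real (sqrt (real n)) = y \<or> complex_of_real (sqrt (real n)) = - y"
    using power2_eq_iff by metis
  moreover have "y \<in> cyclotomic n"
    unfolding y_def w_def z_def by (intro subfield_intros subfield_cyclotomic cyclotomic_root_mem)
  ultimately show ?thesis using subfield_minus[OF subfield_cyclotomic] by auto
qed

lemma cis_pi_quarter:
  "cis (pi / 4) ^ 2 = \<i>" "complex_of_real (sqrt 2) = cis (pi / 4) + inverse (cis (pi / 4))"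
  "cis (pi / 4) = cis (2 * pi / 16) ^ 2"
proof -
  show "cis (pi / 4) ^ 2 = \<i>" unfolding DeMoivre by (simp add: complex_eq_iff)
  show "complex_of_real (sqrt 2) = cis (pi / 4) + inverse (cis (pi / 4))"
    by (simp add: complex_eq_iff cos_45 sin_45)
  show "cis (pi / 4) = cis (2 * pi / 16) ^ 2" unfolding DeMoivre by simp
qed

lemma i_sqrt2_in_cyclotomic_16: "\<i> \<in> cyclotomic 16" "complex_of_real (sqrt 2) \<in> cyclotomic 16"
proof -
  have "cis (pi / 4) \<in> cyclotomic 16"
    unfolding cis_pi_quarter(3) using cyclotomic_root_mem[of 16] subfield_power[OF subfield_cyclotomic] by simp
  then show "\<i> \<in> cyclotomic 16" "complex_of_real (sqrt 2) \<in> cyclotomic 16"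
    unfolding cis_pi_quarter(2) cis_pi_quarter(1)[symmetric]
    by (intro subfield_intros subfield_cyclotomic; simp)+
qed

lemma prime_sqrt_not_Rat:
  assumes p: "Factorial_Ring.prime (p::nat)" shows "complex_of_real (sqrt (real p)) \<notin> \<rat>"
proof
  assume "complex_of_real (sqrt (real p)) \<in> \<rat>"
  then obtain a b :: int where ab: "complex_of_real (sqrt (real p)) = of_int a / of_int b" "b > 0" "coprime a b"
    by (rule Rats_cases')
  then have "(complex_of_real (sqrt (real p)))\<^sup>2 * of_int (b\<^sup>2) = of_int (a\<^sup>2)"
    using ab(2) unfolding ab(1) by (simp add: power_divide)
  then have "of_int (int p * b\<^sup>2) = (of_int (a\<^sup>2) :: complex)" by (simp flip: of_real_power)
  then have eq: "int p * b\<^sup>2 = a\<^sup>2" by (simp only: of_int_eq_iff)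
  have pp: "Factorial_Ring.prime (int p)" using p by simp
  have "int p dvd a\<^sup>2" using eq by (metis dvd_triv_left)
  then have "int p dvd a" using pp prime_dvd_power by blast
  then obtain c where c: "a = int p * c" by blast
  with eq p have "b\<^sup>2 = int p * c\<^sup>2" by (simp add: power2_eq_square prime_gt_0_nat)
  then have "int p dvd b\<^sup>2" by simp
  then have "int p dvd b" using pp prime_dvd_power by blast
  with c ab(3) pp show False by (metis coprime_common_divisor dvd_triv_left not_prime_unit)
qed

section \<open>Groups whose commutator form is the exterior square of a cube\<close>

type_synonym bits = "bool \<times> bool \<times> bool"

definition xor3 :: "bits \<Rightarrow> bits \<Rightarrow> bits" where
  "xor3 = (\<lambda>(x1, x2, x3) (y1, y2, y3). (x1 \<noteq> y1, x2 \<noteq> y2, x3 \<noteq> y3))"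

text \<open>The three \<open>2 \<times> 2\<close> minors over the field with two elements.\<close>

definition wedge :: "bits \<Rightarrow> bits \<Rightarrow> bits" where
  "wedge = (\<lambda>(x1, x2, x3) (y1, y2, y3).
     ((x1 \<and> y2) \<noteq> (x2 \<and> y1), (x1 \<and> y3) \<noteq> (x3 \<and> y1), (x2 \<and> y3) \<noteq> (x3 \<and> y2)))"

abbreviation zero3 :: bits where "zero3 \<equiv> (False, False, False)"

lemma wedge_eq_zero_iff: "wedge x y = zero3 \<longleftrightarrow> x = zero3 \<or> y = zero3 \<or> x = y"
  by (cases x; cases y) (auto simp: wedge_def)

text \<open>In dimension three every element of the exterior square is decomposable.\<close>

lemma wedge_surj: "\<exists>x y. wedge x y = m"
proof -
  obtain p q r where m: "m = (p, q, r)" by (cases m)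
  have "wedge (True, False, r) (False, True, q) = m" if p
    using that by (simp add: m wedge_def)
  moreover have "wedge (q, r, False) (False, False, True) = m" if "\<not> p"
    using that by (simp add: m wedge_def)
  ultimately show ?thesis by blast
qed

lemma card_bits: "card (UNIV :: bits set) = 8"
proof -
  have "card ((UNIV :: bool set) \<times> (UNIV :: bool set) \<times> (UNIV :: bool set)) = 8"
    unfolding card_cartesian_product card_UNIV_bool by simp
  then show ?thesis by simp
qed

lemma sum_card_1_or_4:
  fixes S :: "'a set set"
  assumes fin: "finite S" and card: "\<And>C. C \<in> S \<Longrightarrow> card C = 1 \<or> card C = 4"
  shows "(\<Sum>C\<in>S. card C) = card {C \<in> S. card C = 1} + 4 * card {C \<in> S. card C = 4}"
proof -
  have "(\<Sum>C\<in>S. card C) = (\<Sum>C\<in>S. (if card C = 1 then 1 else 0) + 4 * (if card C = 4 then 1 else 0))"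
  proof (rule sum.cong)
    fix C assume "C \<in> S"
    from card[OF this] show "card C = (if card C = 1 then 1 else 0) + 4 * (if card C = 4 then 1 else 0)"
      by (elim disjE) simp_all
  qed simp
  then show ?thesis
    using fin by (simp add: sum.distrib sum_distrib_left[symmetric] sum.If_cases Int_def)
qed

text \<open>The map \<open>b\<close> is a homomorphism onto \<open>(\<int>/2)\<^sup>3\<close>. The injection
  \<open>s\<close> names the elements of a subgroup \<open>U\<close> that contains all commutators.\<close>

locale wedge_group = group G for G (structure) +
  fixes b :: "'a \<Rightarrow> bits" and U :: "'a set" and s :: "'a \<Rightarrow> bits"
  assumes fin: "finite (carrier G)"
    and b_mult: "x \<in> carrier G \<Longrightarrow> y \<in> carrier G \<Longrightarrow> b (x \<otimes> y) = xor3 (b x) (b y)"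
    and b_surj: "\<exists>x\<in>carrier G. b x = v"
    and U: "subgroup U G" and s_inj: "inj_on s U"
    and comm_U: "x \<in> carrier G \<Longrightarrow> y \<in> carrier G \<Longrightarrow> x \<otimes> y \<otimes> inv x \<otimes> inv y \<in> U"
    and comm_s: "x \<in> carrier G \<Longrightarrow> y \<in> carrier G \<Longrightarrow> s (x \<otimes> y \<otimes> inv x \<otimes> inv y) = wedge (b x) (b y)"
begin

definition Z where "Z = {x \<in> carrier G. b x = zero3}"

lemma commute_iff:
  assumes "x \<in> carrier G" "y \<in> carrier G"
  shows "x \<otimes> y = y \<otimes> x \<longleftrightarrow> b x = zero3 \<or> b y = zero3 \<or> b x = b y"
proof -
  have "x \<otimes> y = y \<otimes> x \<longleftrightarrow> x \<otimes> y \<otimes> inv x \<otimes> inv y = \<one>"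
  proof -
    have "x \<otimes> y \<otimes> inv x \<otimes> inv y = (x \<otimes> y) \<otimes> inv (y \<otimes> x)"
      using assms by (simp add: inv_mult_group m_assoc)
    then show ?thesis using assms by (metis inv_solve_right' l_one m_closed one_closed inv_closed r_inv)
  qed
  also have "\<dots> \<longleftrightarrow> s (x \<otimes> y \<otimes> inv x \<otimes> inv y) = s \<one>"
    using inj_on_eq_iff[OF s_inj comm_U[OF assms] subgroup.one_closed[OF U]] by simp
  also have "s \<one> = zero3"
    using comm_s[of \<one> \<one>] wedge_eq_zero_iff by simp
  finally show ?thesis using comm_s[OF assms] wedge_eq_zero_iff by simp
qed

lemma center_eq: "group_center G = Z"
proof -
  have "b x = zero3" if x: "x \<in> carrier G" and c: "\<forall>y\<in>carrier G. x \<otimes> y = y \<otimes> x" for x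
  proof (rule ccontr)
    assume nz: "b x \<noteq> zero3"
    define v where "v = (if b x = (True, False, False) then (False, True, False) else (True, False, False))"
    have "v \<noteq> zero3" "v \<noteq> b x" by (auto simp: v_def)
    moreover obtain y where "y \<in> carrier G" "b y = v" using b_surj by blast
    ultimately show False using commute_iff[OF x, of y] c nz by auto
  qed
  then have "group_center G \<subseteq> Z" by (auto simp: group_center_def Z_def)
  moreover have "x \<in> group_center G" if "x \<in> Z" for x
    using that commute_iff[of x] by (auto simp: group_center_def Z_def)
  ultimately show ?thesis by blast
qed

lemma card_fibre: "card {x \<in> carrier G. b x = v} = card Z"
proof -
  obtain g where g: "g \<in> carrier G" "b g = v" using b_surj by blast
  have b1: "xor3 v x = v \<longleftrightarrow> x = zero3" for x by (cases x; cases v) (auto simp: xor3_def)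
  have "(\<lambda>x. g \<otimes> x) ` Z = {x \<in> carrier G. b x = v}"
  proof (intro equalityI subsetI)
    fix x assume x: "x \<in> {x \<in> carrier G. b x = v}"
    have eq: "x = g \<otimes> (inv g \<otimes> x)" using x g by (simp add: m_assoc[symmetric])
    then have "xor3 v (b (inv g \<otimes> x)) = v" using b_mult[of g "inv g \<otimes> x"] x g by simp
    then have "inv g \<otimes> x \<in> Z" using x g b1 by (simp add: Z_def)
    with eq show "x \<in> (\<lambda>x. g \<otimes> x) ` Z" by blast
  next
    fix y assume "y \<in> (\<lambda>x. g \<otimes> x) ` Z"
    then obtain x where x: "x \<in> carrier G" "b x = zero3" "y = g \<otimes> x" by (auto simp: Z_def)
    then have "b y = v" using b_mult[OF g(1) x(1)] g(2) b1[of zero3] by simp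
    with x g show "y \<in> {x \<in> carrier G. b x = v}" by simp
  qed
  moreover have "inj_on (\<lambda>x. g \<otimes> x) Z" using g by (auto simp: inj_on_def Z_def)
  ultimately show ?thesis by (metis card_image)
qed

lemma card_carrier: "card (carrier G) = 8 * card Z"
proof -
  have "card (carrier G) = (\<Sum>v\<in>b ` carrier G. card {x \<in> carrier G. b x = v})"
    using sum.image_gen[OF fin, of "\<lambda>_. 1::nat" b] by simp
  also have "b ` carrier G = UNIV" using b_surj by (auto simp: image_iff) metis
  finally show ?thesis by (simp add: card_fibre card_bits)
qed

abbreviation conj_action where "conj_action \<equiv> (\<lambda>g. \<lambda>h\<in>carrier G. g \<otimes> h \<otimes> inv g)"

text \<open>The centralizer of \<open>h\<close> outside \<open>Z\<close> is the preimage of \<open>{0, b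
  h}\<close>, two of the eight fibres of \<open>b\<close>.\<close>

lemma card_orbit:
  assumes h: "h \<in> carrier G"
  shows "card (orbit G conj_action h) = (if h \<in> Z then 1 else 4)"
proof -
  interpret A: group_action G "carrier G" conj_action by (rule action_by_conjugation)
  have st: "stabilizer G conj_action h = {g \<in> carrier G. b g = zero3 \<or> b h = zero3 \<or> b g = b h}"
  proof -
    have "g \<otimes> h \<otimes> inv g = h \<longleftrightarrow> g \<otimes> h = h \<otimes> g" if "g \<in> carrier G" for g
      using that h by (metis inv_solve_right' m_closed)
    then show ?thesis using h commute_iff by (auto simp: stabilizer_def)
  qed
  have os: "card (orbit G conj_action h) * card (stabilizer G conj_action h) = 8 * card Z"
    using A.orbit_stabilizer_theorem[OF h] card_carrier by (simp add: Coset.order_def)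
  have Z0: "card Z > 0"
    using b_surj[of zero3] fin by (auto simp: card_gt_0_iff Z_def)
  show ?thesis
  proof (cases "h \<in> Z")
    case True
    then have "stabilizer G conj_action h = carrier G" using st by (auto simp: Z_def)
    with os Z0 True card_carrier show ?thesis by simp
  next
    case False
    then have nz: "b h \<noteq> zero3" using h by (simp add: Z_def)
    have "stabilizer G conj_action h = Z \<union> {g \<in> carrier G. b g = b h}"
      using st nz by (auto simp: Z_def)
    moreover have "card (Z \<union> {g \<in> carrier G. b g = b h}) = card Z + card Z"
    proof -
      have "finite Z" "finite {g \<in> carrier G. b g = b h}" "Z \<inter> {g \<in> carrier G. b g = b h} = {}"
        using fin nz by (auto simp: Z_def)
      then show ?thesis by (simp add: card_Un_disjoint card_fibre)
    qed
    ultimately have "card (orbit G conj_action h) * (card Z + card Z) = 8 * card Z"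
      using os by simp
    then have "(2 * card (orbit G conj_action h)) * card Z = 8 * card Z"
      by (simp only: distrib_left distrib_right mult_2)
    then have "2 * card (orbit G conj_action h) = 8" using Z0 by (simp only: mult_cancel2) simp
    with False show ?thesis by simp
  qed
qed

lemma conj_classes_card: assumes "C \<in> conj_classes G" shows "card C = 1 \<or> card C = 4"
proof -
  obtain h where h: "h \<in> carrier G" "C = orbit G conj_action h"
    using assms by (auto simp: conj_classes_def orbits_def)
  show ?thesis unfolding h(2) card_orbit[OF h(1)] by simp
qed

lemma
  shows card_classes_1: "card {C \<in> conj_classes G. card C = 1} = card Z"
    and card_classes_4: "4 * card {C \<in> conj_classes G. card C = 4} = 7 * card Z"
proof -
  interpret A: group_action G "carrier G" conj_action by (rule action_by_conjugation)
  have Zsub: "Z \<subseteq> carrier G" by (auto simp: Z_def)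
  have single: "orbit G conj_action z = {z}" if "z \<in> Z" for z
  proof -
    have "z \<in> carrier G" using that Zsub by blast
    then have "card (orbit G conj_action z) = 1" "z \<in> orbit G conj_action z"
      using card_orbit[of z] that A.orbit_refl[of z] by simp_all
    moreover from this(1) obtain w where "orbit G conj_action z = {w}" by (rule card_1_singletonE)
    ultimately show ?thesis by simp
  qed
  have "{C \<in> conj_classes G. card C = 1} = (\<lambda>z. {z}) ` Z"
  proof (intro equalityI subsetI)
    fix C assume C: "C \<in> {C \<in> conj_classes G. card C = 1}"
    then obtain h where h: "h \<in> carrier G" "C = orbit G conj_action h"
      by (auto simp: conj_classes_def orbits_def)
    from C have "card C = 1" by simp
    then have "h \<in> Z" using card_orbit[OF h(1)] unfolding h(2) by (cases "h \<in> Z") simp_all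
    then show "C \<in> (\<lambda>z. {z}) ` Z" unfolding h(2) single[OF \<open>h \<in> Z\<close>] by (rule imageI)
  next
    fix C assume "C \<in> (\<lambda>z. {z}) ` Z"
    then obtain z where z: "z \<in> Z" "C = {z}" by blast
    then have "C = orbit G conj_action z" using single by simp
    with z Zsub show "C \<in> {C \<in> conj_classes G. card C = 1}"
      by (auto simp: conj_classes_def orbits_def)
  qed
  then show c1: "card {C \<in> conj_classes G. card C = 1} = card Z"
    by (simp add: card_image)
  have fincl: "finite (conj_classes G)"
    using fin by (auto simp: conj_classes_def orbits_def setcompr_eq_image)
  have "(\<Sum>C\<in>conj_classes G. card C) = card (carrier G)"
    using A.disjoint_sum[OF fin, of "\<lambda>_. 1::nat"] by (simp add: conj_classes_def)
  moreover note sum_card_1_or_4[OF fincl conj_classes_card]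
  ultimately show "4 * card {C \<in> conj_classes G. card C = 4} = 7 * card Z"
    unfolding c1 card_carrier by linarith
qed

lemma U_eq_commutators: "U = derived_set G (carrier G)"
  and s_surj: "s ` U = UNIV"
proof -
  have sub: "derived_set G (carrier G) \<subseteq> U" using comm_U by auto
  have surj: "s ` derived_set G (carrier G) = UNIV"
  proof -
    have "m \<in> s ` derived_set G (carrier G)" for m
    proof -
      obtain v w where "wedge v w = m" using wedge_surj by blast
      moreover obtain x y where "x \<in> carrier G" "b x = v" "y \<in> carrier G" "b y = w" using b_surj by metis
      ultimately have "m = s (x \<otimes> y \<otimes> inv x \<otimes> inv y)" using comm_s by simp
      moreover have "x \<otimes> y \<otimes> inv x \<otimes> inv y \<in> derived_set G (carrier G)"
        using \<open>x \<in> carrier G\<close> \<open>y \<in> carrier G\<close> by blast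
      ultimately show ?thesis by blast
    qed
    then show ?thesis by blast
  qed
  have "U \<subseteq> derived_set G (carrier G)"
  proof
    fix u assume u: "u \<in> U"
    have "s u \<in> s ` derived_set G (carrier G)" unfolding surj by simp
    then obtain d where d: "s u = s d" "d \<in> derived_set G (carrier G)" by (rule imageE)
    have "u = d" by (rule inj_onD[OF s_inj d(1) u]) (use d(2) sub in blast)
    with d(2) show "u \<in> derived_set G (carrier G)" by simp
  qed
  then show eq: "U = derived_set G (carrier G)" using sub by blast
  show "s ` U = UNIV" unfolding eq by (rule surj)
qed

lemma card_U: "card U = 8"
  using card_image[OF s_inj] card_bits by (simp add: s_surj)

lemma card_derived: "card (derived G (carrier G)) = 8"
proof -
  have "derived G (carrier G) = U"
  proof
    show "derived G (carrier G) \<subseteq> U"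
      unfolding derived_def U_eq_commutators[symmetric] by (rule generate_subgroup_incl[OF _ U]) simp
    show "U \<subseteq> derived G (carrier G)"
      unfolding derived_def U_eq_commutators[symmetric] by (auto intro: generate.incl)
  qed
  with card_U show ?thesis by simp
qed

end

section \<open>Automorphisms and the six square roots\<close>

lemma subgroup_Gal:
  assumes L: "subfield L CC" and C: "K \<subseteq> C" "C \<subseteq> L"
  shows "subgroup (carrier (Gal L C)) (Gal L K)"
proof -
  have KL: "K \<subseteq> L" using C by blast
  interpret G: group "Gal L K" by (rule group_Gal[OF L KL])
  interpret GC: group "Gal L C" by (rule group_Gal[OF L C(2)])
  have sub: "carrier (Gal L C) \<subseteq> carrier (Gal L K)" by (rule Gal_mono[OF C(1)])
  show ?thesis
  proof (rule G.subgroupI[OF sub])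
    show "carrier (Gal L C) \<noteq> {}" using GC.one_closed by blast
    fix \<sigma> assume s: "\<sigma> \<in> carrier (Gal L C)"
    then have sG: "\<sigma> \<in> carrier (Gal L K)" using sub by blast
    show "inv\<^bsub>Gal L K\<^esub> \<sigma> \<in> carrier (Gal L C)"
    proof (rule Gal_subI[OF G.inv_closed[OF sG]])
      fix x assume x: "x \<in> C"
      then have xL: "x \<in> L" using C by blast
      have "(inv\<^bsub>Gal L K\<^esub> \<sigma>) (\<sigma> x) = x"
        using Gal_mult[OF G.inv_closed[OF sG] sG xL] sG xL by (simp add: Gal_one)
      with Gal_fix[OF s x] show "(inv\<^bsub>Gal L K\<^esub> \<sigma>) x = x" by simp
    qed
    fix \<tau> assume t: "\<tau> \<in> carrier (Gal L C)"
    then have tG: "\<tau> \<in> carrier (Gal L K)" using sub by blast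
    show "\<sigma> \<otimes>\<^bsub>Gal L K\<^esub> \<tau> \<in> carrier (Gal L C)"
      using C Gal_fix[OF s] Gal_fix[OF t] by (intro Gal_subI[OF G.m_closed[OF sG tG]]) (auto simp: Gal_mult[OF sG tG] subset_iff)
  qed
qed

text \<open>A root \<open>r\<close> that \<open>\<sigma>\<close> multiplies by \<open>\<plusminus>w\<close>
  when \<open>u\<close> holds, where the number \<open>w\<close> itself changes sign when
  \<open>v\<close> holds. Applying \<open>\<sigma>\<close> after \<open>\<tau>\<close> moves
  \<open>\<sigma>\<close> past the factor \<open>w\<close> introduced by \<open>\<tau>\<close>,
  which costs a sign if \<open>u'\<close> and \<open>v\<close> hold; comparing both orders gives the
  minor \<open>v u' - u v'\<close>.\<close>

lemma twist_mult:
  assumes L: "subfield L CC" and h: "hom_on L \<sigma>" "hom_on L \<tau>" and r: "r \<in> L" "w \<in> L"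
    and w: "\<sigma> w = (if v then - w else w)" "\<tau> w = (if v' then - w else w)"
    and \<sigma>r: "\<sigma> r = (if u then w * r else r) \<or> \<sigma> r = - (if u then w * r else r)"
    and \<tau>r: "\<tau> r = (if u' then w * r else r) \<or> \<tau> r = - (if u' then w * r else r)"
  shows "\<sigma> (\<tau> r) = (if (v \<and> u') \<noteq> (u \<and> v') then - \<tau> (\<sigma> r) else \<tau> (\<sigma> r))"
proof -
  note hs = hom_on_mult[OF h(1)] hom_on_mult[OF h(2)] hom_on_minus[OF L h(1)] hom_on_minus[OF L h(2)]
    subfield_mult[OF L]
  have wr: "\<sigma> (w * r) = \<sigma> w * \<sigma> r" "\<tau> (w * r) = \<tau> w * \<tau> r" using r by (simp_all add: hs)
  show ?thesis
    using \<sigma>r \<tau>r by (elim disjE; cases u; cases u'; simp add: hs r wr; simp add: w)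
qed

text \<open>The same sign computation for a root that is sent to \<open>\<plusminus>w/r\<close> instead.\<close>

lemma twist_divide:
  assumes L: "subfield L CC" and h: "hom_on L \<sigma>" "hom_on L \<tau>" and r: "r \<in> L" "w \<in> L" "r \<noteq> 0" "w \<noteq> 0"
    and w: "\<sigma> w = (if v then - w else w)" "\<tau> w = (if v' then - w else w)"
    and \<sigma>r: "\<sigma> r = (if u then w / r else r) \<or> \<sigma> r = - (if u then w / r else r)"
    and \<tau>r: "\<tau> r = (if u' then w / r else r) \<or> \<tau> r = - (if u' then w / r else r)"
  shows "\<sigma> (\<tau> r) = (if (v \<and> u') \<noteq> (u \<and> v') then - \<tau> (\<sigma> r) else \<tau> (\<sigma> r))"
proof -
  note hs = hom_on_divide[OF L h(1)] hom_on_divide[OF L h(2)] hom_on_minus[OF L h(1)] hom_on_minus[OF L h(2)]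
    subfield_divide[OF L]
  have wr: "\<sigma> (w / r) = \<sigma> w / \<sigma> r" "\<tau> (w / r) = \<tau> w / \<tau> r" using r by (simp_all add: hs)
  show ?thesis
    using \<sigma>r \<tau>r r(3,4) by (elim disjE; cases u; cases u'; simp add: hs r wr; simp add: w)
qed

lemma hom_on_root_of_unity:
  assumes L: "subfield L CC" and h: "hom_on L \<sigma>" and n: "n > 0" and z: "cis (2 * pi / real n) \<in> L"
  shows "\<exists>k. \<sigma> (cis (2 * pi / real n)) = cis (2 * pi / real n) ^ k"
proof -
  have "\<sigma> (cis (2 * pi / real n)) ^ n = \<sigma> (cis (2 * pi / real n) ^ n)"
    using hom_on_power[OF L h z] by simp
  also have "\<dots> = 1" using cis_root_of_unity_iff[OF n, of n] hom_on_1[OF h] by simp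
  finally have "\<sigma> (cis (2 * pi / real n)) \<in> {z. z ^ n = 1}" by simp
  then obtain k where "\<sigma> (cis (2 * pi / real n)) = cis (2 * pi * real k / real n)"
    using bij_betw_roots_unity[OF n] by (auto simp: bij_betw_def)
  then show ?thesis by (intro exI[of _ k]) (simp add: DeMoivre mult_ac)
qed

lemma signed_mem:
  fixes x :: complex
  shows "x = (if c then w else r) \<or> x = - (if c then w else r) \<Longrightarrow> subfield V CC \<Longrightarrow> w \<in> V \<Longrightarrow> r \<in> V \<Longrightarrow> x \<in> V"
  using subfield_minus[of V] by (cases c) auto

lemma signed_eq:
  fixes x :: complex
  shows "x = (if c then w else r) \<or> x = - (if c then w else r) \<Longrightarrow>
    y = (if d then w else r) \<or> y = - (if d then w else r) \<Longrightarrow>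
    \<not> c \<Longrightarrow> \<not> d \<Longrightarrow> (x \<noteq> r) = (y \<noteq> r) \<Longrightarrow> x = y"
  by auto

locale quadratic_form_prime =
  fixes p :: nat and a b :: int
  assumes p: "Factorial_Ring.prime p" "p mod 8 = 1"
    and ab: "a > 0" "b > 0" "int p = a\<^sup>2 - 2 * b\<^sup>2"
begin

abbreviation "s2 \<equiv> complex_of_real (sqrt 2)"
abbreviation "sp \<equiv> complex_of_real (sqrt (real p))"
abbreviation "re \<equiv> complex_of_real (sqrt epsilon)"
abbreviation "rp \<equiv> complex_of_real (root 4 (real p))"
abbreviation "ra \<equiv> complex_of_real (sqrt (alpha a b))"

abbreviation "F \<equiv> F_field p"
abbreviation "N \<equiv> N_field p a b"
abbreviation "B \<equiv> B_field p"
abbreviation "K \<equiv> BN_field p a b"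

lemma p0: "p > 0" using p(1) by (rule prime_gt_0_nat)

lemma squares:
  "s2\<^sup>2 = 2" "sp\<^sup>2 = of_nat p" "re\<^sup>2 = 1 + s2" "rp\<^sup>2 = sp" "ra\<^sup>2 = of_int a + of_int b * s2"
  "(of_int a + of_int b * s2) * (of_int a - of_int b * s2) = of_nat p"
proof -
  show s2: "s2\<^sup>2 = 2" by (simp flip: of_real_power)
  show "sp\<^sup>2 = of_nat p" by (simp flip: of_real_power)
  have "epsilon > 0" by (simp add: epsilon_def add_pos_pos)
  then have "(sqrt epsilon)\<^sup>2 = epsilon" by simp
  then show "re\<^sup>2 = 1 + s2" by (simp add: epsilon_def flip: of_real_power)
  have "root 4 (real p) = sqrt (sqrt (real p))"
    unfolding sqrt_def using real_root_mult_exp[of 2 2 "real p"] by simp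
  then have "(root 4 (real p))\<^sup>2 = sqrt (real p)" by simp
  then show "rp\<^sup>2 = sp" by (simp flip: of_real_power)
  have "alpha a b > 0" using ab by (simp add: alpha_def add_pos_pos)
  then have "(sqrt (alpha a b))\<^sup>2 = alpha a b" by simp
  then show "ra\<^sup>2 = of_int a + of_int b * s2" by (simp add: alpha_def flip: of_real_power)
  have "(of_int a + of_int b * s2) * (of_int a - of_int b * s2) = (of_int a)\<^sup>2 - of_int b ^ 2 * s2\<^sup>2"
    by (simp add: algebra_simps power2_eq_square)
  also have "\<dots> = of_int (a\<^sup>2 - 2 * b\<^sup>2)" unfolding s2 by simp
  finally show "(of_int a + of_int b * s2) * (of_int a - of_int b * s2) = of_nat p"
    unfolding ab(3)[symmetric] by simp
qed

lemma nonzero: "s2 \<noteq> 0" "sp \<noteq> 0" "re \<noteq> 0" "rp \<noteq> 0" "ra \<noteq> 0"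
proof -
  show "s2 \<noteq> 0" "sp \<noteq> 0" using p0 by simp_all
  then show "rp \<noteq> 0" using squares(4) by auto
  have "(1 + s2) * (1 - s2) = - 1" using squares(1) by (simp add: algebra_simps power2_eq_square)
  then show "re \<noteq> 0" using squares(3) by auto
  show "ra \<noteq> 0" using squares(5,6) p0 by auto
qed

definition bits :: "(complex \<Rightarrow> complex) \<Rightarrow> bits" where
  "bits \<sigma> = (\<sigma> \<i> \<noteq> \<i>, \<sigma> s2 \<noteq> s2, \<sigma> sp \<noteq> sp)"

definition signs :: "(complex \<Rightarrow> complex) \<Rightarrow> bits" where
  "signs \<sigma> = (\<sigma> re \<noteq> re, \<sigma> rp \<noteq> rp, \<sigma> ra \<noteq> ra)"

lemma subfield_F: "subfield F CC" and subfield_N: "subfield N CC" and subfield_B: "subfield B CC"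
  and subfield_K: "subfield K CC"
  by (simp_all add: F_field_def N_field_def B_field_def BN_field_def subfield_adjoin
      subfield_compositum subfield_cyclotomic)

lemma F_gens: "\<i> \<in> F" "s2 \<in> F" "sp \<in> F"
  unfolding F_field_def using adjoin_gens[of "{\<i>, s2, sp}" \<rat>] by auto

lemma N_gens: "re \<in> N" "rp \<in> N" "ra \<in> N"
  unfolding N_field_def using adjoin_gens[of "{re, rp, ra}" F] by auto

lemma F_sub_N: "F \<subseteq> N" unfolding N_field_def by (rule adjoin_base)

lemma F_least: "subfield L CC \<Longrightarrow> \<i> \<in> L \<Longrightarrow> s2 \<in> L \<Longrightarrow> sp \<in> L \<Longrightarrow> F \<subseteq> L"
  unfolding F_field_def by (rule adjoin_least) (auto simp: Rats_subset_subfield)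

lemma N_least: "subfield L CC \<Longrightarrow> F \<subseteq> L \<Longrightarrow> re \<in> L \<Longrightarrow> rp \<in> L \<Longrightarrow> ra \<in> L \<Longrightarrow> N \<subseteq> L"
  unfolding N_field_def by (rule adjoin_least) auto

lemma F_sub_B: "F \<subseteq> B"
proof (rule F_least[OF subfield_B])
  have "cyclotomic 16 \<subseteq> B" "cyclotomic p \<subseteq> B"
    unfolding B_field_def using cyclotomic_mono[of p 16] cyclotomic_mono[of 16 p] p0
    by (simp_all add: mult.commute)
  moreover have "p mod 4 = 1" using p(2) by presburger
  ultimately show "\<i> \<in> B" "s2 \<in> B" "sp \<in> B"
    using i_sqrt2_in_cyclotomic_16 sqrt_in_cyclotomic[of p] by auto
qed

lemma B_sub_K: "B \<subseteq> K" and N_sub_K: "N \<subseteq> K"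
  unfolding BN_field_def by (rule compositum_upper)+

lemma hom_signs:
  assumes L: "subfield L CC" and h: "hom_on L \<sigma>" and F: "F \<subseteq> L"
  shows "\<sigma> \<i> = (if \<sigma> \<i> \<noteq> \<i> then - \<i> else \<i>)"
    and "\<sigma> s2 = (if \<sigma> s2 \<noteq> s2 then - s2 else s2)"
    and "\<sigma> sp = (if \<sigma> sp \<noteq> sp then - sp else sp)"
proof -
  have g: "\<i> \<in> L" "s2 \<in> L" "sp \<in> L" using F F_gens by auto
  have "(\<sigma> \<i>)\<^sup>2 = \<i>\<^sup>2"
    using hom_on_power[OF L h g(1), of 2] hom_on_minus[OF L h subfield_1[OF L]] hom_on_1[OF h] by simp
  moreover have "(\<sigma> s2)\<^sup>2 = s2\<^sup>2"
    using hom_on_power[OF L h g(2), of 2] hom_on_of_nat[OF L h, of 2] squares(1) by simp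
  moreover have "(\<sigma> sp)\<^sup>2 = sp\<^sup>2"
    using hom_on_power[OF L h g(3), of 2] hom_on_of_nat[OF L h, of p] squares(2) by simp
  ultimately have "\<sigma> \<i> = \<i> \<or> \<sigma> \<i> = - \<i>" "\<sigma> s2 = s2 \<or> \<sigma> s2 = - s2" "\<sigma> sp = sp \<or> \<sigma> sp = - sp"
    by (simp_all only: power2_eq_iff)
  then show "\<sigma> \<i> = (if \<sigma> \<i> \<noteq> \<i> then - \<i> else \<i>)"
    "\<sigma> s2 = (if \<sigma> s2 \<noteq> s2 then - s2 else s2)"
    "\<sigma> sp = (if \<sigma> sp \<noteq> sp then - sp else sp)" by metis+
qed

text \<open>The square of each image is the conjugate radicand: \<open>1 - \<surd>2 = -1/(1 +
  \<surd>2)\<close>, \<open>-\<surd>p\<close>, and \<open>a - b \<surd>2 = p/(a + b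
  \<surd>2)\<close>.\<close>

lemma hom_roots:
  assumes L: "subfield L CC" and h: "hom_on L \<sigma>" and NL: "N \<subseteq> L"
  shows "\<sigma> re = (if \<sigma> s2 \<noteq> s2 then \<i> / re else re) \<or> \<sigma> re = - (if \<sigma> s2 \<noteq> s2 then \<i> / re else re)"
    and "\<sigma> rp = (if \<sigma> sp \<noteq> sp then \<i> * rp else rp) \<or> \<sigma> rp = - (if \<sigma> sp \<noteq> sp then \<i> * rp else rp)"
    and "\<sigma> ra = (if \<sigma> s2 \<noteq> s2 then sp / ra else ra) \<or> \<sigma> ra = - (if \<sigma> s2 \<noteq> s2 then sp / ra else ra)"
proof -
  have FL: "F \<subseteq> L" using F_sub_N NL by blast
  have g: "s2 \<in> L" "re \<in> L" "rp \<in> L" "ra \<in> L" using FL NL F_gens N_gens by auto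
  note hs = hom_signs[OF L h FL]
  have "(\<sigma> re)\<^sup>2 = \<sigma> (1 + s2)" using hom_on_power[OF L h g(2), of 2] squares(3) by simp
  also have "\<dots> = 1 + \<sigma> s2" using hom_on_add[OF h subfield_1[OF L] g(1)] hom_on_1[OF h] by simp
  also have "\<dots> = (if \<sigma> s2 \<noteq> s2 then \<i> / re else re)\<^sup>2"
  proof (cases "\<sigma> s2 = s2")
    case False
    then have "\<sigma> s2 = - s2" using hs(2) by simp
    moreover have "(1 - s2) * (1 + s2) = - 1" using squares(1) by (simp add: algebra_simps power2_eq_square)
    moreover have "1 + s2 \<noteq> 0" using squares(3) nonzero(3) by (metis power_eq_0_iff)
    ultimately have "(1 + \<sigma> s2) * (1 + s2) = - 1" "1 + s2 \<noteq> 0" by simp_all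
    then have "1 + \<sigma> s2 = - 1 / (1 + s2)" by (simp only: nonzero_eq_divide_eq simp_thms)
    then show ?thesis using False squares(3) by (simp add: power_divide)
  qed (simp add: squares)
  finally show "\<sigma> re = (if \<sigma> s2 \<noteq> s2 then \<i> / re else re) \<or> \<sigma> re = - (if \<sigma> s2 \<noteq> s2 then \<i> / re else re)"
    by (simp only: power2_eq_iff)
  have "(\<sigma> rp)\<^sup>2 = \<sigma> sp" using hom_on_power[OF L h g(3), of 2] squares(4) by simp
  also have "\<dots> = (if \<sigma> sp \<noteq> sp then \<i> * rp else rp)\<^sup>2"
    using hs(3) squares(4) by (auto simp: power_mult_distrib split: if_splits)
  finally show "\<sigma> rp = (if \<sigma> sp \<noteq> sp then \<i> * rp else rp) \<or> \<sigma> rp = - (if \<sigma> sp \<noteq> sp then \<i> * rp else rp)"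
    by (simp only: power2_eq_iff)
  have "(\<sigma> ra)\<^sup>2 = \<sigma> (of_int a + of_int b * s2)"
    using hom_on_power[OF L h g(4), of 2] squares(5) by simp
  also have "\<dots> = of_int a + of_int b * \<sigma> s2"
    using g(1) by (simp add: hom_on_add[OF h] hom_on_mult[OF h] hom_on_of_int[OF L h]
        subfield_of_int[OF L] subfield_mult[OF L])
  also have "\<dots> = (if \<sigma> s2 \<noteq> s2 then sp / ra else ra)\<^sup>2"
  proof (cases "\<sigma> s2 = s2")
    case False
    then have "of_int a + of_int b * \<sigma> s2 = of_int a - of_int b * s2" using hs(2) by simp
    also have "\<dots> = of_nat p / ra\<^sup>2"
    proof -
      have "ra\<^sup>2 \<noteq> 0" using nonzero(5) by simp
      moreover have "(of_int a - of_int b * s2) * ra\<^sup>2 = of_nat p"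
        unfolding squares(5) using squares(6) by (simp only: mult.commute)
      ultimately show ?thesis by (simp only: nonzero_eq_divide_eq simp_thms)
    qed
    finally show ?thesis using False squares(2) by (simp add: power_divide)
  qed (simp add: squares)
  finally show "\<sigma> ra = (if \<sigma> s2 \<noteq> s2 then sp / ra else ra) \<or> \<sigma> ra = - (if \<sigma> s2 \<noteq> s2 then sp / ra else ra)"
    by (simp only: power2_eq_iff)
qed

lemma hom_on_roots_mem:
  assumes "subfield L CC" "hom_on L \<sigma>" "N \<subseteq> L"
  shows "\<sigma> \<i> \<in> F" "\<sigma> s2 \<in> F" "\<sigma> sp \<in> F" "\<sigma> re \<in> N" "\<sigma> rp \<in> N" "\<sigma> ra \<in> N"
proof -
  have FL: "F \<subseteq> L" using F_sub_N assms(3) by blast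
  have g: "\<i> \<in> N" "sp \<in> N" using F_sub_N F_gens by auto
  show "\<sigma> \<i> \<in> F" "\<sigma> s2 \<in> F" "\<sigma> sp \<in> F"
    using hom_signs[OF assms(1,2) FL] F_gens subfield_minus[OF subfield_F] by metis+
  show "\<sigma> re \<in> N" "\<sigma> rp \<in> N" "\<sigma> ra \<in> N"
    by (rule signed_mem[OF hom_roots(1)[OF assms] subfield_N] signed_mem[OF hom_roots(2)[OF assms] subfield_N]
        signed_mem[OF hom_roots(3)[OF assms] subfield_N];
        intro subfield_divide[OF subfield_N] subfield_mult[OF subfield_N] g N_gens)+
qed

lemma fix_F_iff:
  assumes L: "subfield L CC" and h: "hom_on L \<sigma>" and FL: "F \<subseteq> L"
  shows "(\<forall>x\<in>F. \<sigma> x = x) \<longleftrightarrow> bits \<sigma> = (False, False, False)"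
proof
  assume "bits \<sigma> = (False, False, False)"
  then have "\<sigma> \<i> = \<i>" "\<sigma> s2 = s2" "\<sigma> sp = sp" by (auto simp: bits_def)
  moreover have "hom_on L (\<lambda>x. x)" by (simp add: hom_on_def)
  ultimately have "F \<subseteq> {x \<in> L. \<sigma> x = x}"
    using FL F_gens by (intro F_least subfield_hom_eq[OF L h]) auto
  then show "\<forall>x\<in>F. \<sigma> x = x" by auto
qed (use F_gens in \<open>auto simp: bits_def\<close>)

lemma agree_on_compositum:
  assumes L: "subfield L CC" and h: "hom_on L \<sigma>" "hom_on L \<tau>"
    and C: "F \<subseteq> C" "compositum C N \<subseteq> L"
    and eq: "\<And>x. x \<in> C \<Longrightarrow> \<sigma> x = \<tau> x" "\<sigma> re = \<tau> re" "\<sigma> rp = \<tau> rp" "\<sigma> ra = \<tau> ra"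
    and x: "x \<in> compositum C N"
  shows "\<sigma> x = \<tau> x"
proof -
  have sub: "C \<subseteq> L" "N \<subseteq> L" using C(2) compositum_upper[where K=C and L=N] by auto
  have E: "subfield {x \<in> L. \<sigma> x = \<tau> x} CC" by (rule subfield_hom_eq[OF L h])
  have "C \<subseteq> {x \<in> L. \<sigma> x = \<tau> x}" using sub eq(1) by auto
  moreover from this have "N \<subseteq> {x \<in> L. \<sigma> x = \<tau> x}"
    using sub N_gens C(1) eq by (intro N_least[OF E]) auto
  ultimately have "compositum C N \<subseteq> {x \<in> L. \<sigma> x = \<tau> x}" by (rule compositum_least[OF E])
  with x show ?thesis by blast
qed

text \<open>Over a field that contains \<open>F\<close> the three roots can only change sign, so the signs
  determine the automorphism.\<close>

lemma agree_on_compositum_signs: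
  assumes L: "subfield L CC" and h: "hom_on L \<sigma>" "hom_on L \<tau>"
    and C: "F \<subseteq> C" "compositum C N \<subseteq> L"
    and fix': "\<And>x. x \<in> C \<Longrightarrow> \<sigma> x = x" "\<And>x. x \<in> C \<Longrightarrow> \<tau> x = x"
  shows "signs \<sigma> = signs \<tau> \<longleftrightarrow> (\<forall>x\<in>compositum C N. \<sigma> x = \<tau> x)"
proof
  have sub: "C \<subseteq> L" "N \<subseteq> L" using C(2) compositum_upper[where K=C and L=N] by auto
  have s: "\<sigma> s2 = s2" "\<sigma> sp = sp" "\<tau> s2 = s2" "\<tau> sp = sp" using fix' C(1) F_gens by auto
  assume eq: "signs \<sigma> = signs \<tau>"
  have ns: "\<not> \<sigma> s2 \<noteq> s2" "\<not> \<sigma> sp \<noteq> sp" "\<not> \<tau> s2 \<noteq> s2" "\<not> \<tau> sp \<noteq> sp" using s by simp_all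
  have es: "(\<sigma> re \<noteq> re) = (\<tau> re \<noteq> re)" "(\<sigma> rp \<noteq> rp) = (\<tau> rp \<noteq> rp)" "(\<sigma> ra \<noteq> ra) = (\<tau> ra \<noteq> ra)"
    using eq unfolding signs_def by blast+
  note r = hom_roots[OF L h(1) sub(2)] hom_roots[OF L h(2) sub(2)]
  have e: "\<sigma> re = \<tau> re" "\<sigma> rp = \<tau> rp" "\<sigma> ra = \<tau> ra"
    using signed_eq[OF r(1,4) ns(1,3) es(1)] signed_eq[OF r(2,5) ns(2,4) es(2)]
      signed_eq[OF r(3,6) ns(1,3) es(3)] .
  show "\<forall>x\<in>compositum C N. \<sigma> x = \<tau> x"
    by (rule ballI, rule agree_on_compositum[OF L h C _ e]) (simp_all add: fix')
next
  assume "\<forall>x\<in>compositum C N. \<sigma> x = \<tau> x"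
  then show "signs \<sigma> = signs \<tau>"
    using N_gens compositum_upper(2)[where K=C and L=N] by (auto simp: signs_def subset_iff)
qed

text \<open>The link between the field theory and the group theory, stated for every compositum \<open>C
  N\<close> over a field \<open>C\<close> on which automorphisms commute. It is used both with
  \<open>C = B\<close> and with \<open>C = A\<close>. Only the finiteness of the degree enters, so
  that the lemma can serve to compute the degree of \<open>K\<close>.\<close>

theorem wedge_group_Gal:
  assumes deg: "has_degree L \<rat> n" and C: "subfield C CC" "F \<subseteq> C" and LC: "L = compositum C N"
    and comm: "\<And>\<sigma> \<tau> x. \<sigma> \<in> carrier (Gal L \<rat>) \<Longrightarrow> \<tau> \<in> carrier (Gal L \<rat>) \<Longrightarrow> x \<in> C \<Longrightarrow> \<sigma> (\<tau> x) = \<tau> (\<sigma> x)"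
    and surj: "\<And>v. \<exists>\<sigma>\<in>carrier (Gal L \<rat>). bits \<sigma> = v"
  shows "wedge_group (Gal L \<rat>) bits (carrier (Gal L C)) signs"
    and "{\<sigma> \<in> carrier (Gal L \<rat>). bits \<sigma> = (False, False, False)} = carrier (Gal L F)"
proof -
  note L = has_degreeD(2,3)[OF deg]
  have sub: "C \<subseteq> L" "N \<subseteq> L" "F \<subseteq> L" using compositum_upper[where K=C and L=N] C(2) LC by auto
  interpret G: group "Gal L \<rat>" by (rule group_Gal[OF L])
  let ?G = "carrier (Gal L \<rat>)"
  let ?inv = "m_inv (Gal L \<rat>)"
  let ?comm = "\<lambda>\<sigma> \<tau>. \<sigma> \<otimes>\<^bsub>Gal L \<rat>\<^esub> \<tau> \<otimes>\<^bsub>Gal L \<rat>\<^esub> ?inv \<sigma> \<otimes>\<^bsub>Gal L \<rat>\<^esub> ?inv \<tau>"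
  have gL: "\<i> \<in> L" "s2 \<in> L" "sp \<in> L" "re \<in> L" "rp \<in> L" "ra \<in> L" using sub F_gens N_gens by auto
  have bits_mult: "bits (\<sigma> \<otimes>\<^bsub>Gal L \<rat>\<^esub> \<tau>) = xor3 (bits \<sigma>) (bits \<tau>)" if "\<sigma> \<in> ?G" "\<tau> \<in> ?G" for \<sigma> \<tau>
  proof -
    note hs = hom_signs[OF L(1) Gal_hom[OF that(1)] sub(3)] hom_signs[OF L(1) Gal_hom[OF that(2)] sub(3)]
    have "(\<sigma> (\<tau> x) \<noteq> x) = ((\<sigma> x \<noteq> x) \<noteq> (\<tau> x \<noteq> x))"
      if x: "x \<in> L" "x \<noteq> 0" and s: "\<sigma> x = (if \<sigma> x \<noteq> x then - x else x)"
        and t: "\<tau> x = (if \<tau> x \<noteq> x then - x else x)" for x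
    proof -
      have "\<sigma> (- x) = - \<sigma> x" by (rule hom_on_minus[OF L(1) Gal_hom[OF \<open>\<sigma> \<in> ?G\<close>] x(1)])
      then show ?thesis using s t x(2) by (metis add.inverse_inverse neg_equal_zero)
    qed
    from this[OF gL(1) _ hs(1,4)] this[OF gL(2) _ hs(2,5)] this[OF gL(3) _ hs(3,6)]
    show ?thesis using nonzero by (simp add: bits_def xor3_def Gal_mult[OF that] gL)
  qed
  have bits_inv: "bits (?inv \<sigma>) = bits \<sigma>" if s: "\<sigma> \<in> ?G" for \<sigma>
  proof -
    have "xor3 (bits (?inv \<sigma>)) (bits \<sigma>) = bits \<one>\<^bsub>Gal L \<rat>\<^esub>"
      using bits_mult[of "?inv \<sigma>" \<sigma>] s by simp
    also have "\<dots> = (False, False, False)" by (simp add: bits_def Gal_one gL)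
    finally show ?thesis by (cases "bits (?inv \<sigma>)"; cases "bits \<sigma>") (simp add: xor3_def)
  qed
  have inv_mem: "?inv \<sigma> \<in> ?G" if "\<sigma> \<in> ?G" for \<sigma> using that by simp
  have comm_apply: "(?comm \<sigma> \<tau>) x
      = \<sigma> (\<tau> ((?inv \<sigma>) ((?inv \<tau>) x)))"
    if st: "\<sigma> \<in> ?G" "\<tau> \<in> ?G" and x: "x \<in> L" for \<sigma> \<tau> x
  proof -
    note i = inv_mem[OF st(1)] inv_mem[OF st(2)]
    have "(?inv \<tau>) x \<in> L" by (rule Gal_in[OF i(2) x])
    moreover from this have "(?inv \<sigma>) ((?inv \<tau>) x) \<in> L" by (rule Gal_in[OF i(1)])
    ultimately show ?thesis using st x i by (simp add: Gal_mult)
  qed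
  have undo: "\<sigma> (\<tau> ((?inv \<tau>) ((?inv \<sigma>) x))) = x"
    if st: "\<sigma> \<in> ?G" "\<tau> \<in> ?G" and x: "x \<in> L" for \<sigma> \<tau> x
  proof -
    have c: "\<rho> ((?inv \<rho>) y) = y" if "\<rho> \<in> ?G" "y \<in> L" for \<rho> y
      using Gal_mult[OF that(1) inv_mem[OF that(1)] that(2)] that by (simp add: Gal_one)
    show ?thesis using c[OF st(2)] c[OF st(1) x] Gal_in[OF inv_mem[OF st(1)] x] by simp
  qed
  have comm_U: "?comm \<sigma> \<tau> \<in> carrier (Gal L C)"
    if st: "\<sigma> \<in> ?G" "\<tau> \<in> ?G" for \<sigma> \<tau>
  proof (rule Gal_subI[where K = \<rat>])
    fix x assume x: "x \<in> C"
    then have xL: "x \<in> L" using sub by blast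
    show "(?comm \<sigma> \<tau>) x = x"
      unfolding comm_apply[OF st xL] comm[OF inv_mem[OF st(1)] inv_mem[OF st(2)] x]
      by (rule undo[OF st xL])
  qed (use st in simp)
  have comm_s: "signs (?comm \<sigma> \<tau>)
      = wedge (bits \<sigma>) (bits \<tau>)" if st: "\<sigma> \<in> ?G" "\<tau> \<in> ?G" for \<sigma> \<tau>
  proof -
    \<comment> \<open>The commutator is \<open>\<sigma> \<tau>\<close> applied after \<open>\<rho> \<theta>\<close>, and \<open>\<sigma> \<tau>\<close> is inverse to \<open>\<theta> \<rho>\<close>; so its sign at a
      root is the sign between \<open>\<rho> \<theta>\<close> and \<open>\<theta> \<rho>\<close> there. Inverses have the same bits.\<close>
    define \<rho> \<theta> where "\<rho> = ?inv \<sigma>" and "\<theta> = ?inv \<tau>"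
    have m: "\<rho> \<in> ?G" "\<theta> \<in> ?G" using st by (simp_all add: \<rho>_def \<theta>_def)
    note h = Gal_hom[OF m(1)] Gal_hom[OF m(2)]
    note hs = hom_signs[OF L(1) h(1) sub(3)] hom_signs[OF L(1) h(2) sub(3)]
    note hr = hom_roots[OF L(1) h(1) sub(2)] hom_roots[OF L(1) h(2) sub(2)]
    have i0: "\<i> \<noteq> 0" by simp
    have sgn: "(\<sigma> (\<tau> (\<rho> (\<theta> r))) \<noteq> r) = c"
      if r: "r \<in> L" "r \<noteq> 0" and tw: "\<rho> (\<theta> r) = (if c then - \<theta> (\<rho> r) else \<theta> (\<rho> r))" for r c
    proof -
      have tr: "\<theta> (\<rho> r) \<in> L" by (rule Gal_in[OF m(2) Gal_in[OF m(1) r(1)]])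
      have "\<sigma> (\<tau> (- \<theta> (\<rho> r))) = - \<sigma> (\<tau> (\<theta> (\<rho> r)))"
        using hom_on_minus[OF L(1) Gal_hom[OF st(2)] tr]
          hom_on_minus[OF L(1) Gal_hom[OF st(1)] Gal_in[OF st(2) tr]] by simp
      moreover have "\<sigma> (\<tau> (\<theta> (\<rho> r))) = r" using undo[OF st r(1)] by (simp add: \<rho>_def \<theta>_def)
      ultimately have "\<sigma> (\<tau> (\<rho> (\<theta> r))) = (if c then - r else r)" using tw by simp
      then show ?thesis using r(2) by simp
    qed
    have "signs (?comm \<sigma> \<tau>)
       = (\<sigma> (\<tau> (\<rho> (\<theta> re))) \<noteq> re, \<sigma> (\<tau> (\<rho> (\<theta> rp))) \<noteq> rp, \<sigma> (\<tau> (\<rho> (\<theta> ra))) \<noteq> ra)"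
      unfolding signs_def comm_apply[OF st gL(4)] comm_apply[OF st gL(5)] comm_apply[OF st gL(6)]
        \<rho>_def \<theta>_def ..
    also have "\<dots> = wedge (bits \<rho>) (bits \<theta>)"
      unfolding sgn[OF gL(4) nonzero(3) twist_divide[OF L(1) h gL(4) gL(1) nonzero(3) i0 hs(1,4) hr(1,4)]]
        sgn[OF gL(5) nonzero(4) twist_mult[OF L(1) h gL(5) gL(1) hs(1,4) hr(2,5)]]
        sgn[OF gL(6) nonzero(5) twist_divide[OF L(1) h gL(6) gL(3) nonzero(5) nonzero(2) hs(3,6) hr(3,6)]]
      by (auto simp: wedge_def bits_def)
    also have "\<dots> = wedge (bits \<sigma>) (bits \<tau>)" using bits_inv[OF st(1)] bits_inv[OF st(2)] by (simp add: \<rho>_def \<theta>_def)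
    finally show ?thesis .
  qed
  have inj: "inj_on signs (carrier (Gal L C))"
  proof (rule inj_onI)
    fix \<sigma> \<tau> assume st: "\<sigma> \<in> carrier (Gal L C)" "\<tau> \<in> carrier (Gal L C)" and eq: "signs \<sigma> = signs \<tau>"
    have "\<forall>x\<in>compositum C N. \<sigma> x = \<tau> x"
      using agree_on_compositum_signs[OF L(1) Gal_hom[OF st(1)] Gal_hom[OF st(2)] C(2)] LC eq
        Gal_fix[OF st(1)] Gal_fix[OF st(2)] by auto
    then show "\<sigma> = \<tau>" using Gal_eqI[OF st] LC by blast
  qed
  show "wedge_group (Gal L \<rat>) bits (carrier (Gal L C)) signs"
    by (intro wedge_group.intro wedge_group_axioms.intro G.is_group finite_Gal[OF deg] bits_mult surj
        subgroup_Gal[OF L(1) Rats_subset_subfield[OF C(1)] sub(1)] inj comm_U comm_s)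
  show "{\<sigma> \<in> ?G. bits \<sigma> = (False, False, False)} = carrier (Gal L F)"
  proof (intro equalityI subsetI)
    fix \<sigma> assume "\<sigma> \<in> {\<sigma> \<in> ?G. bits \<sigma> = (False, False, False)}"
    then show "\<sigma> \<in> carrier (Gal L F)"
      using fix_F_iff[OF L(1) Gal_hom sub(3), of \<sigma> \<rat>] by (auto intro: Gal_subI)
  next
    fix \<sigma> assume s: "\<sigma> \<in> carrier (Gal L F)"
    have "bits \<sigma> = (False, False, False)"
      using fix_F_iff[OF L(1) Gal_hom[OF s] sub(3)] Gal_fix[OF s] by blast
    moreover have "\<sigma> \<in> ?G" using s Gal_mono[OF Rats_subset_subfield[OF subfield_F], of L] by blast
    ultimately show "\<sigma> \<in> {\<sigma> \<in> ?G. bits \<sigma> = (False, False, False)}" by simp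
  qed
qed

end

section \<open>The Galois group of the large field\<close>

lemma hom_determined_on_cyclotomic:
  assumes L: "subfield L CC" and h: "hom_on L \<sigma>" "hom_on L \<tau>" and n: "cyclotomic n \<subseteq> L"
    and eq: "\<sigma> (cis (2 * pi / real n)) = \<tau> (cis (2 * pi / real n))" and x: "x \<in> cyclotomic n"
  shows "\<sigma> x = \<tau> x"
proof -
  have E: "subfield {x \<in> L. \<sigma> x = \<tau> x} CC" by (rule subfield_hom_eq[OF L h])
  have "cyclotomic n \<subseteq> {x \<in> L. \<sigma> x = \<tau> x}"
    unfolding cyclotomic_def
    using n cyclotomic_root_mem[of n] eq by (intro adjoin_least[OF E] Rats_subset_subfield[OF E]) auto
  with x show ?thesis by blast
qed

lemma hom_cyclotomic_stable:
  assumes L: "subfield L CC" and h: "hom_on L \<sigma>" and n: "n > 0" "cyclotomic n \<subseteq> L" and x: "x \<in> cyclotomic n"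
  shows "\<sigma> x \<in> cyclotomic n"
proof -
  let ?z = "cis (2 * pi / real n)"
  have zL: "?z \<in> L" using n(2) cyclotomic_root_mem by blast
  obtain k where "\<sigma> ?z = ?z ^ k" using hom_on_root_of_unity[OF L h n(1) zL] by blast
  then have "\<sigma> ?z \<in> cyclotomic n" using subfield_power[OF subfield_cyclotomic cyclotomic_root_mem] by simp
  note V = subfield_hom_vimage[OF L h subfield_cyclotomic[of n]]
  have "adjoin \<rat> {?z} \<subseteq> {x \<in> L. \<sigma> x \<in> cyclotomic n}"
    using zL \<open>\<sigma> ?z \<in> cyclotomic n\<close> by (intro adjoin_least[OF V] Rats_subset_subfield[OF V]) simp
  with x show ?thesis unfolding cyclotomic_def[of n] by blast
qed

lemma hom_commute_on_cyclotomic: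
  assumes L: "subfield L CC" and s: "\<sigma> \<in> carrier (Gal L \<rat>)" and t: "\<tau> \<in> carrier (Gal L \<rat>)"
    and n: "n > 0" "cyclotomic n \<subseteq> L" and x: "x \<in> cyclotomic n"
  shows "\<sigma> (\<tau> x) = \<tau> (\<sigma> x)"
proof -
  let ?z = "cis (2 * pi / real n)"
  have zL: "?z \<in> L" using n(2) cyclotomic_root_mem by blast
  obtain j k where jk: "\<sigma> ?z = ?z ^ j" "\<tau> ?z = ?z ^ k"
    using hom_on_root_of_unity[OF L Gal_hom[OF s] n(1) zL] hom_on_root_of_unity[OF L Gal_hom[OF t] n(1) zL] by blast
  have "\<sigma> (\<tau> ?z) = \<tau> (\<sigma> ?z)"
    unfolding jk hom_on_power[OF L Gal_hom[OF s] zL] hom_on_power[OF L Gal_hom[OF t] zL]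
    by (simp add: power_mult[symmetric] mult.commute)
  from hom_determined_on_cyclotomic[OF L hom_on_compose[OF Gal_hom[OF s] Gal_hom[OF t] Gal_in[OF t]]
      hom_on_compose[OF Gal_hom[OF t] Gal_hom[OF s] Gal_in[OF s]] n(2) this x]
  show ?thesis .
qed

text \<open>The four exponents 1, 3, 5, 7 realize the four sign patterns on \<open>\<i>\<close> and
  \<open>\<surd>2\<close>.\<close>

lemma cyclotomic_16_action:
  assumes L: "subfield L CC" and h: "hom_on L \<sigma>" and 16: "cyclotomic 16 \<subseteq> L"
    and m: "\<sigma> (cis (2 * pi / 16)) = cis (2 * pi / 16) ^ (if c then if d then 3 else 7 else if d then 5 else 1)"
  shows "\<sigma> \<i> = (if c then - \<i> else \<i>)"
    and "\<sigma> (complex_of_real (sqrt 2)) = (if d then - complex_of_real (sqrt 2) else complex_of_real (sqrt 2))"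
proof -
  define u where "u = cis (pi / 4)"
  define m where "m = (if c then if d then 3 else 7 else if d then 5 else 1 :: nat)"
  have zL: "cis (2 * pi / 16) \<in> L" using 16 cyclotomic_root_mem[of 16] by auto
  have u2: "u\<^sup>2 = \<i>" and s: "complex_of_real (sqrt 2) = u + inverse u" and uz: "u = cis (2 * pi / 16) ^ 2"
    using cis_pi_quarter by (simp_all add: u_def)
  have uL: "u \<in> L" unfolding uz by (rule subfield_power[OF L zL])
  have su: "\<sigma> u = u ^ m"
    unfolding uz hom_on_power[OF L h zL] assms(4) m_def by (simp add: power_mult[symmetric] mult.commute)
  have u0: "u \<noteq> 0" by (simp add: u_def)
  have inv: "inverse u = - \<i> * u" using u2 u0 by (simp add: field_simps power2_eq_square)
  have u3: "u ^ 3 = \<i> * u" using u2 by (simp add: power3_eq_cube power2_eq_square)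
  have u5: "u ^ 5 = - u"
  proof -
    have "u ^ 5 = u ^ 2 * u ^ 2 * u" by (simp flip: power_add power_Suc2)
    then show ?thesis using u2 by simp
  qed
  have u7: "u ^ 7 = - \<i> * u"
  proof -
    have "u ^ 7 = u ^ 2 * u ^ 5" by (simp flip: power_add)
    then show ?thesis using u2 u5 by simp
  qed
  have um: "u ^ m = (if c then if d then \<i> * u else - \<i> * u else if d then - u else u)"
    using u3 u5 u7 by (simp add: m_def)
  have "\<sigma> \<i> = (u ^ m)\<^sup>2" using hom_on_power[OF L h uL, of 2] su u2 by simp
  then show "\<sigma> \<i> = (if c then - \<i> else \<i>)" unfolding um using u2 by (simp add: power_mult_distrib)
  have "\<sigma> (complex_of_real (sqrt 2)) = u ^ m + inverse (u ^ m)"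
    unfolding s using hom_on_add[OF h uL subfield_inverse[OF L uL]] hom_on_inverse[OF L h uL] su by simp
  then show "\<sigma> (complex_of_real (sqrt 2)) = (if d then - complex_of_real (sqrt 2) else complex_of_real (sqrt 2))"
    unfolding um s by (simp add: inv inverse_mult_distrib)
qed

context quadratic_form_prime
begin

abbreviation "z16 \<equiv> cis (2 * pi / 16)"
abbreviation "zp \<equiv> cis (2 * pi / real p)"
abbreviation "zB \<equiv> cis (2 * pi / real (16 * p))"

lemma cyclotomic_16_sub_B: "cyclotomic 16 \<subseteq> B" and cyclotomic_p_sub_B: "cyclotomic p \<subseteq> B"
  unfolding B_field_def using cyclotomic_mono[of p 16] cyclotomic_mono[of 16 p] p0
  by (simp_all add: mult.commute)

lemma zB_powers: "zB ^ p = z16" "zB ^ 16 = zp"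
  using cis_root_power[of p 16] cis_root_power[of 16 p] p0 by (simp_all add: mult.commute)

lemma zp_power_eq_1_iff: "zp ^ k = 1 \<longleftrightarrow> p dvd k"
  by (rule cis_root_of_unity_iff[OF p0])

lemma zp_exponent:
  assumes L: "subfield L CC" and h: "hom_on L \<sigma>" and z: "zp \<in> L" "\<sigma> zp = zp ^ c"
  shows "\<not> p dvd c"
proof
  assume "p dvd c"
  then have "\<sigma> zp = \<sigma> 1" using z(2) zp_power_eq_1_iff hom_on_1[OF h] by simp
  then have "zp = 1" using hom_on_inj[OF L h z(1) subfield_1[OF L]] by simp
  then have "p dvd 1" using zp_power_eq_1_iff[of 1] by simp
  then show False using p(1) not_prime_unit by blast
qed

lemma sp_mem: "sp \<in> cyclotomic p"
proof -
  have "p mod 4 = 1" using p(2) by presburger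
  then show ?thesis by (rule sqrt_in_cyclotomic)
qed

lemma coprime_16_p: "coprime 16 p"
proof -
  have "odd p" using p(2) by presburger
  then have "coprime (2 ^ 4) p" unfolding coprime_power_left_iff by (simp add: coprime_left_2_iff_odd)
  then show ?thesis by simp
qed

lemma galois_degree_B: "galois_degree B \<rat> (8 * (p - 1))"
proof -
  have "totient (2 ^ Suc 3) = 8" by (subst totient_prime_power_Suc) auto
  then have "totient (16 * p) = 8 * (p - 1)"
    using totient_mult_coprime[OF coprime_16_p] totient_prime[OF p(1)] by simp
  then show ?thesis
    unfolding B_field_def using galois_degree_cyclotomic[of "16 * p"] p0 by simp
qed

text \<open>By the Chinese remainder theorem the actions on the roots of unity of order 16 and of order
  \<open>p\<close> can be prescribed independently.\<close>

lemma B_automorphism: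
  assumes "odd m" "\<not> p dvd c"
  shows "\<exists>\<sigma>\<in>carrier (Gal B \<rat>). \<sigma> z16 = z16 ^ m \<and> \<sigma> zp = zp ^ c"
proof -
  obtain k where k: "[k = m] (mod 16)" "[k = c] (mod p)"
    using binary_chinese_remainder_nat[OF coprime_16_p] by blast
  have "coprime k (16 * p)"
  proof -
    have "odd k"
    proof -
      have "k mod 16 = m mod 16" using k(1) by (simp add: cong_def)
      then show ?thesis using assms(1) by presburger
    qed
    then have "coprime k (2 ^ 4)" unfolding coprime_power_right_iff by (simp add: coprime_right_2_iff_odd)
    moreover have "\<not> p dvd k" using assms(2) k(2) by (simp add: cong_dvd_iff)
    then have "coprime p k" by (rule prime_imp_coprime[OF p(1)])
    then have "coprime k p" by (simp only: coprime_commute)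
    ultimately show ?thesis by simp
  qed
  from root_of_unity_automorphism[OF _ cis_root_of_unity_iff this] p0
  obtain \<sigma> where \<sigma>: "\<sigma> \<in> carrier (Gal B \<rat>)" "\<sigma> zB = zB ^ k"
    unfolding B_field_def cyclotomic_def by auto
  have zB: "zB \<in> B" unfolding B_field_def by (rule cyclotomic_root_mem)
  note pw = hom_on_power[OF subfield_B Gal_hom[OF \<sigma>(1)] zB]
  have act: "\<sigma> z16 = z16 ^ k" "\<sigma> zp = zp ^ k"
    unfolding zB_powers[symmetric] pw \<sigma>(2) by (simp_all only: power_mult[symmetric] mult.commute)
  have "z ^ k = z ^ m" if "[k = m] (mod n)" "z ^ n = 1" for z :: complex and k m n
    using power_mod_period[OF that(2)] that(1) by (metis cong_def)
  note cong_power = this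
  have "z16 ^ 16 = 1" "zp ^ p = 1"
    using cis_root_of_unity_iff[of 16 16] cis_root_of_unity_iff[OF p0, of p] by simp_all
  from cong_power[OF k(1) this(1)] cong_power[OF k(2) this(2)] act \<sigma>(1)
  show ?thesis by (intro bexI[of _ \<sigma>] conjI) simp_all
qed

text \<open>As \<open>\<surd>p\<close> is irrational, some automorphism moves it; as \<open>\<surd>p\<close>
  lies in the \<open>p\<close>-th cyclotomic field, this depends only on the exponent at
  \<open>\<zeta>\<^sub>p\<close>.\<close>

lemma B_flips_sp: "\<exists>c. \<not> p dvd c \<and> (\<forall>\<sigma>\<in>carrier (Gal B \<rat>). \<sigma> zp = zp ^ c \<longrightarrow> \<sigma> sp \<noteq> sp)"
proof -
  have "{x \<in> B. \<forall>\<sigma>\<in>carrier (Gal B \<rat>). \<sigma> x = x} = \<rat>"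
    by (rule fixed_field_Gal[OF galois_degree_B subfield_Rats _ Rats_subset_subfield[OF subfield_B]]) simp
  moreover have "sp \<in> B" using F_gens F_sub_B by blast
  ultimately obtain \<sigma> where s: "\<sigma> \<in> carrier (Gal B \<rat>)" "\<sigma> sp \<noteq> sp"
    using prime_sqrt_not_Rat[OF p(1)] by blast
  have zpB: "zp \<in> B" using cyclotomic_p_sub_B cyclotomic_root_mem by blast
  obtain c where c: "\<sigma> zp = zp ^ c"
    using hom_on_root_of_unity[OF subfield_B Gal_hom[OF s(1)] p0 zpB] by blast
  have "\<not> p dvd c" by (rule zp_exponent[OF subfield_B Gal_hom[OF s(1)] zpB c])
  moreover have "\<tau> sp \<noteq> sp" if "\<tau> \<in> carrier (Gal B \<rat>)" "\<tau> zp = zp ^ c" for \<tau>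
    using hom_determined_on_cyclotomic[OF subfield_B Gal_hom[OF that(1)] Gal_hom[OF s(1)]
        cyclotomic_p_sub_B _ sp_mem] that(2) c s(2) by simp
  ultimately show ?thesis by blast
qed

lemma B_bits_surj: "\<exists>\<sigma>\<in>carrier (Gal B \<rat>). bits \<sigma> = v"
proof -
  obtain c d e where v: "v = (c, d, e)" by (cases v)
  obtain k where k: "\<not> p dvd k" "\<And>\<sigma>. \<sigma> \<in> carrier (Gal B \<rat>) \<Longrightarrow> \<sigma> zp = zp ^ k \<Longrightarrow> \<sigma> sp \<noteq> sp"
    using B_flips_sp by blast
  define m where "m = (if c then if d then 3 else 7 else if d then 5 else 1 :: nat)"
  have "odd m" by (simp add: m_def)
  moreover have "\<not> p dvd 1" using p(1) not_prime_unit by blast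
  then have "\<not> p dvd (if e then k else 1)" using k(1) by simp
  ultimately obtain \<sigma> where s: "\<sigma> \<in> carrier (Gal B \<rat>)" "\<sigma> z16 = z16 ^ m" "\<sigma> zp = zp ^ (if e then k else 1)"
    using B_automorphism by blast
  note act = cyclotomic_16_action[OF subfield_B Gal_hom[OF s(1)] cyclotomic_16_sub_B s(2)[unfolded m_def]]
  have "\<i> \<noteq> - \<i>" "s2 \<noteq> - s2" using nonzero(1) by (simp_all add: eq_neg_iff_add_eq_0)
  then have "\<sigma> \<i> \<noteq> \<i> \<longleftrightarrow> c" "\<sigma> s2 \<noteq> s2 \<longleftrightarrow> d" using act by auto
  moreover have "\<sigma> sp \<noteq> sp \<longleftrightarrow> e"
  proof (cases e)
    case True
    then show ?thesis using k(2)[OF s(1)] s(3) by simp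
  next
    case False
    then have "\<sigma> zp = zp" using s(3) by simp
    moreover have "hom_on B (\<lambda>x. x)" by (simp add: hom_on_def)
    ultimately have "\<sigma> sp = sp"
      using hom_determined_on_cyclotomic[OF subfield_B Gal_hom[OF s(1)] _ cyclotomic_p_sub_B _ sp_mem, of "\<lambda>x. x"]
      by simp
    with False show ?thesis by simp
  qed
  ultimately show ?thesis using s(1) v by (intro bexI[of _ \<sigma>]) (simp_all add: bits_def)
qed

definition "K1 = adjoin B {re}"
definition "K2 = adjoin K1 {rp}"

lemma subfield_K12: "subfield K1 CC" "subfield K2 CC"
  by (simp_all add: K1_def K2_def subfield_adjoin)

lemma tower_squares: "re\<^sup>2 \<in> B" "rp\<^sup>2 \<in> K1" "ra\<^sup>2 \<in> K2" and tower_sub: "B \<subseteq> K1" "K1 \<subseteq> K2"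
proof -
  show sub: "B \<subseteq> K1" "K1 \<subseteq> K2" unfolding K1_def K2_def by (rule adjoin_base)+
  have g: "s2 \<in> B" "sp \<in> B" using F_gens F_sub_B by auto
  show "re\<^sup>2 \<in> B" unfolding squares(3) by (intro subfield_add subfield_1 subfield_B g)
  show "rp\<^sup>2 \<in> K1" unfolding squares(4) using g sub by blast
  have "of_int a + of_int b * s2 \<in> B"
    by (intro subfield_add subfield_mult subfield_of_int subfield_B g)
  then show "ra\<^sup>2 \<in> K2" unfolding squares(5) using sub by blast
qed

lemma K_tower: "K = adjoin K2 {ra}"
proof
  have sub: "K2 \<subseteq> adjoin K2 {ra}" by (rule adjoin_base)
  then have B3: "B \<subseteq> adjoin K2 {ra}" using tower_sub by blast
  have "re \<in> K1" "rp \<in> K2" "ra \<in> adjoin K2 {ra}"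
    unfolding K1_def K2_def using adjoin_gens by blast+
  then have "N \<subseteq> adjoin K2 {ra}"
    using sub tower_sub B3 F_sub_B by (intro N_least subfield_adjoin) auto
  with B3 show "K \<subseteq> adjoin K2 {ra}"
    unfolding BN_field_def by (intro compositum_least subfield_adjoin)
  have g: "re \<in> K" "rp \<in> K" "ra \<in> K" using N_gens N_sub_K by auto
  have "K1 \<subseteq> K" unfolding K1_def using g B_sub_K by (intro adjoin_least subfield_K) auto
  then have "K2 \<subseteq> K" unfolding K2_def using g by (intro adjoin_least subfield_K) auto
  then show "adjoin K2 {ra} \<subseteq> K" using g by (intro adjoin_least subfield_K) auto
qed

text \<open>Three quadratic steps above \<open>B\<close>; whether a step is trivial is left open here.\<close>

lemma K_degree_bound: "\<exists>n\<le>64 * (p - 1). has_degree K \<rat> n"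
proof -
  obtain j1 where j1: "has_degree K1 B j1" "j1 \<le> 2"
    unfolding K1_def by (rule has_degree_adjoin_sqrt[OF subfield_B tower_squares(1)])
  obtain j2 where j2: "has_degree K2 K1 j2" "j2 \<le> 2"
    unfolding K2_def by (rule has_degree_adjoin_sqrt[OF subfield_K12(1) tower_squares(2)])
  obtain j3 where j3: "has_degree K K2 j3" "j3 \<le> 2"
    unfolding K_tower by (rule has_degree_adjoin_sqrt[OF subfield_K12(2) tower_squares(3)])
  have "has_degree K \<rat> (8 * (p - 1) * j1 * j2 * j3)"
    using has_degree_tower[OF has_degree_tower[OF has_degree_tower[OF
          galois_degreeD(1)[OF galois_degree_B] j1(1)] j2(1)] j3(1)] .
  moreover have "8 * (p - 1) * j1 * j2 * j3 \<le> 8 * (p - 1) * 2 * 2 * 2"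
    using j1(2) j2(2) j3(2) by (intro mult_le_mono) auto
  ultimately show ?thesis by (intro exI[of _ "8 * (p - 1) * j1 * j2 * j3"]) simp
qed

lemma extend_to_K:
  assumes s: "\<sigma> \<in> carrier (Gal B \<rat>)"
  shows "\<exists>\<psi>\<in>carrier (Gal K \<rat>). \<forall>x\<in>B. \<psi> x = \<sigma> x"
proof -
  obtain \<psi>1 where 1: "hom_on K1 \<psi>1" "\<forall>x\<in>B. \<psi>1 x = \<sigma> x"
    using extend_hom_adjoin_sqrt[OF subfield_B tower_squares(1) Gal_hom[OF s]] unfolding K1_def by blast
  obtain \<psi>2 where 2: "hom_on K2 \<psi>2" "\<forall>x\<in>K1. \<psi>2 x = \<psi>1 x"
    using extend_hom_adjoin_sqrt[OF subfield_K12(1) tower_squares(2) 1(1)] unfolding K2_def by blast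
  obtain \<psi> where 3: "hom_on K \<psi>" "\<forall>x\<in>K2. \<psi> x = \<psi>2 x"
    using extend_hom_adjoin_sqrt[OF subfield_K12(2) tower_squares(3) 2(1)] unfolding K_tower by blast
  have eq: "\<psi> x = \<sigma> x" if x: "x \<in> B" for x
  proof -
    have "x \<in> K1" "x \<in> K2" using x tower_sub by blast+
    with x 1(2) 2(2) 3(2) show ?thesis by simp
  qed
  have V: "subfield {x \<in> K. \<psi> x \<in> K} CC" by (rule subfield_hom_vimage[OF subfield_K 3(1) subfield_K])
  have "B \<subseteq> {x \<in> K. \<psi> x \<in> K}" using eq Gal_in[OF s] B_sub_K by auto
  moreover from this have "N \<subseteq> {x \<in> K. \<psi> x \<in> K}"
    using hom_on_roots_mem(4-6)[OF subfield_K 3(1) N_sub_K] N_sub_K N_gens F_sub_B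
    by (intro N_least[OF V]) auto
  ultimately have "K \<subseteq> {x \<in> K. \<psi> x \<in> K}" unfolding BN_field_def[of p a b]
    by (intro compositum_least) (use V in \<open>simp_all add: BN_field_def\<close>)
  then have into: "\<psi> x \<in> K" if "x \<in> K" for x using that by blast
  obtain n where "has_degree K \<rat> n" using K_degree_bound by blast
  then have "bij_betw \<psi> K K"
    by (rule endomorphism_bij[OF _ 3(1)]) (auto simp: hom_on_Rats[OF subfield_K 3(1)] into)
  then have "restrict \<psi> K \<in> carrier (Gal K \<rat>)"
    using 3(1) hom_on_restrict[OF subfield_K, of \<psi>] Rats_subset_subfield[OF subfield_K]
    by (auto simp: Gal_iff hom_on_Rats[OF subfield_K 3(1)] cong: bij_betw_cong)
  then show ?thesis using eq B_sub_K by (intro bexI[of _ "restrict \<psi> K"]) auto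
qed

lemma commute_on_B:
  "\<sigma> \<in> carrier (Gal K \<rat>) \<Longrightarrow> \<tau> \<in> carrier (Gal K \<rat>) \<Longrightarrow> x \<in> B \<Longrightarrow> \<sigma> (\<tau> x) = \<tau> (\<sigma> x)"
  using hom_commute_on_cyclotomic[OF subfield_K, of \<sigma> \<tau> "16 * p" x] p0 B_sub_K
  by (simp add: B_field_def)

lemma K_bits_surj: "\<exists>\<sigma>\<in>carrier (Gal K \<rat>). bits \<sigma> = v"
proof -
  obtain \<sigma> where s: "\<sigma> \<in> carrier (Gal B \<rat>)" "bits \<sigma> = v" using B_bits_surj by blast
  obtain \<psi> where t: "\<psi> \<in> carrier (Gal K \<rat>)" "\<forall>x\<in>B. \<psi> x = \<sigma> x" using extend_to_K[OF s(1)] by blast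
  have "\<i> \<in> B" "s2 \<in> B" "sp \<in> B" using F_gens F_sub_B by auto
  then have "bits \<psi> = bits \<sigma>" using t(2) by (simp add: bits_def)
  with s t show ?thesis by auto
qed

lemma wedge_group_K:
  "wedge_group (Gal K \<rat>) bits (carrier (Gal K B)) signs"
  "{\<sigma> \<in> carrier (Gal K \<rat>). bits \<sigma> = (False, False, False)} = carrier (Gal K F)"
proof -
  obtain n where n: "has_degree K \<rat> n" using K_degree_bound by blast
  have K: "K = compositum B N" by (simp add: BN_field_def)
  show "wedge_group (Gal K \<rat>) bits (carrier (Gal K B)) signs"
    by (rule wedge_group_Gal(1)[OF n subfield_B F_sub_B K], erule (2) commute_on_B, rule K_bits_surj)
  show "{\<sigma> \<in> carrier (Gal K \<rat>). bits \<sigma> = (False, False, False)} = carrier (Gal K F)"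
    by (rule wedge_group_Gal(2)[OF n subfield_B F_sub_B K], erule (2) commute_on_B, rule K_bits_surj)
qed

text \<open>At least \<open>8 (p - 1)\<close> restrictions to \<open>B\<close> and eight automorphisms over
  \<open>B\<close> make up for the upper bound on the degree. In particular no step of the quadratic
  tower is trivial.\<close>

theorem galois_degree_K: "galois_degree K \<rat> (64 * (p - 1))"
proof -
  obtain n where n: "n \<le> 64 * (p - 1)" "has_degree K \<rat> n" using K_degree_bound by blast
  have "card (carrier (Gal K \<rat>))
      = card ((\<lambda>\<sigma>. restrict \<sigma> B) ` carrier (Gal K \<rat>)) * card (carrier (Gal K B))"
    by (rule card_Gal_fibres[OF subfield_K Rats_subset_subfield[OF subfield_B] B_sub_K finite_Gal[OF n(2)]])
      (auto simp: fun_eq_iff)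
  moreover have "card (carrier (Gal K B)) = 8" by (rule wedge_group.card_U[OF wedge_group_K(1)])
  moreover have "8 * (p - 1) \<le> card ((\<lambda>\<sigma>. restrict \<sigma> B) ` carrier (Gal K \<rat>))"
  proof -
    have "carrier (Gal B \<rat>) \<subseteq> (\<lambda>\<sigma>. restrict \<sigma> B) ` carrier (Gal K \<rat>)"
    proof
      fix \<sigma> assume s: "\<sigma> \<in> carrier (Gal B \<rat>)"
      obtain \<psi> where t: "\<psi> \<in> carrier (Gal K \<rat>)" "\<forall>x\<in>B. \<psi> x = \<sigma> x" using extend_to_K[OF s] by blast
      have "\<sigma> = restrict \<psi> B"
        by (rule extensionalityI[OF Gal_ext[OF s]]) (use t in auto)
      with t show "\<sigma> \<in> (\<lambda>\<sigma>. restrict \<sigma> B) ` carrier (Gal K \<rat>)" by blast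
    qed
    from card_mono[OF _ this] show ?thesis
      using finite_Gal[OF n(2)] galois_degreeD(2)[OF galois_degree_B] by simp
  qed
  ultimately have "64 * (p - 1) \<le> card (carrier (Gal K \<rat>))" by simp
  with n card_Gal_le[OF n(2)] have "n = 64 * (p - 1)" "card (carrier (Gal K \<rat>)) = 64 * (p - 1)" by linarith+
  with n(2) show ?thesis by (simp add: galois_degree_def)
qed

end

section \<open>The quartic subfield\<close>

lemma cis_power_eq_iff:
  assumes n: "n > 0"
  shows "cis (2 * pi / real n) ^ i = cis (2 * pi / real n) ^ j \<longleftrightarrow> [i = j] (mod n)"
  by (rule primitive_power_eq_iff[OF n cis_root_of_unity_iff[OF n]])

context quadratic_form_prime
begin

abbreviation "\<Gamma> \<equiv> Gal K \<rat>"

lemma Cp_sub_K: "cyclotomic p \<subseteq> K" using cyclotomic_p_sub_B B_sub_K by blast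

lemma group_\<Gamma>: "group \<Gamma>"
  by (rule group_Gal[OF subfield_K Rats_subset_subfield[OF subfield_K]])

lemma four_dvd: "4 dvd p - 1" using p(2) by presburger

text \<open>A primitive root modulo \<open>p\<close>; it makes the Galois group of the \<open>p\<close>-th
  cyclotomic field visibly cyclic.\<close>

definition prim :: nat where "prim = (SOME g. residue_primroot p g)"

lemma prim: "residue_primroot p prim"
  unfolding prim_def using prime_primitive_root_exists[of p] p(1) prime_gt_1_nat by (metis someI_ex)

lemma prim_power_cong: "[prim ^ i = prim ^ j] (mod p) \<longleftrightarrow> [i = j] (mod p - 1)"
  using order_divides_expdiff[of p prim i j] prim totient_prime[OF p(1)] by (simp add: residue_primroot_def)

lemma prim_log: assumes "\<not> p dvd u" shows "\<exists>j. [u = prim ^ j] (mod p)"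
proof -
  have "u mod p \<in> totatives p"
    using assms p(1) p0 by (simp add: totatives_prime dvd_eq_mod_eq_0)
  then have "u mod p \<in> (\<lambda>i. prim ^ i mod p) ` {..<totient p}"
    using residue_primroot_is_generator[OF prime_gt_1_nat[OF p(1)] prim] by (simp add: bij_betw_def)
  then obtain j where "u mod p = prim ^ j mod p" by (rule imageE)
  then show ?thesis by (intro exI[of _ j]) (simp add: cong_def)
qed

lemma \<Gamma>_automorphism:
  assumes "odd m" "\<not> p dvd c"
  shows "\<exists>\<sigma>\<in>carrier \<Gamma>. \<sigma> z16 = z16 ^ m \<and> \<sigma> zp = zp ^ c"
proof -
  obtain \<sigma> where s: "\<sigma> \<in> carrier (Gal B \<rat>)" "\<sigma> z16 = z16 ^ m" "\<sigma> zp = zp ^ c"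
    using B_automorphism[OF assms] by blast
  obtain \<psi> where t: "\<psi> \<in> carrier \<Gamma>" "\<forall>x\<in>B. \<psi> x = \<sigma> x" using extend_to_K[OF s(1)] by blast
  have "z16 \<in> B" "zp \<in> B"
    using cyclotomic_16_sub_B cyclotomic_root_mem[of 16] cyclotomic_p_sub_B cyclotomic_root_mem[of p] by auto
  with s t show ?thesis by (intro bexI[OF _ t(1)]) simp
qed

definition rho where "rho = (SOME \<sigma>. \<sigma> \<in> carrier \<Gamma> \<and> \<sigma> zp = zp ^ prim)"

lemma rho: "rho \<in> carrier \<Gamma>" "rho zp = zp ^ prim"
proof -
  have "coprime p prim" using prim by (simp add: residue_primroot_def)
  moreover have "\<not> p dvd 1" using p(1) not_prime_unit by blast
  ultimately have "\<not> p dvd prim" by (metis coprime_common_divisor dvd_refl)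
  then have "\<exists>\<sigma>. \<sigma> \<in> carrier \<Gamma> \<and> \<sigma> zp = zp ^ prim" using \<Gamma>_automorphism[of 1 prim] by auto
  then have "rho \<in> carrier \<Gamma> \<and> rho zp = zp ^ prim" unfolding rho_def by (rule someI_ex)
  then show "rho \<in> carrier \<Gamma>" "rho zp = zp ^ prim" by auto
qed

text \<open>The power \<open>j\<close> of an automorphism that acts on the \<open>p\<close>-th cyclotomic
  field as a generator. Every automorphism of \<open>K\<close> agrees with one of these powers on
  that field.\<close>

definition P :: "nat \<Rightarrow> complex \<Rightarrow> complex" where "P j = rho [^]\<^bsub>\<Gamma>\<^esub> j"

lemma P_mem: "P j \<in> carrier \<Gamma>"
  unfolding P_def by (intro monoid.nat_pow_closed[OF group.is_monoid[OF group_\<Gamma>]] rho)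

lemma P_add: "x \<in> K \<Longrightarrow> P (i + j) x = P i (P j x)"
  using Gal_mult[OF P_mem P_mem, of x i j]
    monoid.nat_pow_mult[OF group.is_monoid[OF group_\<Gamma>] rho(1), of i j]
  by (simp add: P_def)

lemma P_1: "P 1 = rho"
  unfolding P_def using monoid.nat_pow_eone[OF group.is_monoid[OF group_\<Gamma>] rho(1)] by simp

lemma P_0: "x \<in> K \<Longrightarrow> P 0 x = x"
  by (simp add: P_def monoid.nat_pow_0[OF group.is_monoid[OF group_\<Gamma>]] Gal_one)

lemma zp_mem: "zp \<in> cyclotomic p" "zp \<in> K"
  using cyclotomic_root_mem Cp_sub_K by blast+

lemma P_zp: "P j zp = zp ^ (prim ^ j)"
proof (induction j)
  case 0
  then show ?case using P_0[OF zp_mem(2)] by simp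
next
  case (Suc j)
  have "P (Suc j) zp = P j (P 1 zp)" using P_add[OF zp_mem(2), of j 1] by simp
  also have "\<dots> = P j (zp ^ prim)" unfolding P_1 rho(2) ..
  also have "\<dots> = (P j zp) ^ prim" by (rule hom_on_power[OF subfield_K Gal_hom[OF P_mem] zp_mem(2)])
  finally show ?case unfolding Suc by (simp add: power_mult[symmetric] mult.commute)
qed

lemma agree_on_Cp:
  assumes "\<sigma> \<in> carrier \<Gamma>" "\<tau> \<in> carrier \<Gamma>" "\<sigma> zp = \<tau> zp" "x \<in> cyclotomic p"
  shows "\<sigma> x = \<tau> x"
  by (rule hom_determined_on_cyclotomic[OF subfield_K Gal_hom[OF assms(1)] Gal_hom[OF assms(2)] Cp_sub_K assms(3,4)])

lemma P_zp_eq_iff: "P i zp = P j zp \<longleftrightarrow> [i = j] (mod p - 1)"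
  unfolding P_zp cis_power_eq_iff[OF p0] by (rule prim_power_cong)

lemma eq_power_on_Cp:
  assumes s: "\<sigma> \<in> carrier \<Gamma>" shows "\<exists>j. \<forall>x\<in>cyclotomic p. \<sigma> x = P j x"
proof -
  obtain c where c: "\<sigma> zp = zp ^ c"
    using hom_on_root_of_unity[OF subfield_K Gal_hom[OF s] p0 zp_mem(2)] by blast
  have "\<not> p dvd c" by (rule zp_exponent[OF subfield_K Gal_hom[OF s] zp_mem(2) c])
  then obtain j where "[c = prim ^ j] (mod p)" using prim_log by blast
  then have "\<sigma> zp = P j zp" unfolding c P_zp cis_power_eq_iff[OF p0] .
  then show ?thesis using agree_on_Cp[OF s P_mem] by blast
qed

text \<open>The automorphisms that raise \<open>\<zeta>\<^sub>p\<close> to a fourth power residue modulo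
  \<open>p\<close>. As 4 divides \<open>p - 1\<close>, the condition on \<open>j\<close> does not
  depend on the choice of \<open>j\<close>.\<close>

definition H4 where "H4 = {\<sigma> \<in> carrier \<Gamma>. \<exists>j. 4 dvd j \<and> (\<forall>x\<in>cyclotomic p. \<sigma> x = P j x)}"

lemma P_in_H4_iff: "P j \<in> H4 \<longleftrightarrow> 4 dvd j"
proof
  assume "P j \<in> H4"
  then obtain i where "4 dvd i" "P j zp = P i zp" using zp_mem by (auto simp: H4_def)
  moreover from this have "[j = i] (mod 4)"
    using P_zp_eq_iff four_dvd cong_dvd_modulus_nat by blast
  ultimately show "4 dvd j" by (simp add: cong_dvd_iff)
qed (use P_mem in \<open>auto simp: H4_def\<close>)

lemma subgroup_H4: "subgroup H4 \<Gamma>"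
proof (rule group.subgroupI[OF group_\<Gamma>])
  interpret G: group \<Gamma> by (rule group_\<Gamma>)
  show "H4 \<subseteq> carrier \<Gamma>" by (auto simp: H4_def)
  show "H4 \<noteq> {}" using P_in_H4_iff[of 0] by auto
  fix \<sigma> assume s: "\<sigma> \<in> H4"
  then obtain i where i: "\<sigma> \<in> carrier \<Gamma>" "4 dvd i" "\<And>x. x \<in> cyclotomic p \<Longrightarrow> \<sigma> x = P i x"
    by (auto simp: H4_def)
  have Cp: "P j x \<in> cyclotomic p" if "x \<in> cyclotomic p" for j x
    by (rule hom_cyclotomic_stable[OF subfield_K Gal_hom[OF P_mem] p0 Cp_sub_K that])
  have inv: "inv\<^bsub>\<Gamma>\<^esub> \<sigma> \<in> carrier \<Gamma>" using i by simp
  obtain j where j: "\<And>x. x \<in> cyclotomic p \<Longrightarrow> (inv\<^bsub>\<Gamma>\<^esub> \<sigma>) x = P j x"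
    using eq_power_on_Cp[OF inv] by blast
  have "P (i + j) zp = \<sigma> ((inv\<^bsub>\<Gamma>\<^esub> \<sigma>) zp)"
    using P_add[OF zp_mem(2)] i(3)[OF Cp[OF zp_mem(1)]] j[OF zp_mem(1)] by simp
  also have "\<dots> = zp"
    using Gal_mult[OF i(1) inv zp_mem(2)] i(1) by (simp add: Gal_one zp_mem)
  also have "\<dots> = P 0 zp" using P_0 zp_mem by simp
  finally have "[i + j = 0] (mod p - 1)" by (simp only: P_zp_eq_iff)
  then have "4 dvd i + j" using four_dvd cong_0_iff dvd_trans by blast
  then have "4 dvd j" using i(2) by (simp add: dvd_add_right_iff)
  with j inv show "inv\<^bsub>\<Gamma>\<^esub> \<sigma> \<in> H4" by (auto simp: H4_def)
  fix \<tau> assume "\<tau> \<in> H4"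
  then obtain k where k: "\<tau> \<in> carrier \<Gamma>" "4 dvd k" "\<And>x. x \<in> cyclotomic p \<Longrightarrow> \<tau> x = P k x"
    by (auto simp: H4_def)
  have "(\<sigma> \<otimes>\<^bsub>\<Gamma>\<^esub> \<tau>) x = P (i + k) x" if x: "x \<in> cyclotomic p" for x
  proof -
    have xK: "x \<in> K" using x Cp_sub_K by blast
    show ?thesis unfolding Gal_mult[OF i(1) k(1) xK] P_add[OF xK] k(3)[OF x] i(3)[OF Cp[OF x]] ..
  qed
  with i k show "\<sigma> \<otimes>\<^bsub>\<Gamma>\<^esub> \<tau> \<in> H4" unfolding H4_def by (auto intro!: exI[of _ "i + k"] G.m_closed)
qed

definition Tq where "Tq = {x \<in> K. \<forall>\<sigma>\<in>H4. \<sigma> x = x}"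

lemma Gal_Tq: "carrier (Gal K Tq) = H4"
  unfolding Tq_def by (rule galois_degree_fixed_field[OF galois_degree_K subgroup_H4])

lemma subfield_Tq: "subfield Tq CC"
  unfolding Tq_def by (rule subfield_fixed[OF subfield_K]) (auto simp: H4_def)

lemma Tq_sub_Cp: "Tq \<subseteq> cyclotomic p"
proof -
  have "carrier (Gal K (cyclotomic p)) \<subseteq> H4"
  proof
    fix \<sigma> assume s: "\<sigma> \<in> carrier (Gal K (cyclotomic p))"
    then have "\<sigma> \<in> carrier \<Gamma>" using Gal_mono[OF Rats_subset_subfield[OF subfield_cyclotomic]] by blast
    moreover have "\<forall>x\<in>cyclotomic p. \<sigma> x = P 0 x" using Gal_fix[OF s] P_0 Cp_sub_K by auto
    ultimately show "\<sigma> \<in> H4" unfolding H4_def by (auto intro!: exI[of _ 0])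
  qed
  then have "Tq \<subseteq> {x \<in> K. \<forall>\<sigma>\<in>carrier (Gal K (cyclotomic p)). \<sigma> x = x}" by (auto simp: Tq_def)
  also have "\<dots> = cyclotomic p"
    by (rule fixed_field_Gal[OF galois_degree_K subfield_cyclotomic Rats_subset_subfield[OF subfield_cyclotomic] Cp_sub_K])
  finally show ?thesis .
qed

lemma Tq_sub: "Tq \<subseteq> B" "Tq \<subseteq> K"
  using Tq_sub_Cp cyclotomic_p_sub_B Cp_sub_K by auto

lemma P_fixes_Tq_iff: "(\<forall>x\<in>Tq. P d x = x) \<longleftrightarrow> 4 dvd d"
proof -
  have "(\<forall>x\<in>Tq. P d x = x) \<longleftrightarrow> P d \<in> carrier (Gal K Tq)"
    using Gal_subI[OF P_mem] Gal_fix by blast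
  then show ?thesis unfolding Gal_Tq P_in_H4_iff .
qed

lemma P_eq_cancel:
  assumes "S \<subseteq> K" "\<forall>x\<in>S. P i x = P (i + d) x" shows "\<forall>x\<in>S. P d x = x"
proof
  fix x assume "x \<in> S"
  then have x: "x \<in> K" "P i x = P i (P d x)" using assms P_add by auto
  then show "P d x = x" using hom_on_inj[OF subfield_K Gal_hom[OF P_mem] x(1) Gal_in[OF P_mem x(1)]] by metis
qed

lemma P_eq_on_Tq_iff: "(\<forall>x\<in>Tq. P i x = P j x) \<longleftrightarrow> [i = j] (mod 4)"
proof -
  have *: "(\<forall>x\<in>Tq. P i x = P (i + d) x) \<longleftrightarrow> [i = i + d] (mod 4)" for i d
  proof -
    have "(\<forall>x\<in>Tq. P i x = P (i + d) x) \<longleftrightarrow> (\<forall>x\<in>Tq. P d x = x)"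
      using P_eq_cancel[OF Tq_sub(2), of i d] P_add Tq_sub(2) by auto
    also have "\<dots> \<longleftrightarrow> [i = i + d] (mod 4)"
      unfolding P_fixes_Tq_iff cong_sym_eq[of i "i + d"] cong_add_lcancel_0_nat cong_0_iff ..
    finally show ?thesis .
  qed
  show ?thesis
  proof (cases "i \<le> j")
    case True
    with *[of i "j - i"] show ?thesis by simp
  next
    case False
    with *[of j "i - j"] show ?thesis by (simp add: cong_sym_eq eq_commute)
  qed
qed

text \<open>A discrete logarithm of the action on \<open>\<zeta>\<^sub>p\<close>; it is determined modulo
  \<open>p - 1\<close>, hence modulo 4.\<close>

definition lg where "lg \<sigma> = (SOME j. \<forall>x\<in>cyclotomic p. \<sigma> x = P j x)"

lemma lg: "\<sigma> \<in> carrier \<Gamma> \<Longrightarrow> x \<in> cyclotomic p \<Longrightarrow> \<sigma> x = P (lg \<sigma>) x"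
  unfolding lg_def using someI_ex[OF eq_power_on_Cp] by blast

lemma lg_P: "[lg (P j) = j] (mod p - 1)"
  using lg[OF P_mem zp_mem(1), of j] by (metis P_zp_eq_iff)

lemma eq_on_Tq_iff:
  assumes "\<sigma> \<in> carrier \<Gamma>" "\<tau> \<in> carrier \<Gamma>"
  shows "lg \<sigma> mod 4 = lg \<tau> mod 4 \<longleftrightarrow> (\<forall>x\<in>Tq. \<sigma> x = \<tau> x)"
proof -
  have "(\<forall>x\<in>Tq. \<sigma> x = \<tau> x) \<longleftrightarrow> (\<forall>x\<in>Tq. P (lg \<sigma>) x = P (lg \<tau>) x)"
    using lg[OF assms(1)] lg[OF assms(2)] Tq_sub_Cp by (auto simp: subset_iff)
  then show ?thesis unfolding P_eq_on_Tq_iff by (simp add: cong_def)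
qed

lemma has_degree_Tq: "has_degree Tq \<rat> 4"
proof -
  have "has_degree Tq \<rat> (card ((\<lambda>\<sigma>. lg \<sigma> mod 4) ` carrier \<Gamma>))"
    by (rule has_degree_via_restrictions[OF galois_degree_K subfield_Rats subfield_Tq _ Rats_subset_subfield[OF subfield_Tq] Tq_sub(2)])
      (simp_all add: eq_on_Tq_iff)
  also have "(\<lambda>\<sigma>. lg \<sigma> mod 4) ` carrier \<Gamma> = {..<4}"
  proof (intro equalityI subsetI)
    fix j :: nat assume "j \<in> {..<4}"
    moreover have "[lg (P j) = j] (mod 4)" using lg_P four_dvd cong_dvd_modulus_nat by blast
    ultimately have "j = lg (P j) mod 4" by (simp add: cong_def)
    then show "j \<in> (\<lambda>\<sigma>. lg \<sigma> mod 4) ` carrier \<Gamma>" using P_mem by blast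
  qed auto
  finally show ?thesis by simp
qed

text \<open>A quartic subfield \<open>T\<close> of the \<open>p\<close>-th cyclotomic field admits exactly
  four restrictions, all of them powers of one. So the least positive \<open>d\<close> for which the
  power \<open>d\<close> is trivial on \<open>T\<close> is 4, and \<open>H4\<close> fixes
  \<open>T\<close>.\<close>

lemma Tq_unique:
  assumes T: "T \<subseteq> cyclotomic p" "has_degree T \<rat> 4"
  shows "T = Tq"
proof -
  have sT: "subfield T CC" using has_degreeD[OF T(2)] by blast
  have TK: "T \<subseteq> K" using T(1) Cp_sub_K by blast
  define q where "q = (\<lambda>\<sigma>::complex \<Rightarrow> complex. restrict \<sigma> T)"
  have q_iff: "q \<sigma> = q \<tau> \<longleftrightarrow> (\<forall>x\<in>T. \<sigma> x = \<tau> x)" for \<sigma> \<tau> by (auto simp: q_def fun_eq_iff)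
  have "has_degree T \<rat> (card (q ` carrier \<Gamma>))"
    by (rule has_degree_via_restrictions[OF galois_degree_K subfield_Rats sT _ Rats_subset_subfield[OF sT] TK])
      (simp_all add: q_iff)
  then have card4: "card (q ` carrier \<Gamma>) = 4" by (rule has_degree_unique[OF _ T(2)])
  have fin: "finite (q ` carrier \<Gamma>)" using galois_degreeD(6)[OF galois_degree_K] by simp
  have "\<not> inj_on (\<lambda>j. q (P j)) {..4::nat}"
  proof
    assume "inj_on (\<lambda>j. q (P j)) {..4::nat}"
    from card_image[OF this] have "card ((\<lambda>j. q (P j)) ` {..4}) = 5" by simp
    moreover have "card ((\<lambda>j. q (P j)) ` {..4}) \<le> card (q ` carrier \<Gamma>)"
      using P_mem by (intro card_mono[OF fin]) auto
    ultimately show False using card4 by simp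
  qed
  then obtain i j where ij: "i < j" "j \<le> 4" "q (P i) = q (P j)"
    unfolding inj_on_def by (metis atMost_iff linorder_neqE_nat)
  define d where "d = j - i"
  have d: "0 < d" "d \<le> 4" "\<forall>x\<in>T. P d x = x"
    using ij q_iff P_eq_cancel[OF TK, of i d] by (auto simp: d_def)
  have mult: "\<forall>x\<in>T. P (d * k) x = x" for k
    using d(3) TK P_add P_0 by (induction k) (auto simp: subset_iff)
  have "q ` carrier \<Gamma> \<subseteq> (\<lambda>j. q (P j)) ` {..<d}"
  proof
    fix r assume "r \<in> q ` carrier \<Gamma>"
    then obtain \<sigma> where s: "\<sigma> \<in> carrier \<Gamma>" "r = q \<sigma>" by blast
    have "\<sigma> x = P (lg \<sigma> mod d) x" if x: "x \<in> T" for x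
    proof -
      have "\<sigma> x = P (lg \<sigma> mod d + d * (lg \<sigma> div d)) x" using lg[OF s(1)] x T(1) by auto
      also have "\<dots> = P (lg \<sigma> mod d) (P (d * (lg \<sigma> div d)) x)" by (rule P_add) (use x TK in blast)
      also have "P (d * (lg \<sigma> div d)) x = x" using mult x by blast
      finally show ?thesis .
    qed
    then have "r = q (P (lg \<sigma> mod d))" using s(2) q_iff by simp
    then show "r \<in> (\<lambda>j. q (P j)) ` {..<d}" using d(1) by auto
  qed
  from card_mono[OF _ this] card4 have "4 \<le> card ((\<lambda>j. q (P j)) ` {..<d})" by simp
  also have "\<dots> \<le> d" using card_image_le[of "{..<d}" "\<lambda>j. q (P j)"] by simp
  finally have "d = 4" using d(2) by simp
  have "T \<subseteq> Tq"
  proof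
    fix x assume x: "x \<in> T"
    have "\<sigma> x = x" if h: "\<sigma> \<in> H4" for \<sigma>
    proof -
      obtain j where "4 dvd j" "\<sigma> x = P j x" using h x T(1) by (auto simp: H4_def)
      then show ?thesis using mult x \<open>d = 4\<close> by (auto elim!: dvdE)
    qed
    then show "x \<in> Tq" using x TK by (auto simp: Tq_def)
  qed
  from has_degree_intermediate[OF has_degree_Tq sT Rats_subset_subfield[OF sT] this]
  obtain m k where mk: "has_degree T \<rat> m" "has_degree Tq T k" "4 = m * k" by blast
  have "m = 4" by (rule has_degree_unique[OF mk(1) T(2)])
  with mk(3) have "k = 1" by simp
  with mk(2) show ?thesis unfolding \<open>k = 1\<close> has_degree_1_iff by simp
qed

lemma T_field_eq: "T_field p = Tq"
  unfolding T_field_def 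
  by (rule the_equality, rule conjI[OF Tq_sub_Cp has_degree_Tq], elim conjE, rule Tq_unique)

lemma rho_sp: "rho sp = - sp"
proof -
  have sK: "sp \<in> K" using sp_mem Cp_sub_K by blast
  have h: "rho sp = sp \<or> rho sp = - sp"
    using hom_signs(3)[OF subfield_K Gal_hom[OF rho(1)]] F_sub_B B_sub_K by (metis subset_trans)
  moreover have "rho sp \<noteq> sp"
  proof
    assume "rho sp = sp"
    then have "P (Suc j) sp = P j sp" for j using P_add[OF sK, of j 1] P_1 by simp
    then have "P j sp = sp" for j using P_0[OF sK] by (induction j) simp_all
    then have "\<sigma> sp = sp" if "\<sigma> \<in> carrier \<Gamma>" for \<sigma> using lg[OF that sp_mem] by simp
    moreover obtain \<sigma> where "\<sigma> \<in> carrier \<Gamma>" "bits \<sigma> = (False, False, True)" using K_bits_surj by blast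
    ultimately show False by (auto simp: bits_def)
  qed
  ultimately show ?thesis by blast
qed

lemma P_sp: "P j sp = (if even j then sp else - sp)"
proof (induction j)
  case 0
  show ?case using P_0 sp_mem Cp_sub_K by auto
next
  case (Suc j)
  have sK: "sp \<in> K" using sp_mem Cp_sub_K by blast
  have "P (Suc j) sp = P j (- sp)" using P_add[OF sK, of j 1] P_1 rho_sp by simp
  also have "\<dots> = - P j sp" by (rule hom_on_minus[OF subfield_K Gal_hom[OF P_mem] sK])
  finally show ?case using Suc by simp
qed

text \<open>Already the square of an automorphism fixes \<open>\<surd>p\<close>.\<close>

lemma sp_in_Tq: "sp \<in> Tq"
proof -
  have "\<sigma> sp = sp" if "\<sigma> \<in> H4" for \<sigma>
  proof -
    obtain j where "4 dvd j" "\<sigma> sp = P j sp" using \<open>\<sigma> \<in> H4\<close> sp_mem by (auto simp: H4_def)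
    moreover from this have "even j" by presburger
    ultimately show ?thesis using P_sp by simp
  qed
  then show ?thesis using sp_mem Cp_sub_K by (auto simp: Tq_def)
qed

lemma Tq_stable: assumes s: "\<sigma> \<in> carrier \<Gamma>" and x: "x \<in> Tq" shows "\<sigma> x \<in> Tq"
proof -
  have "\<tau> (\<sigma> x) = \<sigma> x" if "\<tau> \<in> H4" for \<tau>
  proof -
    have "\<tau> (\<sigma> x) = \<sigma> (\<tau> x)" using that s x Tq_sub by (intro commute_on_B) (auto simp: H4_def)
    moreover have "\<tau> x = x" using x that by (simp add: Tq_def)
    ultimately show ?thesis by simp
  qed
  then show ?thesis using Gal_in[OF s] x by (auto simp: Tq_def)
qed

end

section \<open>The fields \<open>A\<close> and \<open>M\<close>\<close>

text \<open>Kummer theory for square roots: recording the signs at \<open>r\<close> elements is an injective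
  homomorphism, which is onto by cardinality.\<close>

lemma Gal_iso_elementary_abelian:
  assumes L: "subfield L CC" "k \<subseteq> L" and x: "\<And>j. j < r \<Longrightarrow> x j \<in> L \<and> x j \<noteq> 0"
    and sign: "\<And>\<sigma> j. \<sigma> \<in> carrier (Gal L k) \<Longrightarrow> j < r \<Longrightarrow> \<sigma> (x j) = x j \<or> \<sigma> (x j) = - x j"
    and det: "\<And>\<sigma> \<tau>. \<sigma> \<in> carrier (Gal L k) \<Longrightarrow> \<tau> \<in> carrier (Gal L k) \<Longrightarrow> (\<And>j. j < r \<Longrightarrow> \<sigma> (x j) = \<tau> (x j)) \<Longrightarrow> \<sigma> = \<tau>"
    and card: "card (carrier (Gal L k)) = 2 ^ r"
  shows "Gal L k \<cong> product_group {..<r} (\<lambda>_. integer_mod_group 2)"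
proof -
  let ?H = "carrier (Gal L k)"
  let ?Pi = "product_group {..<r} (\<lambda>_. integer_mod_group 2)"
  define \<phi> :: "(complex \<Rightarrow> complex) \<Rightarrow> nat \<Rightarrow> int"
    where "\<phi> = (\<lambda>\<sigma>. \<lambda>j\<in>{..<r}. if \<sigma> (x j) = x j then 0 else 1)"
  have carr: "carrier ?Pi = (\<Pi>\<^sub>E j\<in>{..<r}. {0..<2})"
    by (simp add: carrier_integer_mod_group)
  have hom: "\<phi> \<in> hom (Gal L k) ?Pi"
  proof (rule homI)
    fix \<sigma> assume s: "\<sigma> \<in> ?H"
    show "\<phi> \<sigma> \<in> carrier ?Pi" unfolding carr by (auto simp: \<phi>_def)
    fix \<tau> assume t: "\<tau> \<in> ?H"
    show "\<phi> (\<sigma> \<otimes>\<^bsub>Gal L k\<^esub> \<tau>) = \<phi> \<sigma> \<otimes>\<^bsub>?Pi\<^esub> \<phi> \<tau>"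
    proof (rule extensionalityI[of _ "{..<r}"])
      fix j assume "j \<in> {..<r}"
      then have j: "j < r" by simp
      have xL: "x j \<in> L" and x0: "x j \<noteq> - x j" using x[OF j] by (auto simp: eq_neg_iff_add_eq_0)
      have neg: "\<sigma> (- x j) = - \<sigma> (x j)" by (rule hom_on_minus[OF L(1) Gal_hom[OF s] xL])
      have "(if \<sigma> (\<tau> (x j)) = x j then 0 else 1 :: int)
          = ((if \<sigma> (x j) = x j then 0 else 1) + (if \<tau> (x j) = x j then 0 else 1)) mod 2"
        using sign[OF s j] sign[OF t j] x0 by (elim disjE) (simp_all add: neg)
      then show "\<phi> (\<sigma> \<otimes>\<^bsub>Gal L k\<^esub> \<tau>) j = (\<phi> \<sigma> \<otimes>\<^bsub>?Pi\<^esub> \<phi> \<tau>) j"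
        using j by (simp add: \<phi>_def Gal_mult[OF s t xL])
    qed (auto simp: \<phi>_def)
  qed
  have inj: "inj_on \<phi> ?H"
  proof (rule inj_onI)
    fix \<sigma> \<tau> assume st: "\<sigma> \<in> ?H" "\<tau> \<in> ?H" and eq: "\<phi> \<sigma> = \<phi> \<tau>"
    have "\<sigma> (x j) = \<tau> (x j)" if j: "j < r" for j
    proof -
      have "\<sigma> (x j) = x j \<longleftrightarrow> \<tau> (x j) = x j"
        using fun_cong[OF eq, of j] j by (simp add: \<phi>_def split: if_splits)
      then show ?thesis using sign[OF st(1) j] sign[OF st(2) j] by auto
    qed
    then show "\<sigma> = \<tau>" by (rule det[OF st])
  qed
  have "\<phi> ` ?H = carrier ?Pi"
  proof (rule card_subset_eq)
    show "finite (carrier ?Pi)" unfolding carr by (intro finite_PiE) auto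
    show "\<phi> ` ?H \<subseteq> carrier ?Pi" using hom by (auto simp: hom_def)
    show "card (\<phi> ` ?H) = card (carrier ?Pi)"
      unfolding card_image[OF inj] card carr by (simp add: card_PiE)
  qed
  then have "\<phi> \<in> iso (Gal L k) ?Pi" using hom inj by (auto simp: iso_def bij_betw_def)
  then show ?thesis by (auto simp: is_iso_def)
qed

context quadratic_form_prime
begin

abbreviation "A \<equiv> A_field p"
abbreviation "M \<equiv> M_field p a b"

lemma A_eq: "A = compositum (cyclotomic 16) Tq"
  by (simp add: A_field_def T_field_eq)

lemma subfield_A: "subfield A CC" and subfield_M: "subfield M CC"
  by (simp_all add: A_eq M_field_def subfield_compositum)

lemma A_parts: "cyclotomic 16 \<subseteq> A" "Tq \<subseteq> A"
  unfolding A_eq by (rule compositum_upper)+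

lemma M_parts: "A \<subseteq> M" "N \<subseteq> M"
  unfolding M_field_def by (rule compositum_upper)+

lemma A_sub_B: "A \<subseteq> B"
  unfolding A_eq by (rule compositum_least[OF subfield_B cyclotomic_16_sub_B Tq_sub(1)])

lemma A_sub_K: "A \<subseteq> K" using A_sub_B B_sub_K by blast

lemma M_sub_K: "M \<subseteq> K"
  unfolding M_field_def by (rule compositum_least[OF subfield_K A_sub_K N_sub_K])

lemma F_sub_A: "F \<subseteq> A"
  using i_sqrt2_in_cyclotomic_16 A_parts sp_in_Tq by (intro F_least[OF subfield_A]) auto

lemma N_eq_compositum: "compositum F N = N"
  using compositum_least[OF subfield_N F_sub_N order_refl] compositum_upper(2)[of N F] by blast

lemma F_sub_K: "F \<subseteq> K" using F_sub_B B_sub_K by blast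

lemma F_stable: "\<sigma> \<in> carrier \<Gamma> \<Longrightarrow> x \<in> F \<Longrightarrow> \<sigma> x \<in> F"
proof -
  assume s: "\<sigma> \<in> carrier \<Gamma>" and x: "x \<in> F"
  have "F \<subseteq> {x \<in> K. \<sigma> x \<in> F}"
    using hom_on_roots_mem(1-3)[OF subfield_K Gal_hom[OF s] N_sub_K] F_gens F_sub_K
    by (intro F_least[OF subfield_hom_vimage[OF subfield_K Gal_hom[OF s] subfield_F]]) auto
  with x show ?thesis by blast
qed

lemma N_stable: "\<sigma> \<in> carrier \<Gamma> \<Longrightarrow> x \<in> N \<Longrightarrow> \<sigma> x \<in> N"
proof -
  assume s: "\<sigma> \<in> carrier \<Gamma>" and x: "x \<in> N"
  have "F \<subseteq> {x \<in> K. \<sigma> x \<in> N}" using F_stable[OF s] F_sub_K F_sub_N by auto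
  then have "N \<subseteq> {x \<in> K. \<sigma> x \<in> N}"
    using hom_on_roots_mem(4-6)[OF subfield_K Gal_hom[OF s] N_sub_K] N_gens N_sub_K
    by (intro N_least[OF subfield_hom_vimage[OF subfield_K Gal_hom[OF s] subfield_N]]) auto
  with x show ?thesis by blast
qed

lemma compositum_stable:
  assumes s: "\<sigma> \<in> carrier \<Gamma>" and V: "V \<subseteq> K" "\<And>x. x \<in> V \<Longrightarrow> \<sigma> x \<in> V"
    and W: "W \<subseteq> K" "\<And>x. x \<in> W \<Longrightarrow> \<sigma> x \<in> W" and x: "x \<in> compositum V W"
  shows "\<sigma> x \<in> compositum V W"
proof -
  have "compositum V W \<subseteq> {x \<in> K. \<sigma> x \<in> compositum V W}"
    using V W compositum_upper[where K=V and L=W]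
    by (intro compositum_least[OF subfield_hom_vimage[OF subfield_K Gal_hom[OF s] subfield_compositum]]) auto
  with x show ?thesis by blast
qed

lemma B_stable: "\<sigma> \<in> carrier \<Gamma> \<Longrightarrow> x \<in> B \<Longrightarrow> \<sigma> x \<in> B"
  using hom_cyclotomic_stable[OF subfield_K Gal_hom, of \<sigma> \<rat> "16 * p" x] p0 B_sub_K
  by (simp add: B_field_def)

lemma A_stable: assumes "\<sigma> \<in> carrier \<Gamma>" "x \<in> A" shows "\<sigma> x \<in> A"
proof -
  have "cyclotomic 16 \<subseteq> K" using A_parts A_sub_K by blast
  then show ?thesis
    using compositum_stable[OF assms(1) _ hom_cyclotomic_stable[OF subfield_K Gal_hom[OF assms(1)]]
        Tq_sub(2) Tq_stable[OF assms(1)], of 16 x] assms(2) by (simp add: A_eq)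
qed

lemma M_stable: assumes "\<sigma> \<in> carrier \<Gamma>" "x \<in> M" shows "\<sigma> x \<in> M"
  using compositum_stable[OF assms(1) A_sub_K A_stable[OF assms(1)] N_sub_K N_stable[OF assms(1)]] assms(2)
  by (simp add: M_field_def)

text \<open>Commutators fix \<open>C\<close> and realize all eight sign patterns. The cases \<open>C =
  F\<close> and \<open>C = A\<close> give the degrees of \<open>N\<close> over \<open>F\<close> and
  of \<open>M\<close> over \<open>A\<close>.\<close>

lemma has_degree_compositum_N:
  assumes C: "subfield C CC" "F \<subseteq> C" "C \<subseteq> B"
  shows "has_degree (compositum C N) C 8"
proof -
  have CK: "C \<subseteq> K" using C(3) B_sub_K by blast
  have sub: "compositum C N \<subseteq> K" by (rule compositum_least[OF subfield_K CK N_sub_K])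
  have "has_degree (compositum C N) C (card (signs ` carrier (Gal K C)))"
  proof (rule has_degree_via_restrictions[OF galois_degree_K C(1) subfield_compositum
        Rats_subset_subfield[OF C(1)] compositum_upper(1) sub])
    fix \<sigma> \<tau> assume "\<sigma> \<in> carrier (Gal K C)" "\<tau> \<in> carrier (Gal K C)"
    then show "signs \<sigma> = signs \<tau> \<longleftrightarrow> (\<forall>x\<in>compositum C N. \<sigma> x = \<tau> x)"
      by (intro agree_on_compositum_signs[OF subfield_K _ _ C(2) sub]) (auto intro: Gal_hom Gal_fix)
  qed
  moreover have "signs ` carrier (Gal K C) = UNIV"
    using wedge_group.s_surj[OF wedge_group_K(1)] Gal_mono[OF C(3), of K] by blast
  ultimately show ?thesis by (simp add: card_bits)
qed

text \<open>Automorphisms that fix \<open>T\<^sub>p\<close> still move \<open>\<zeta>\<^sub>1\<^sub>6\<close>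
  to each of its eight conjugates.\<close>

lemma has_degree_A_Tq: "has_degree A Tq 8"
proof -
  have zK: "z16 \<in> K" using cyclotomic_root_mem[of 16] A_parts A_sub_K by auto
  have "has_degree A Tq (card ((\<lambda>\<sigma>. \<sigma> z16) ` carrier (Gal K Tq)))"
  proof (rule has_degree_via_restrictions[OF galois_degree_K subfield_Tq subfield_A
        Rats_subset_subfield[OF subfield_Tq] A_parts(2) A_sub_K])
    fix \<sigma> \<tau> assume st: "\<sigma> \<in> carrier (Gal K Tq)" "\<tau> \<in> carrier (Gal K Tq)"
    show "\<sigma> z16 = \<tau> z16 \<longleftrightarrow> (\<forall>x\<in>A. \<sigma> x = \<tau> x)"
    proof
      assume eq: "\<sigma> z16 = \<tau> z16"
      have "cyclotomic 16 \<subseteq> {x \<in> K. \<sigma> x = \<tau> x}"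
        using hom_determined_on_cyclotomic[OF subfield_K Gal_hom[OF st(1)] Gal_hom[OF st(2)], of 16] eq
          A_parts A_sub_K by auto
      moreover have "Tq \<subseteq> {x \<in> K. \<sigma> x = \<tau> x}"
        using Gal_fix[OF st(1)] Gal_fix[OF st(2)] Tq_sub(2) by auto
      ultimately have "A \<subseteq> {x \<in> K. \<sigma> x = \<tau> x}" unfolding A_eq
        by (rule compositum_least[OF subfield_hom_eq[OF subfield_K Gal_hom[OF st(1)] Gal_hom[OF st(2)]]])
      then show "\<forall>x\<in>A. \<sigma> x = \<tau> x" by auto
    next
      assume "\<forall>x\<in>A. \<sigma> x = \<tau> x"
      then show "\<sigma> z16 = \<tau> z16" using cyclotomic_root_mem[of 16] A_parts by auto
    qed
  qed
  also have "(\<lambda>\<sigma>. \<sigma> z16) ` carrier (Gal K Tq) = (\<lambda>i. z16 ^ (2 * i + 1)) ` {..<8}"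
  proof (intro equalityI subsetI)
    fix w assume "w \<in> (\<lambda>\<sigma>. \<sigma> z16) ` carrier (Gal K Tq)"
    then obtain \<sigma> where s: "\<sigma> \<in> carrier (Gal K Tq)" "w = \<sigma> z16" by blast
    note h = Gal_hom[OF s(1)]
    obtain m where m: "\<sigma> z16 = z16 ^ m"
      using hom_on_root_of_unity[OF subfield_K h, of 16] zK by auto
    \<comment> \<open>The number \<open>z16 ^ 8 = - 1\<close> is fixed, so the exponent must be odd.\<close>
    have z8: "z16 ^ 8 = - 1" unfolding DeMoivre by (simp add: complex_eq_iff)
    have "- 1 = \<sigma> (z16 ^ 8)"
      unfolding z8 using hom_on_minus[OF subfield_K h subfield_1[OF subfield_K]] hom_on_1[OF h] by simp
    also have "\<dots> = (z16 ^ 8) ^ m"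
      unfolding hom_on_power[OF subfield_K h zK] m by (simp only: power_mult[symmetric] mult.commute)
    finally have "odd m" unfolding z8 by (cases "even m") simp_all
    then obtain i where i: "m = 2 * i + 1" by (rule oddE)
    have "[m = 2 * (i mod 8) + 1] (mod 16)"
    proof -
      have "i = 8 * (i div 8) + i mod 8" by simp
      then have "m = 16 * (i div 8) + (2 * (i mod 8) + 1)" unfolding i by linarith
      then show ?thesis unfolding cong_def by (metis mod_mult_self4)
    qed
    then have "w = z16 ^ (2 * (i mod 8) + 1)"
      using cis_power_eq_iff[of 16 m "2 * (i mod 8) + 1"] s(2) m by simp
    then show "w \<in> (\<lambda>i. z16 ^ (2 * i + 1)) ` {..<8}" by (intro image_eqI[of _ _ "i mod 8"]) simp_all
  next
    fix w assume "w \<in> (\<lambda>i. z16 ^ (2 * i + 1)) ` {..<8}"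
    then obtain i where i: "w = z16 ^ (2 * i + 1)" by blast
    have "\<not> p dvd 1" using p(1) not_prime_unit by blast
    then obtain \<sigma> where s: "\<sigma> \<in> carrier \<Gamma>" "\<sigma> z16 = z16 ^ (2 * i + 1)" "\<sigma> zp = zp ^ 1"
      using \<Gamma>_automorphism[of "2 * i + 1" 1] by auto
    have "\<sigma> zp = P 0 zp" using s(3) P_0[OF zp_mem(2)] by simp
    then have "\<forall>x\<in>cyclotomic p. \<sigma> x = P 0 x" using agree_on_Cp[OF s(1) P_mem] by blast
    then have "\<sigma> \<in> H4" using s(1) unfolding H4_def by (auto intro!: exI[of _ 0])
    then show "w \<in> (\<lambda>\<sigma>. \<sigma> z16) ` carrier (Gal K Tq)" unfolding Gal_Tq using s(2) i by (intro image_eqI[of _ _ \<sigma>]) simp_all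
  qed
  also have "card ((\<lambda>i. z16 ^ (2 * i + 1)) ` {..<8}) = 8"
  proof -
    have "inj_on (\<lambda>i. z16 ^ (2 * i + 1)) {..<8}"
    proof (rule inj_onI)
      fix i j :: nat assume "i \<in> {..<8}" "j \<in> {..<8}" "z16 ^ (2 * i + 1) = z16 ^ (2 * j + 1)"
      then have "i < 8" "j < 8" "[2 * i + 1 = 2 * j + 1] (mod 16)"
        using cis_power_eq_iff[of 16 "2 * i + 1" "2 * j + 1"] by simp_all
      then show "i = j" by (simp add: cong_def)
    qed
    then show ?thesis by (simp add: card_image)
  qed
  finally show ?thesis .
qed

lemma has_degree_M: "has_degree M \<rat> 256"
  using has_degree_tower[OF has_degree_tower[OF has_degree_Tq has_degree_A_Tq]
      has_degree_compositum_N[OF subfield_A F_sub_A A_sub_B]]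
  by (simp add: M_field_def)

text \<open>On \<open>N\<close> every automorphism over \<open>F\<close> agrees with a commutator, and
  commutators fix \<open>B\<close>.\<close>

lemma N_inter_B: "N \<inter> B = F"
proof
  show "F \<subseteq> N \<inter> B" using F_sub_N F_sub_B by blast
  show "N \<inter> B \<subseteq> F"
  proof
    fix x assume x: "x \<in> N \<inter> B"
    have "\<sigma> x = x" if s: "\<sigma> \<in> carrier (Gal K F)" for \<sigma>
    proof -
      have "signs \<sigma> \<in> signs ` carrier (Gal K B)"
        using wedge_group.s_surj[OF wedge_group_K(1)] by blast
      then obtain u where u: "signs \<sigma> = signs u" "u \<in> carrier (Gal K B)" by (rule imageE)
      then have uF: "u \<in> carrier (Gal K F)" using Gal_mono[OF F_sub_B, of K] by blast
      have "\<forall>x\<in>compositum F N. \<sigma> x = u x"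
        using agree_on_compositum_signs[OF subfield_K Gal_hom[OF s] Gal_hom[OF uF] order_refl] u(1)
          Gal_fix[OF s] Gal_fix[OF uF] N_sub_K by (simp add: N_eq_compositum)
      then show ?thesis using x Gal_fix[OF u(2)] by (simp add: N_eq_compositum)
    qed
    moreover have "x \<in> K" using x N_sub_K by blast
    ultimately show "x \<in> F"
      using fixed_field_Gal[OF galois_degree_K subfield_F Rats_subset_subfield[OF subfield_F] F_sub_K] by blast
  qed
qed

lemma N_inter_A: "N \<inter> A = F"
  using N_inter_B A_sub_B F_sub_A F_sub_N by blast

lemma Gal_M: "carrier (Gal M \<rat>) = (\<lambda>\<sigma>. restrict \<sigma> M) ` carrier \<Gamma>"
  by (rule stable_intermediate(1)[OF galois_degree_K subfield_M Rats_subset_subfield[OF subfield_M] M_sub_K])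
    (rule M_stable)

lemma galois_degree_M: "galois_degree M \<rat> 256"
proof -
  have "galois_degree M \<rat> (card (carrier (Gal M \<rat>)))"
    by (rule stable_intermediate(2)[OF galois_degree_K subfield_M Rats_subset_subfield[OF subfield_M] M_sub_K])
      (rule M_stable)
  then show ?thesis using has_degree_unique[OF has_degree_M] by (simp add: galois_degree_def)
qed

lemma wedge_group_M:
  "wedge_group (Gal M \<rat>) bits (carrier (Gal M A)) signs"
  "{\<sigma> \<in> carrier (Gal M \<rat>). bits \<sigma> = (False, False, False)} = carrier (Gal M F)"
proof -
  have M: "M = compositum A N" by (simp add: M_field_def)
  have comm: "\<sigma> (\<tau> x) = \<tau> (\<sigma> x)"
    if st: "\<sigma> \<in> carrier (Gal M \<rat>)" "\<tau> \<in> carrier (Gal M \<rat>)" and x: "x \<in> A" for \<sigma> \<tau> x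
  proof -
    obtain \<sigma>' \<tau>' where *: "\<sigma>' \<in> carrier \<Gamma>" "\<sigma> = restrict \<sigma>' M" "\<tau>' \<in> carrier \<Gamma>" "\<tau> = restrict \<tau>' M"
      using st unfolding Gal_M by blast
    have "x \<in> M" "x \<in> B" using x M_parts A_sub_B by auto
    then show ?thesis
      using commute_on_B[OF *(1,3)] M_stable[OF *(1)] M_stable[OF *(3)] by (simp add: *(2,4))
  qed
  have surj: "\<exists>\<sigma>\<in>carrier (Gal M \<rat>). bits \<sigma> = v" for v
  proof -
    obtain \<sigma> where s: "\<sigma> \<in> carrier \<Gamma>" "bits \<sigma> = v" using K_bits_surj by blast
    have "\<i> \<in> M" "s2 \<in> M" "sp \<in> M" using F_gens F_sub_N M_parts by auto
    then have "bits (restrict \<sigma> M) = v" using s(2) by (simp add: bits_def)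
    then show ?thesis unfolding Gal_M using s(1) by blast
  qed
  show "wedge_group (Gal M \<rat>) bits (carrier (Gal M A)) signs"
    by (rule wedge_group_Gal(1)[OF has_degree_M subfield_A F_sub_A M], erule (2) comm, rule surj)
  show "{\<sigma> \<in> carrier (Gal M \<rat>). bits \<sigma> = (False, False, False)} = carrier (Gal M F)"
    by (rule wedge_group_Gal(2)[OF has_degree_M subfield_A F_sub_A M], erule (2) comm, rule surj)
qed

lemma wedge_Z:
  "wedge_group (Gal L \<rat>) bits U s \<Longrightarrow> wedge_group.Z (Gal L \<rat>) bits = {\<sigma> \<in> carrier (Gal L \<rat>). bits \<sigma> = (False, False, False)}"
  by (rule wedge_group.Z_def)

lemma card_Gal_M_F: "card (carrier (Gal M F)) = 32"
  using wedge_group.card_carrier[OF wedge_group_M(1)] galois_degreeD(2)[OF galois_degree_M]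
  unfolding wedge_Z[OF wedge_group_M(1)] wedge_group_M(2) by simp

lemma card_Gal_K_F: "card (carrier (Gal K F)) = 8 * (p - 1)"
  using wedge_group.card_carrier[OF wedge_group_K(1)] galois_degreeD(2)[OF galois_degree_K]
  unfolding wedge_Z[OF wedge_group_K(1)] wedge_group_K(2) by simp

text \<open>On \<open>T\<^sub>p\<close> an automorphism over \<open>F\<close> is an even power of the
  generator, so it is trivial or equal to the square \<open>P 2\<close>. A number in the
  \<open>-1\<close>-eigenspace of \<open>P 2\<close> tells the two cases apart.\<close>

lemma Tq_sign_generator:
  obtains t where "t \<in> Tq" "t \<noteq> 0" "\<And>\<sigma>. \<sigma> \<in> carrier (Gal K F) \<Longrightarrow> \<sigma> t = t \<or> \<sigma> t = - t"
    "\<And>\<sigma> x. \<sigma> \<in> carrier (Gal K F) \<Longrightarrow> \<sigma> t = t \<Longrightarrow> x \<in> Tq \<Longrightarrow> \<sigma> x = x"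
    "\<And>\<sigma> x. \<sigma> \<in> carrier (Gal K F) \<Longrightarrow> \<sigma> t = - t \<Longrightarrow> x \<in> Tq \<Longrightarrow> \<sigma> x = P 2 x"
proof -
  have "\<not> (\<forall>x\<in>Tq. P 2 x = x)" unfolding P_fixes_Tq_iff by simp
  then obtain x where x: "x \<in> Tq" "P 2 x \<noteq> x" by blast
  define t where "t = x - P 2 x"
  have t0: "t \<noteq> 0" using x by (simp add: t_def)
  have tT: "t \<in> Tq" unfolding t_def by (rule subfield_diff[OF subfield_Tq x(1) Tq_stable[OF P_mem x(1)]])
  have xK: "x \<in> K" "P 2 x \<in> K" using x(1) Tq_sub Tq_stable[OF P_mem x(1)] by auto
  have "P 2 t = P 2 x - P 2 (P 2 x)" unfolding t_def by (rule hom_on_diff[OF subfield_K Gal_hom[OF P_mem] xK])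
  also have "P 2 (P 2 x) = P (2 + 2) x" by (rule P_add[OF xK(1), symmetric])
  also have "\<dots> = x" using P_fixes_Tq_iff[of "2 + 2"] x(1) by simp
  finally have Pt: "P 2 t = - t" by (simp add: t_def)
  have alt: "(\<forall>x\<in>Tq. \<sigma> x = x) \<or> (\<forall>x\<in>Tq. \<sigma> x = P 2 x)" if s: "\<sigma> \<in> carrier (Gal K F)" for \<sigma>
  proof -
    have sG: "\<sigma> \<in> carrier \<Gamma>" using s Gal_mono[OF Rats_subset_subfield[OF subfield_F], of K] by blast
    have "P (lg \<sigma>) sp = sp" using lg[OF sG sp_mem] Gal_fix[OF s F_gens(3)] by simp
    then have "even (lg \<sigma>)" using P_sp[of "lg \<sigma>"] nonzero(2) by (auto simp: eq_neg_iff_add_eq_0 split: if_splits)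
    moreover have "even n \<Longrightarrow> n mod 4 = 0 mod 4 \<or> n mod 4 = 2 mod 4" for n :: nat by presburger
    ultimately have "[lg \<sigma> = 0] (mod 4) \<or> [lg \<sigma> = 2] (mod 4)" unfolding cong_def by blast
    then have "(\<forall>x\<in>Tq. P (lg \<sigma>) x = P 0 x) \<or> (\<forall>x\<in>Tq. P (lg \<sigma>) x = P 2 x)"
      unfolding P_eq_on_Tq_iff .
    moreover have "\<sigma> x = P (lg \<sigma>) x" "P 0 x = x" if "x \<in> Tq" for x
      using lg[OF sG] P_0 Tq_sub_Cp Tq_sub(2) that by auto
    ultimately show ?thesis by simp
  qed
  have ne: "t \<noteq> - t" using t0 by (simp add: eq_neg_iff_add_eq_0)
  show ?thesis
    by (rule that[OF tT t0]) (use alt Pt tT ne in metis)+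
qed

text \<open>The five signs are those of the roots of \<open>\<epsilon>\<close>, of \<open>\<surd>p\<close> and
  of \<open>\<alpha>\<close>, of \<open>\<zeta>\<^sub>1\<^sub>6\<close>, whose square lies in
  \<open>F\<close>, and of the generator of \<open>T\<^sub>p\<close> over
  \<open>\<rat>(\<surd>p)\<close> found above.\<close>

lemma Gal_M_F_iso: "Gal M F \<cong> product_group {..<5::nat} (\<lambda>_. integer_mod_group 2)"
proof -
  obtain t where t: "t \<in> Tq" "t \<noteq> 0" "\<And>\<sigma>. \<sigma> \<in> carrier (Gal K F) \<Longrightarrow> \<sigma> t = t \<or> \<sigma> t = - t"
    "\<And>\<sigma> x. \<sigma> \<in> carrier (Gal K F) \<Longrightarrow> \<sigma> t = t \<Longrightarrow> x \<in> Tq \<Longrightarrow> \<sigma> x = x"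
    "\<And>\<sigma> x. \<sigma> \<in> carrier (Gal K F) \<Longrightarrow> \<sigma> t = - t \<Longrightarrow> x \<in> Tq \<Longrightarrow> \<sigma> x = P 2 x"
    using Tq_sign_generator by blast
  have FM: "F \<subseteq> M" using F_sub_N M_parts by blast
  have lift: "\<exists>\<sigma>'\<in>carrier (Gal K F). \<forall>x\<in>M. \<sigma> x = \<sigma>' x" if s: "\<sigma> \<in> carrier (Gal M F)" for \<sigma>
  proof -
    have "\<sigma> \<in> carrier (Gal M \<rat>)" using s Gal_mono[OF Rats_subset_subfield[OF subfield_F], of M] by blast
    then obtain \<sigma>' where *: "\<sigma>' \<in> carrier \<Gamma>" "\<sigma> = restrict \<sigma>' M" unfolding Gal_M by blast
    have "\<sigma>' x = x" if "x \<in> F" for x using Gal_fix[OF s that] that FM *(2) by auto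
    then have "\<sigma>' \<in> carrier (Gal K F)" by (rule Gal_subI[OF *(1)])
    with *(2) show ?thesis by auto
  qed
  have z16M: "z16 \<in> M" using cyclotomic_root_mem[of 16] A_parts M_parts by auto
  have tM: "t \<in> M" using t(1) A_parts M_parts by blast
  have gM: "re \<in> M" "rp \<in> M" "ra \<in> M" using N_gens M_parts by auto
  have NM: "N \<subseteq> M" by (rule M_parts)
  have signs5: "\<sigma> re = re \<or> \<sigma> re = - re" "\<sigma> rp = rp \<or> \<sigma> rp = - rp" "\<sigma> ra = ra \<or> \<sigma> ra = - ra"
      "\<sigma> z16 = z16 \<or> \<sigma> z16 = - z16" "\<sigma> t = t \<or> \<sigma> t = - t"
    if s: "\<sigma> \<in> carrier (Gal M F)" for \<sigma>
  proof -
    have f: "\<sigma> \<i> = \<i>" "\<sigma> s2 = s2" "\<sigma> sp = sp" using Gal_fix[OF s] F_gens by auto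
    show "\<sigma> re = re \<or> \<sigma> re = - re" "\<sigma> rp = rp \<or> \<sigma> rp = - rp" "\<sigma> ra = ra \<or> \<sigma> ra = - ra"
      using hom_roots[OF subfield_M Gal_hom[OF s] NM] by (simp_all add: f)
    obtain \<sigma>' where "\<sigma>' \<in> carrier (Gal K F)" "\<forall>x\<in>M. \<sigma> x = \<sigma>' x" using lift[OF s] by blast
    then show "\<sigma> t = t \<or> \<sigma> t = - t" using t(3) tM by simp
    have "z16\<^sup>2 = s2 * (1 + \<i>) / 2"
      unfolding DeMoivre by (simp add: complex_eq_iff cos_45 sin_45)
    moreover have "s2 * (1 + \<i>) / 2 \<in> F"
      using F_gens subfield_of_nat[OF subfield_F, of 2] by (intro subfield_divide subfield_mult subfield_add subfield_1 subfield_F) simp_all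
    ultimately have "z16\<^sup>2 \<in> F" by (simp only:)
    then have "\<sigma> (z16\<^sup>2) = z16\<^sup>2" by (rule Gal_fix[OF s])
    then have "(\<sigma> z16)\<^sup>2 = z16\<^sup>2" using hom_on_power[OF subfield_M Gal_hom[OF s] z16M, of 2] by simp
    then show "\<sigma> z16 = z16 \<or> \<sigma> z16 = - z16" by (simp only: power2_eq_iff)
  qed
  define x where "x = (\<lambda>j::nat. [re, rp, ra, z16, t] ! j)"
  have all5: "(\<forall>j<5. Q (x j)) \<longleftrightarrow> Q re \<and> Q rp \<and> Q ra \<and> Q z16 \<and> Q t" for Q
    by (simp add: x_def eval_nat_numeral All_less_Suc) blast
  show ?thesis
  proof (rule Gal_iso_elementary_abelian[OF subfield_M FM, where x = x])
    have "\<forall>j<5. x j \<in> M \<and> x j \<noteq> 0"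
      unfolding all5[of "\<lambda>y. y \<in> M \<and> y \<noteq> 0"] using gM z16M tM nonzero t(2) by simp
    then show "x j \<in> M \<and> x j \<noteq> 0" if "j < 5" for j using that by blast
    show "\<sigma> (x j) = x j \<or> \<sigma> (x j) = - x j" if "\<sigma> \<in> carrier (Gal M F)" "j < 5" for \<sigma> j
    proof -
      have "\<forall>j<5. \<sigma> (x j) = x j \<or> \<sigma> (x j) = - x j"
        unfolding all5[of "\<lambda>y. \<sigma> y = y \<or> \<sigma> y = - y"] using signs5[OF that(1)] by blast
      then show ?thesis using that(2) by blast
    qed
    show "card (carrier (Gal M F)) = 2 ^ 5" by (simp add: card_Gal_M_F)
    fix \<sigma> \<tau> assume st: "\<sigma> \<in> carrier (Gal M F)" "\<tau> \<in> carrier (Gal M F)"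
      and "\<And>j. j < 5 \<Longrightarrow> \<sigma> (x j) = \<tau> (x j)"
    then have "\<forall>j<5. \<sigma> (x j) = \<tau> (x j)" by blast
    then have eq: "\<sigma> re = \<tau> re" "\<sigma> rp = \<tau> rp" "\<sigma> ra = \<tau> ra" "\<sigma> z16 = \<tau> z16" "\<sigma> t = \<tau> t"
      unfolding all5[of "\<lambda>y. \<sigma> y = \<tau> y"] by blast+
    note h = Gal_hom[OF st(1)] Gal_hom[OF st(2)]
    obtain \<sigma>' \<tau>' where l: "\<sigma>' \<in> carrier (Gal K F)" "\<forall>x\<in>M. \<sigma> x = \<sigma>' x"
        "\<tau>' \<in> carrier (Gal K F)" "\<forall>x\<in>M. \<tau> x = \<tau>' x"
      using lift[OF st(1)] lift[OF st(2)] by blast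
    have TM: "Tq \<subseteq> M" using A_parts M_parts by blast
    have "\<sigma> y = \<tau> y" if y: "y \<in> Tq" for y
    proof -
      have "\<sigma>' t = \<tau>' t" using eq(5) l tM by simp
      then have "\<sigma>' y = \<tau>' y" using t(3)[OF l(1)] t(4)[OF l(1) _ y] t(5)[OF l(1) _ y]
          t(4)[OF l(3) _ y] t(5)[OF l(3) _ y] by metis
      then show ?thesis using l y TM by auto
    qed
    then have "Tq \<subseteq> {x \<in> M. \<sigma> x = \<tau> x}" using TM by auto
    moreover have "cyclotomic 16 \<subseteq> {x \<in> M. \<sigma> x = \<tau> x}"
      using hom_determined_on_cyclotomic[OF subfield_M h, of 16] eq(4) A_parts M_parts by auto
    ultimately have "A \<subseteq> {x \<in> M. \<sigma> x = \<tau> x}"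
      unfolding A_eq by (intro compositum_least[OF subfield_hom_eq[OF subfield_M h]])
    then have Aeq: "\<sigma> x = \<tau> x" if "x \<in> A" for x using that by blast
    have M: "M = compositum A N" by (simp add: M_field_def)
    have "\<sigma> x = \<tau> x" if "x \<in> M" for x
      using agree_on_compositum[OF subfield_M h F_sub_A _ Aeq eq(1-3), of x] that M by simp
    then show "\<sigma> = \<tau>" by (rule Gal_eqI[OF st])
  qed
qed

lemma all_galois:
  "\<forall>L \<in> {F_field p, T_field p, N_field p a b, A_field p, M_field p a b, B_field p, BN_field p a b}.
     finite_galois L \<rat>"
proof -
  note st = stable_intermediate(3)[OF galois_degree_K _ Rats_subset_subfield]
  have "finite_galois F \<rat>" by (rule st[OF subfield_F subfield_F F_sub_K]) (rule F_stable)
  moreover have "finite_galois (T_field p) \<rat>"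
    unfolding T_field_eq by (rule st[OF subfield_Tq subfield_Tq Tq_sub(2)]) (rule Tq_stable)
  moreover have "finite_galois N \<rat>" by (rule st[OF subfield_N subfield_N N_sub_K]) (rule N_stable)
  moreover have "finite_galois A \<rat>" by (rule st[OF subfield_A subfield_A A_sub_K]) (rule A_stable)
  moreover have "finite_galois M \<rat>" by (rule st[OF subfield_M subfield_M M_sub_K]) (rule M_stable)
  moreover have "finite_galois B \<rat>" by (rule st[OF subfield_B subfield_B B_sub_K]) (rule B_stable)
  moreover have "finite_galois K \<rat>" by (rule st[OF subfield_K subfield_K order_refl]) (rule Gal_in)
  ultimately show ?thesis by blast
qed

end

theorem lemma4p12:
  fixes p :: nat and a b :: int
  assumes "Factorial_Ring.prime p" and "p mod 8 = 1"
    and "a > 0" and "b > 0" and "int p = a\<^sup>2 - 2 * b\<^sup>2"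
  shows
    "(\<exists>!T. T \<subseteq> cyclotomic p \<and> has_degree T \<rat> 4) \<and>
     (\<forall>L \<in> {F_field p, T_field p, N_field p a b, A_field p, M_field p a b, B_field p,
             BN_field p a b}. finite_galois L \<rat>) \<and>
     has_degree (N_field p a b) (F_field p) 8 \<and>
     N_field p a b \<inter> A_field p = F_field p \<and>
     N_field p a b \<inter> B_field p = F_field p \<and>
     has_degree (M_field p a b) \<rat> 256 \<and>
     has_degree (BN_field p a b) \<rat> (64 * (p - 1)) \<and>
     (let G = Gal (M_field p a b) \<rat>; H = Gal (M_field p a b) (F_field p) in
        group_center G = carrier H \<and>
        H \<cong> product_group {..<5::nat} (\<lambda>_. integer_mod_group 2) \<and>
        card (derived G (carrier G)) = 8 \<and>
        card {C \<in> conj_classes G. card C = 1} = 32 \<and>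
        card {C \<in> conj_classes G. card C = 4} = 56 \<and>
        (\<forall>C \<in> conj_classes G. card C = 1 \<or> card C = 4)) \<and>
     (let G' = Gal (BN_field p a b) \<rat> in
        card {C \<in> conj_classes G'. card C = 1} = 8 * (p - 1) \<and>
        card {C \<in> conj_classes G'. card C = 4} = 14 * (p - 1) \<and>
        (\<forall>C \<in> conj_classes G'. card C = 1 \<or> card C = 4))"
proof -
  interpret Q: quadratic_form_prime p a b by unfold_locales (fact assms)+
  note WM = Q.wedge_group_M(1) and WK = Q.wedge_group_K(1)
  note ZM = Q.wedge_Z[OF WM, unfolded Q.wedge_group_M(2)] and ZK = Q.wedge_Z[OF WK, unfolded Q.wedge_group_K(2)]
  have T: "\<exists>!T. T \<subseteq> cyclotomic p \<and> has_degree T \<rat> 4"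
    by (rule ex1I[of _ Q.Tq], rule conjI[OF Q.Tq_sub_Cp Q.has_degree_Tq], elim conjE, rule Q.Tq_unique)
  have NF: "has_degree (N_field p a b) (F_field p) 8"
    using Q.has_degree_compositum_N[OF Q.subfield_F order_refl Q.F_sub_B] unfolding Q.N_eq_compositum .
  have M4: "card {C \<in> conj_classes (Gal (M_field p a b) \<rat>). card C = 4} = 56"
    using wedge_group.card_classes_4[OF WM] unfolding ZM Q.card_Gal_M_F by simp
  have K4: "card {C \<in> conj_classes (Gal (BN_field p a b) \<rat>). card C = 4} = 14 * (p - 1)"
    using wedge_group.card_classes_4[OF WK] unfolding ZK Q.card_Gal_K_F by simp
  show ?thesis
    unfolding Let_def
    by (intro conjI ballI T NF M4 K4 Q.all_galois[rule_format] Q.N_inter_A Q.N_inter_B Q.has_degree_M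
        galois_degreeD(1)[OF Q.galois_degree_K] Q.Gal_M_F_iso
        wedge_group.center_eq[OF WM, unfolded ZM] wedge_group.card_derived[OF WM]
        wedge_group.card_classes_1[OF WM, unfolded ZM Q.card_Gal_M_F]
        wedge_group.card_classes_1[OF WK, unfolded ZK Q.card_Gal_K_F]
        wedge_group.conj_classes_card[OF WM] wedge_group.conj_classes_card[OF WK])
qed

end
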